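(* (1) There exists an elusive finite transitive permutation group $X$ of degree $5^2\cdot 3^2=225$ such that $X$ has a normal subgroup $N\cong \mathrm{C}_3^4\times \mathrm{C}_5^3$ with $X/N\cong \mathrm{A}_5$, $X$ does not split over $N$, and the point stabilizer of $X$ is isomorphic to a semidirect product $(\mathrm{C}_3^3\times\mathrm{C}_5^2){:}\mathrm{C}_2^2$. (2) There exists an elusive finite transitive permutation group $X$ of degree $5^2\cdot 3^2\cdot 2=450$ such that $X$ has a normal subgroup $N\cong \mathrm{C}_3^4\times \mathrm{C}_5^3$ with $X/N\cong \mathrm{A}_5$, $X$ does not split over $N$, and the point stabilizer of $X$ is isomorphic to a semidirect product $(\mathrm{C}_3^3\times\mathrm{C}_5^2){:}\mathrm{C}_2$.
   Context: All permutation groups act on finite sets. A derangement is a permutation with no fixed points. A transitive permutation group is elusive if it contains no derangements of prime order. $\mathrm{C}_n$ denotes the cyclic group of order $n$, $\mathrm{A}_5$ the alternating group of degree 5, and $A{:}B$ a semidirect product of a normal subgroup $A$ by $B$. "$X$ does not split over $N$" means $N$ has no complement in $X$. *)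

theory Defs
  imports "HOL-Algebra.Algebra"
begin

definition perm_group :: "nat \<Rightarrow> (nat \<Rightarrow> nat) set \<Rightarrow> (nat \<Rightarrow> nat) monoid" where
  "perm_group n H = (sym_group n)\<lparr>carrier := H\<rparr>"

definition transitive_perm_group :: "nat \<Rightarrow> (nat \<Rightarrow> nat) set \<Rightarrow> bool" where
  "transitive_perm_group n H \<longleftrightarrow> subgroup H (sym_group n) \<and>
     (\<forall>i\<in>{1..n}. \<forall>j\<in>{1..n}. \<exists>g\<in>H. g i = j)"

definition derangement :: "nat \<Rightarrow> (nat \<Rightarrow> nat) \<Rightarrow> bool" where
  "derangement n g \<longleftrightarrow> (\<forall>i\<in>{1..n}. g i \<noteq> i)"

definition elusive :: "nat \<Rightarrow> (nat \<Rightarrow> nat) set \<Rightarrow> bool" where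
  "elusive n H \<longleftrightarrow> transitive_perm_group n H \<and>
     \<not> (\<exists>g\<in>H. Factorial_Ring.prime (group.ord (sym_group n) g) \<and> derangement n g)"

text \<open>Point stabilizer of the point 1 (all point stabilizers are conjugate in a transitive group).\<close>
definition point_stabilizer :: "(nat \<Rightarrow> nat) set \<Rightarrow> (nat \<Rightarrow> nat) set" where
  "point_stabilizer H = {g \<in> H. g 1 = 1}"

definition elem_ab :: "nat \<Rightarrow> nat \<Rightarrow> (nat \<Rightarrow> int) monoid" where
  "elem_ab p k = product_group {..<k} (\<lambda>_. integer_mod_group p)"

definition splits_over :: "('a, 'b) monoid_scheme \<Rightarrow> 'a set \<Rightarrow> bool" where
  "splits_over G N \<longleftrightarrow> (\<exists>K. subgroup K G \<and> N \<inter> K = {\<one>\<^bsub>G\<^esub>} \<and> N <#>\<^bsub>G\<^esub> K = carrier G)"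

definition is_semidirect_product ::
  "('a, 'b) monoid_scheme \<Rightarrow> ('c, 'd) monoid_scheme \<Rightarrow> ('e, 'f) monoid_scheme \<Rightarrow> bool" where
  "is_semidirect_product G A B \<longleftrightarrow> (\<exists>K L. K \<lhd> G \<and> subgroup L G \<and>
     K \<inter> L = {\<one>\<^bsub>G\<^esub>} \<and> K <#>\<^bsub>G\<^esub> L = carrier G \<and>
     G\<lparr>carrier := K\<rparr> \<cong> A \<and> G\<lparr>carrier := L\<rparr> \<cong> B)"

end

theory Submission
  imports Defs "HOL-Analysis.Determinants"
begin

text \<open>
The group \<open>A\<^sub>5\<close> acts on the 4-dimensional sum-zero part of its permutation module over the field with 3 elements and,
as the index-2 subgroup of \<open>SO\<^sub>3(5)\<close>, on a 3-dimensional space over the field with 5 elements. Both modules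
have a non-split extension: the first consists of pairs of a permutation \<open>s\<close> of five points and a
vector \<open>t\<close> over the integers modulo 9 whose reduction modulo 3 is prescribed by a monomial representation,
the second of matrices in \<open>SO\<^sub>3\<close> over the integers modulo 25. The fifteen norm-one lines of the 5-dimensional
geometry form five orthonormal frames of three lines each, so requiring that \<open>M\<close> maps the line
\<open>k\<close> of frame \<open>i\<close> to the line \<open>k + t i\<close> of frame \<open>s i\<close> glues the two extensions into their fibre product over \<open>A\<^sub>5\<close>.

There, elements over a 3-cycle have order divisible by 9 (the shifts at the two fixed points do not
both vanish), and elements over a 5-cycle have order divisible by 25 (by the Cayley-Hamilton identity). Hence elements of order
3 and 5 lie in the kernel, where every vector has a conjugate in a suitable hyperplane invariant under the
Klein four-group, and involutions are all conjugate. So the action on the cosets of (hyperplanes):(subgroup of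
the Klein group) is elusive, and a complement to the kernel would contain an element of order 3 outside it.
\<close>

section \<open>Groups and their coset actions\<close>

text \<open>The stabilizer projects onto a 2-subgroup of \<open>A_5\<close>. An element of order 3
  or 5 outside the kernel would thus have no conjugate in the stabilizer and would be a derangement
  of prime order; this is the obstacle, and the non-split extensions are chosen so that no such
  element exists. The kernel has odd order, so the Klein four-group still lifts: diagonal sign
  matrices with zero shifts.

  Both hyperplanes are attached to the same involution \<open>(1 2)(3 4)\<close>. The form
  \<open>t 1 + t 2 - t 3 - t 4\<close> and the axis of the corresponding half-turn, the first
  coordinate axis, are preserved up to sign exactly by its centralizer, the Klein group. Each has
  fifteen images up to sign, one for every involution of \<open>A_5\<close>, and these fifteen
  hyperplanes cover the module. The indices multiply to \<open>3 * 5 * 15 = 225\<close>, and to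
  twice that for a subgroup of order 2.

  Congruence modulo 5 is written in the integers modulo 25 as equality after multiplication by 5,
  and congruence modulo 3 in the integers modulo 9 as equality after multiplication by 3, so that
  every component lives in a single ring.\<close>

lemma elem_ab_carrier:
  assumes "p > 0"
  shows "carrier (elem_ab p k) = (\<Pi>\<^sub>E i\<in>{..<k}. {0..<int p})"
  using assms by (simp add: elem_ab_def carrier_integer_mod_group)

lemma elem_ab_mult:
  "x \<otimes>\<^bsub>elem_ab p k\<^esub> y = (\<lambda>i\<in>{..<k}. (x i + y i) mod int p)"
  by (simp add: elem_ab_def)

lemma group_elem_ab: "group (elem_ab p k)"
  by (simp add: elem_ab_def)

lemma card_elem_ab:
  assumes "p > 0"
  shows "card (carrier (elem_ab p k)) = p ^ k"
  using assms by (simp add: elem_ab_carrier card_PiE)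

lemma elem_ab_cong:
  assumes "a \<in> carrier (elem_ab p k)" "b \<in> carrier (elem_ab p k)" "p > 0"
    and "\<And>i. i < k \<Longrightarrow> int p dvd a i - b i"
  shows "a = b"
proof (rule PiE_ext)
  show "a \<in> (\<Pi>\<^sub>E i\<in>{..<k}. {0..<int p})" "b \<in> (\<Pi>\<^sub>E i\<in>{..<k}. {0..<int p})"
    using assms(1-3) elem_ab_carrier by auto
next
  fix i assume i: "i \<in> {..<k}"
  have "a i \<in> {0..<int p}" "b i \<in> {0..<int p}"
    using assms(1-3) i elem_ab_carrier by (auto simp: PiE_iff)
  moreover have "a i mod int p = b i mod int p"
    using assms(4) i by (simp add: mod_eq_dvd_iff)
  ultimately show "a i = b i" by simp
qed

text \<open>The parametrization \<open>f\<close> takes arbitrary integer sequences, so its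
  additivity involves no reduction of representatives. The kernel condition makes \<open>f\<close>
  factor injectively through the residues.\<close>

lemma iso_elem_ab_DirProd:
  fixes f :: "(nat \<Rightarrow> int) \<Rightarrow> (nat \<Rightarrow> int) \<Rightarrow> 'a"
  assumes G: "group G" and p: "p > 0" "q > 0"
    and closed: "\<And>a b. f a b \<in> carrier G"
    and add: "\<And>a b c d. f (\<lambda>i. a i + c i) (\<lambda>i. b i + d i) = f a b \<otimes>\<^bsub>G\<^esub> f c d"
    and ker: "\<And>a b. f a b = \<one>\<^bsub>G\<^esub> \<longleftrightarrow> (\<forall>i<k. int p dvd a i) \<and> (\<forall>i<l. int q dvd b i)"
    and surj: "\<And>x. x \<in> carrier G \<Longrightarrow> \<exists>a b. x = f a b"
  shows "G \<cong> elem_ab p k \<times>\<times> elem_ab q l"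
proof -
  interpret G: group G by (rule G)
  let ?E = "elem_ab p k \<times>\<times> elem_ab q l"
  let ?f = "\<lambda>(a, b). f a b"
  have eq: "f a b = f c d \<longleftrightarrow> (\<forall>i<k. int p dvd a i - c i) \<and> (\<forall>i<l. int q dvd b i - d i)" for a b c d
  proof -
    have *: "f a b = f (\<lambda>i. a i - c i) (\<lambda>i. b i - d i) \<otimes>\<^bsub>G\<^esub> f c d"
      by (simp flip: add)
    have "f a b = f c d \<longleftrightarrow> f (\<lambda>i. a i - c i) (\<lambda>i. b i - d i) = \<one>\<^bsub>G\<^esub>"
      unfolding * using closed by (simp add: G.r_cancel_one)
    then show ?thesis by (simp add: ker)
  qed
  have "?f \<in> iso ?E G"
  proof (rule isoI)
    show "?f \<in> hom ?E G"
    proof (rule homI)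
      fix x y assume "x \<in> carrier ?E" "y \<in> carrier ?E"
      obtain a b c d where xy: "x = (a, b)" "y = (c, d)" by (metis surj_pair)
      show "?f (x \<otimes>\<^bsub>?E\<^esub> y) = ?f x \<otimes>\<^bsub>G\<^esub> ?f y"
        by (simp add: xy elem_ab_mult mod_eq_dvd_iff[symmetric] eq flip: add)
    qed (auto simp: closed)
    show "bij_betw ?f (carrier ?E) (carrier G)"
      unfolding bij_betw_def
    proof
      show "inj_on ?f (carrier ?E)"
        using p by (auto simp: inj_on_def eq intro: elem_ab_cong)
      show "?f ` carrier ?E = carrier G"
      proof
        show "carrier G \<subseteq> ?f ` carrier ?E"
        proof
          fix x assume "x \<in> carrier G"
          then obtain a b where x: "x = f a b" using surj by blast
          have "x = f (\<lambda>i\<in>{..<k}. a i mod int p) (\<lambda>i\<in>{..<l}. b i mod int q)"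
            unfolding x eq by (simp add: mod_eq_dvd_iff[symmetric])
          then show "x \<in> ?f ` carrier ?E"
            using p
            by (intro image_eqI[where x = "(\<lambda>i\<in>{..<k}. a i mod int p, \<lambda>i\<in>{..<l}. b i mod int q)"])
              (auto simp: elem_ab_carrier)
        qed
      qed (auto simp: closed)
    qed
  qed
  then show ?thesis
    using group.iso_sym[OF DirProd_group[OF group_elem_ab group_elem_ab]] is_isoI by blast
qed

lemma iso_elem_ab:
  fixes f :: "(nat \<Rightarrow> int) \<Rightarrow> 'a"
  assumes G: "group G" and p: "p > 0"
    and closed: "\<And>a. f a \<in> carrier G"
    and add: "\<And>a c. f (\<lambda>i. a i + c i) = f a \<otimes>\<^bsub>G\<^esub> f c"
    and ker: "\<And>a. f a = \<one>\<^bsub>G\<^esub> \<longleftrightarrow> (\<forall>i<k. int p dvd a i)"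
    and surj: "\<And>x. x \<in> carrier G \<Longrightarrow> \<exists>a. x = f a"
  shows "G \<cong> elem_ab p k"
proof -
  have "G \<cong> elem_ab p k \<times>\<times> elem_ab 1 0"
    by (rule iso_elem_ab_DirProd[where f = "\<lambda>a _. f a"]) (use assms in auto)
  also have "elem_ab p k \<times>\<times> elem_ab 1 0 \<cong> elem_ab p k"
  proof (rule is_isoI, rule isoI)
    show "fst \<in> hom (elem_ab p k \<times>\<times> elem_ab 1 0) (elem_ab p k)"
      by (auto simp: hom_def)
    show "bij_betw fst (carrier (elem_ab p k \<times>\<times> elem_ab 1 0)) (carrier (elem_ab p k))"
      by (auto simp: bij_betw_def inj_on_def elem_ab_carrier)
  qed
  finally (iso_trans) show ?thesis .
qed

text \<open>An element \<open>x\<close> sends a right coset to its translate by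
  \<open>inv x\<close>; the inverse turns right translation into an action compatible with
  composition. Its kernel is the core of \<open>S\<close>, trivial by assumption.\<close>

lemma coset_action:
  fixes G (structure)
  assumes G: "group G" and fin: "finite (carrier G)" and S: "subgroup S G"
    and n: "card (rcosets S) = n"
    and core: "\<And>x. x \<in> carrier G \<Longrightarrow> (\<And>g. g \<in> carrier G \<Longrightarrow> g \<otimes> x \<otimes> inv g \<in> S) \<Longrightarrow> x = \<one>"
  obtains \<phi> where "\<phi> \<in> hom G (sym_group n)" "inj_on \<phi> (carrier G)"
    "\<And>i j. i \<in> {1..n} \<Longrightarrow> j \<in> {1..n} \<Longrightarrow> \<exists>g\<in>carrier G. \<phi> g i = j"
    "\<And>x. x \<in> carrier G \<Longrightarrow> \<phi> x 1 = 1 \<longleftrightarrow> x \<in> S"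
    "1 \<in> {1..n}"
proof -
  interpret group G by (rule G)
  let ?C = "rcosets S"
  have Sc: "S \<subseteq> carrier G" using S subgroup.subset by blast
  have SC: "S \<in> ?C"
    using subgroup.subgroup_in_rcosets[OF S G] .
  have finC: "finite ?C"
    unfolding RCOSETS_def using fin by auto
  have npos: "1 \<in> {1..n}"
    using SC finC n by (metis One_nat_def Suc_leI atLeastAtMost_iff card_gt_0_iff empty_iff order_refl)
  obtain b0 where b0: "bij_betw b0 {1..n} ?C"
    using ex_bij_betw_nat_finite_1[OF finC] n by auto
  obtain k where k: "k \<in> {1..n}" "b0 k = S"
    using b0 SC by (metis bij_betw_iff_bijections)
  \<comment> \<open>The numbering is corrected so that the coset \<open>S\<close> itself gets number
    1, the point whose stabilizer is taken.\<close>
  define b where "b = b0 \<circ> Transposition.transpose 1 k"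
  have b: "bij_betw b {1..n} ?C"
    unfolding b_def
    by (rule bij_betw_trans[OF _ b0]) (use k npos in \<open>simp add: bij_betw_transpose_iff\<close>)
  have b1: "b 1 = S" using k by (simp add: b_def)
  define c where "c = inv_into {1..n} b"
  have c: "bij_betw c ?C {1..n}" unfolding c_def by (rule bij_betw_inv_into[OF b])
  have cb: "c (b i) = i" if "i \<in> {1..n}" for i
    unfolding c_def using that b by (simp add: bij_betw_inv_into_left)
  have bc: "b (c A) = A" if "A \<in> ?C" for A
    unfolding c_def using that b by (simp add: bij_betw_inv_into_right)
  have bC: "b i \<in> ?C" if "i \<in> {1..n}" for i using that b bij_betwE by blast
  have cn: "c A \<in> {1..n}" if "A \<in> ?C" for A using that c bij_betwE by blast
  have Csub: "A \<subseteq> carrier G" if "A \<in> ?C" for A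
    using that Sc by (auto simp: RCOSETS_def r_coset_def)
  have shift: "A #> x \<in> ?C" if "A \<in> ?C" "x \<in> carrier G" for A x
    using that Sc by (force simp: RCOSETS_def coset_mult_assoc)
  define \<phi> where "\<phi> = (\<lambda>x i. if i \<in> {1..n} then c (b i #> inv x) else i)"
  have b\<phi>: "b (\<phi> x i) = b i #> inv x" if "i \<in> {1..n}" "x \<in> carrier G" for x i
    using that bC bc shift by (simp add: \<phi>_def)
  have \<phi>n: "\<phi> x i \<in> {1..n}" if "i \<in> {1..n}" "x \<in> carrier G" for x i
    unfolding \<phi>_def using that(1) cn[OF shift[OF bC[OF that(1)] inv_closed[OF that(2)]]] by (simp only: if_True)
  have \<phi>mult: "\<phi> (x \<otimes> y) = \<phi> x \<circ> \<phi> y" if "x \<in> carrier G" "y \<in> carrier G" for x y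
  proof
    fix i
    show "\<phi> (x \<otimes> y) i = (\<phi> x \<circ> \<phi> y) i"
    proof (cases "i \<in> {1..n}")
      case True
      then show ?thesis
        using that Csub[OF bC[OF True]] b\<phi>[OF True that(2)] \<phi>n[OF True that(2)]
        by (simp add: \<phi>_def inv_mult_group coset_mult_assoc del: atLeastAtMost_iff)
    qed (auto simp: \<phi>_def)
  qed
  have \<phi>one: "\<phi> \<one> = id"
  proof
    fix i show "\<phi> \<one> i = id i"
      using Csub[OF bC, of i] cb by (auto simp: \<phi>_def coset_mult_one)
  qed
  have perm: "\<phi> x permutes {1..n}" if "x \<in> carrier G" for x
  proof (rule bij_imp_permutes)
    show "bij_betw (\<phi> x) {1..n} {1..n}"
    proof (rule bij_betw_byWitness[where f' = "\<phi> (inv x)"])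
      show "\<forall>a\<in>{1..n}. \<phi> (inv x) (\<phi> x a) = a"
        using \<phi>mult[of "inv x" x] that \<phi>one by (simp add: fun_eq_iff)
      show "\<forall>a\<in>{1..n}. \<phi> x (\<phi> (inv x) a) = a"
        using \<phi>mult[of x "inv x"] that \<phi>one by (simp add: fun_eq_iff)
      show "\<phi> x ` {1..n} \<subseteq> {1..n}" "\<phi> (inv x) ` {1..n} \<subseteq> {1..n}"
        using \<phi>n that by (meson image_subsetI inv_closed)+
    qed
  qed (auto simp: \<phi>_def)
  have hom: "\<phi> \<in> hom G (sym_group n)"
    using perm by (auto simp: hom_def sym_group_def \<phi>mult)
  have trans: "\<exists>g\<in>carrier G. \<phi> g i = j" if ij: "i \<in> {1..n}" "j \<in> {1..n}" for i j
  proof -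
    obtain x where x: "x \<in> carrier G" "b i = S #> x"
      using bC[OF ij(1)] by (auto simp: RCOSETS_def)
    obtain y where y: "y \<in> carrier G" "b j = S #> y"
      using bC[OF ij(2)] by (auto simp: RCOSETS_def)
    have "\<phi> (inv y \<otimes> x) i = c (S #> x #> inv (inv y \<otimes> x))"
      using ij x by (simp add: \<phi>_def)
    also have "S #> x #> inv (inv y \<otimes> x) = S #> y"
      using x y Sc by (simp add: coset_mult_assoc inv_mult_group m_assoc[symmetric])
    also have "c \<dots> = j" using cb[OF ij(2)] y by simp
    finally show ?thesis using x y by blast
  qed
  have stab: "\<phi> x 1 = 1 \<longleftrightarrow> x \<in> S" if x: "x \<in> carrier G" for x
  proof -
    have "\<phi> x 1 = 1 \<longleftrightarrow> b (\<phi> x 1) = b 1"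
      using cb \<phi>n[OF npos x] npos by metis
    also have "\<dots> \<longleftrightarrow> S #> inv x = S" using b\<phi>[OF npos x] b1 by simp
    also have "\<dots> \<longleftrightarrow> inv x \<in> S"
      using x S by (metis coset_join1 coset_join2 inv_closed Sc)
    also have "\<dots> \<longleftrightarrow> x \<in> S"
      using x S by (metis inv_inv subgroup.m_inv_closed)
    finally show ?thesis .
  qed
  have ker: "x = \<one>" if x: "x \<in> carrier G" and id: "\<phi> x = id" for x
  proof (rule core[OF x])
    fix g assume g: "g \<in> carrier G"
    have "\<phi> (g \<otimes> x \<otimes> inv g) = \<phi> g \<circ> \<phi> x \<circ> \<phi> (inv g)"
      using g x by (simp add: \<phi>mult)
    also have "\<dots> = id"
      using \<phi>mult[of g "inv g"] g \<phi>one id by simp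
    finally show "g \<otimes> x \<otimes> inv g \<in> S"
      using stab[of "g \<otimes> x \<otimes> inv g"] g x by simp
  qed
  have "group_hom G (sym_group n) \<phi>"
    using hom sym_group_is_group by (simp add: group_hom_def group_hom_axioms_def)
  moreover have "kernel G (sym_group n) \<phi> = {\<one>}"
    using ker \<phi>one by (auto simp: kernel_def sym_group_one)
  ultimately have "inj_on \<phi> (carrier G)"
    using group_hom.trivial_ker_imp_inj by blast
  then show ?thesis using that hom trans stab npos by blast
qed

section \<open>Transport of complements and semidirect products along isomorphisms\<close>

lemma iso_restrict:
  assumes "\<phi> \<in> iso G G'" "K \<subseteq> carrier G"
  shows "\<phi> \<in> iso (G\<lparr>carrier := K\<rparr>) (G'\<lparr>carrier := \<phi> ` K\<rparr>)"
  using assms by (auto simp: iso_def hom_def bij_betw_def inj_on_subset subset_iff)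

lemma iso_image_set_mult:
  assumes "\<phi> \<in> iso G G'" "K \<subseteq> carrier G" "L \<subseteq> carrier G"
  shows "\<phi> ` (K <#>\<^bsub>G\<^esub> L) = \<phi> ` K <#>\<^bsub>G'\<^esub> \<phi> ` L"
  using assms set_mult_hom[of \<phi> G G' K L] by (simp add: iso_def)

lemma iso_image_subgroup:
  assumes "group G" "group G'" "\<phi> \<in> iso G G'" "subgroup K G"
  shows "subgroup (\<phi> ` K) G'"
  using assms by (metis group_hom.intro group_hom.subgroup_img_is_subgroup group_hom_axioms.intro iso_imp_homomorphism)

lemma iso_image_normal:
  assumes "group G" "group G'" "\<phi> \<in> iso G G'" "K \<lhd> G"
  shows "\<phi> ` K \<lhd> G'"
  using assms by (meson group_hom.intro group_hom_axioms.intro iso_imp_homomorphism iso_normal_subgroup)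

lemma iso_image_complement:
  assumes G: "group G" and G': "group G'" and \<phi>: "\<phi> \<in> iso G G'"
    and K: "K \<subseteq> carrier G" and L: "L \<subseteq> carrier G"
    and KL: "K \<inter> L = {\<one>\<^bsub>G\<^esub>}" "K <#>\<^bsub>G\<^esub> L = carrier G"
  shows "\<phi> ` K \<inter> \<phi> ` L = {\<one>\<^bsub>G'\<^esub>}" "\<phi> ` K <#>\<^bsub>G'\<^esub> \<phi> ` L = carrier G'"
proof -
  have inj: "inj_on \<phi> (carrier G)" and surj: "\<phi> ` carrier G = carrier G'"
    and hom: "\<phi> \<in> hom G G'"
    using \<phi> by (auto simp: iso_def bij_betw_def)
  have "\<phi> ` K \<inter> \<phi> ` L = \<phi> ` (K \<inter> L)"
    using inj K L by (metis inj_on_image_Int)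
  then show "\<phi> ` K \<inter> \<phi> ` L = {\<one>\<^bsub>G'\<^esub>}"
    using KL hom_one[OF hom G G'] by simp
  show "\<phi> ` K <#>\<^bsub>G'\<^esub> \<phi> ` L = carrier G'"
    using iso_image_set_mult[OF \<phi> K L] KL surj by simp
qed

lemma is_semidirect_product_iso:
  assumes G: "group G" and G': "group G'" and \<phi>: "\<phi> \<in> iso G G'"
    and "is_semidirect_product G A B"
  shows "is_semidirect_product G' A B"
proof -
  obtain K L where KL: "K \<lhd> G" "subgroup L G" "K \<inter> L = {\<one>\<^bsub>G\<^esub>}" "K <#>\<^bsub>G\<^esub> L = carrier G"
    "G\<lparr>carrier := K\<rparr> \<cong> A" "G\<lparr>carrier := L\<rparr> \<cong> B"
    using assms(4) unfolding is_semidirect_product_def by blast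
  have sub: "K \<subseteq> carrier G" "L \<subseteq> carrier G" and K: "subgroup K G"
    using KL(1,2) by (auto simp: normal_def subgroup.subset subgroup.mem_carrier)
  have iso: "G'\<lparr>carrier := \<phi> ` J\<rparr> \<cong> D" if "subgroup J G" "G\<lparr>carrier := J\<rparr> \<cong> D" for J and D :: "('x, 'y) monoid_scheme"
  proof -
    have "G\<lparr>carrier := J\<rparr> \<cong> G'\<lparr>carrier := \<phi> ` J\<rparr>"
      using iso_restrict[OF \<phi>] that(1) subgroup.subset is_isoI by metis
    then show ?thesis
      using that group.iso_sym[OF subgroup.subgroup_is_group[OF that(1) G]] iso_trans by blast
  qed
  show ?thesis
    unfolding is_semidirect_product_def
    using iso_image_normal[OF G G' \<phi> KL(1)] iso_image_subgroup[OF G G' \<phi> KL(2)]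
      iso_image_complement[OF G G' \<phi> sub KL(3,4)] iso[OF K KL(5)] iso[OF KL(2,6)] by blast
qed

lemma splits_over_iso:
  assumes G: "group G" and G': "group G'" and \<phi>: "\<phi> \<in> iso G G'" and N: "N \<subseteq> carrier G"
    and "splits_over G' (\<phi> ` N)"
  shows "splits_over G N"
proof -
  obtain K where K: "subgroup K G'" "\<phi> ` N \<inter> K = {\<one>\<^bsub>G'\<^esub>}" "\<phi> ` N <#>\<^bsub>G'\<^esub> K = carrier G'"
    using assms(5) unfolding splits_over_def by blast
  let ?\<psi> = "inv_into (carrier G) \<phi>"
  have \<psi>: "?\<psi> \<in> iso G' G" using group.iso_set_sym[OF G \<phi>] .
  have "inj_on \<phi> (carrier G)" using \<phi> by (simp add: iso_def bij_betw_def)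
  then have \<psi>N: "?\<psi> ` \<phi> ` N = N" using N by (simp add: inv_into_image_cancel)
  have "\<phi> ` N \<subseteq> carrier G'" using \<phi> N by (auto simp: iso_def hom_def)
  from iso_image_complement[OF G' G \<psi> this subgroup.subset[OF K(1)] K(2,3)]
  show ?thesis
    unfolding splits_over_def \<psi>N using iso_image_subgroup[OF G' G \<psi> K(1)] by blast
qed

text \<open>In the action on cosets, \<open>x\<close> fixes the point
  \<open>\<phi> (inv g) 1\<close> iff \<open>g \<otimes> x \<otimes> inv g\<close> lies in
  \<open>S\<close>. Elusiveness thus becomes a statement inside \<open>G\<close>: every element of
  prime order is conjugate into \<open>S\<close>. The other claims transfer along the isomorphism of
  \<open>G\<close> with its image.\<close>

lemma elusive_representation:
  fixes G (structure)
  assumes G: "group G" and fin: "finite (carrier G)" and S: "subgroup S G"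
    and n: "card (rcosets S) = n"
    and core: "\<And>x. x \<in> carrier G \<Longrightarrow> (\<And>g. g \<in> carrier G \<Longrightarrow> g \<otimes> x \<otimes> inv g \<in> S) \<Longrightarrow> x = \<one>"
    and prime: "\<And>x. x \<in> carrier G \<Longrightarrow> Factorial_Ring.prime (group.ord G x) \<Longrightarrow> \<exists>g\<in>carrier G. g \<otimes> x \<otimes> inv g \<in> S"
    and Q: "group Q" and \<pi>: "\<pi> \<in> hom G Q" "\<pi> ` carrier G = carrier Q"
    and A: "G\<lparr>carrier := kernel G Q \<pi>\<rparr> \<cong> A"
    and split: "\<not> splits_over G (kernel G Q \<pi>)"
    and semi: "is_semidirect_product (G\<lparr>carrier := S\<rparr>) B C"
  shows "\<exists>H N. elusive n H \<and> N \<lhd> perm_group n H \<and> perm_group n H\<lparr>carrier := N\<rparr> \<cong> A \<and>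
    perm_group n H Mod N \<cong> Q \<and> \<not> splits_over (perm_group n H) N \<and>
    is_semidirect_product (perm_group n (point_stabilizer H)) B C"
proof -
  interpret group G by (rule G)
  interpret Sy: group "sym_group n" by (rule sym_group_is_group)
  obtain \<phi> where \<phi>: "\<phi> \<in> hom G (sym_group n)" "inj_on \<phi> (carrier G)"
    and trans: "\<And>i j. i \<in> {1..n} \<Longrightarrow> j \<in> {1..n} \<Longrightarrow> \<exists>g\<in>carrier G. \<phi> g i = j"
    and stab: "\<And>x. x \<in> carrier G \<Longrightarrow> \<phi> x 1 = 1 \<longleftrightarrow> x \<in> S"
    and n1: "1 \<in> {1..n}"
    using coset_action[OF G fin S n core] by metis
  interpret gh: group_hom G "sym_group n" \<phi>
    using \<phi> by unfold_locales
  define H where "H = \<phi> ` carrier G"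
  let ?P = "perm_group n H"
  let ?N = "kernel G Q \<pi>"
  have H: "subgroup H (sym_group n)" unfolding H_def by (rule gh.img_is_subgroup)
  have P: "group ?P"
    unfolding perm_group_def by (rule Sy.subgroup_imp_group[OF H])
  have iso: "\<phi> \<in> iso G ?P"
    using \<phi> by (auto simp: iso_def hom_def perm_group_def H_def bij_betw_def)
  interpret gQ: group_hom G Q \<pi> using G Q \<pi> by (simp add: group_hom_def group_hom_axioms_def)
  have Nsub: "?N \<subseteq> carrier G" by (auto simp: kernel_def)
  have NG: "?N \<lhd> G" by (rule gQ.normal_kernel)
  have el: "elusive n H"
    unfolding elusive_def
  proof
    show "transitive_perm_group n H"
      using H trans unfolding transitive_perm_group_def by (auto simp: H_def)
    show "\<not> (\<exists>g\<in>H. Factorial_Ring.prime (Sy.ord g) \<and> derangement n g)"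
    proof
      assume "\<exists>g\<in>H. Factorial_Ring.prime (Sy.ord g) \<and> derangement n g"
      then obtain x where x: "x \<in> carrier G" "Factorial_Ring.prime (Sy.ord (\<phi> x))" "derangement n (\<phi> x)"
        unfolding H_def by blast
      have "Sy.ord (\<phi> x) = group.ord G x"
      proof (rule Sy.ord_unique[THEN iffD2, rule_format])
        fix k :: nat
        have "\<phi> x [^]\<^bsub>sym_group n\<^esub> k = \<one>\<^bsub>sym_group n\<^esub> \<longleftrightarrow> \<phi> (x [^] k) = \<phi> \<one>"
          using x(1) by (simp add: gh.hom_nat_pow)
        also have "\<dots> \<longleftrightarrow> x [^] k = \<one>" using x(1) \<phi>(2) by (auto simp: inj_on_def)
        finally show "\<phi> x [^]\<^bsub>sym_group n\<^esub> k = \<one>\<^bsub>sym_group n\<^esub> \<longleftrightarrow> group.ord G x dvd k"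
          using x(1) pow_eq_id by simp
      qed (use x(1) in simp)
      then obtain g where g: "g \<in> carrier G" "g \<otimes> x \<otimes> inv g \<in> S"
        using prime[OF x(1)] x(2) by auto
      let ?i = "\<phi> (inv g) 1"
      have i: "?i \<in> {1..n}"
        using gh.hom_closed[of "inv g"] g n1 permutes_in_image
        by (metis inv_closed sym_group_carrier)
      have "\<phi> (g \<otimes> x \<otimes> inv g) 1 = 1" using g x by (subst stab) auto
      then have "\<phi> g (\<phi> x ?i) = 1" using g x by (simp add: sym_group_mult del: gh.hom_inv)
      then have "\<phi> (inv g) (\<phi> g (\<phi> x ?i)) = ?i" by simp
      moreover have "\<phi> (inv g) \<circ> \<phi> g = id"
        using gh.hom_mult[of "inv g" g] g by (simp add: sym_group_mult sym_group_one del: gh.hom_inv)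
      ultimately have "\<phi> x ?i = ?i" by (metis comp_apply id_apply)
      then show False using x(3) i unfolding derangement_def by blast
    qed
  qed
  have "?P\<lparr>carrier := \<phi> ` ?N\<rparr> \<cong> A"
  proof -
    have "G\<lparr>carrier := ?N\<rparr> \<cong> ?P\<lparr>carrier := \<phi> ` ?N\<rparr>"
      using iso_restrict[OF iso Nsub] is_isoI by metis
    then show ?thesis
      using A group.iso_sym[OF subgroup.subgroup_is_group[OF gQ.subgroup_kernel G]] iso_trans by blast
  qed
  moreover have "?P Mod \<phi> ` ?N \<cong> Q"
  proof -
    let ?\<psi> = "inv_into (carrier G) \<phi>"
    have \<psi>: "?\<psi> \<in> iso ?P G" using group.iso_set_sym[OF G iso] .
    have "\<pi> \<circ> ?\<psi> \<in> hom ?P Q" using \<psi> \<pi>(1) by (auto simp: iso_def hom_def Pi_iff)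
    then have gh': "group_hom ?P Q (\<pi> \<circ> ?\<psi>)"
      using P Q by (simp add: group_hom_def group_hom_axioms_def)
    have im: "?\<psi> ` carrier ?P = carrier G" using \<psi> by (auto simp: iso_def bij_betw_def)
    have "(\<pi> \<circ> ?\<psi>) ` carrier ?P = carrier Q" using im \<pi>(2) by (simp flip: image_image add: image_comp[symmetric])
    moreover have "kernel ?P Q (\<pi> \<circ> ?\<psi>) = \<phi> ` ?N"
      using \<phi>(2) by (auto simp: kernel_def perm_group_def H_def)
    ultimately show ?thesis using group_hom.FactGroup_iso[OF gh'] by metis
  qed
  moreover have "\<not> splits_over ?P (\<phi> ` ?N)"
    using splits_over_iso[OF G P iso Nsub] split by blast
  moreover have "is_semidirect_product (perm_group n (point_stabilizer H)) B C"
  proof -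
    have Sc: "S \<subseteq> carrier G" using S subgroup.subset by blast
    have im: "point_stabilizer H = \<phi> ` S"
      using stab Sc by (auto simp: point_stabilizer_def H_def)
    have gS: "group (G\<lparr>carrier := S\<rparr>)" by (rule subgroup_imp_group[OF S])
    have "subgroup (\<phi> ` S) (sym_group n)" using gh.subgroup_img_is_subgroup[OF S] .
    then have gP: "group (perm_group n (\<phi> ` S))"
      unfolding perm_group_def by (rule Sy.subgroup_imp_group)
    have "\<phi> \<in> iso (G\<lparr>carrier := S\<rparr>) (perm_group n (\<phi> ` S))"
      using iso_restrict[OF iso Sc] by (simp add: perm_group_def)
    from is_semidirect_product_iso[OF gS gP this semi] show ?thesis by (simp add: im)
  qed
  ultimately show ?thesis
    using el iso_image_normal[OF G P iso NG] by blast
qed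

section \<open>Special orthogonal matrices over the integers modulo 25\<close>

text \<open>In the integers modulo 25, equality of the 5-fold multiples is congruence modulo 5; the
  lemma is its compatibility with products.\<close>

lemma times5_cong_mult:
  fixes x y x' y' :: "'a::comm_ring_1"
  assumes "5 * x = 5 * x'" "5 * y = 5 * y'"
  shows "5 * (x * y) = 5 * (x' * y')"
  by (metis assms mult.assoc mult.left_commute)

lemma mod25_times5_eq_0_iff:
  "5 * (of_int z :: 25) = 0 \<longleftrightarrow> 5 dvd z"
proof -
  have "5 * (of_int z :: 25) = of_int (5 * z)" by simp
  also have "\<dots> = 0 \<longleftrightarrow> int CHAR(25) dvd 5 * z"
    by (simp only: of_int_eq_0_iff_char_dvd)
  also have "\<dots> \<longleftrightarrow> 5 dvd z" by simp presburger
  finally show ?thesis .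
qed

text \<open>The residues modulo 5 form a field.\<close>

lemma mod25_domain:
  fixes x y :: 25
  assumes "5 * (x * y) = 0"
  shows "5 * x = 0 \<or> 5 * y = 0"
proof -
  obtain a b where ab: "x = of_int a" "y = of_int b" by (metis bit1_cases)
  have "5 dvd a * b" using assms by (simp add: ab mod25_times5_eq_0_iff[symmetric])
  then have "5 dvd a \<or> 5 dvd b" by (simp add: prime_dvd_mult_iff)
  then show ?thesis by (simp add: ab mod25_times5_eq_0_iff)
qed

lemma mod25_square_zero:
  fixes x :: 25
  assumes "5 * x = 0"
  shows "x * y * x = 0" 
proof -
  obtain a where a: "x = of_int a" by (metis bit1_cases)
  then obtain b where "a = 5 * b" using assms by (auto simp: mod25_times5_eq_0_iff)
  then have "x = 5 * of_int b" using a by simp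
  then have "x * y * x = 25 * (of_int b * y * of_int b)" by (simp add: algebra_simps)
  moreover have "(25 :: 25) = 0" by simp
  ultimately show ?thesis by (metis mult_zero_left)
qed

text \<open>The unit group modulo 25 is cyclic, so 1 has just two square roots. This makes scalars
  with \<open>e * e = 1\<close> into genuine signs later on.\<close>

lemma mod25_square_one:
  fixes x :: 25
  assumes "x * x = 1"
  shows "x = 1 \<or> x = -1"
proof -
  obtain a where a: "x = of_int a" "0 \<le> a" "a < 25" by (cases x) auto
  have "a = 0 \<or> a = 1 \<or> a = 2 \<or> a = 3 \<or> a = 4 \<or> a = 5 \<or> a = 6 \<or> a = 7 \<or> a = 8 \<or> a = 9 \<or> a = 10 \<or> a = 11 \<or> a = 12 \<or> a = 13 \<or> a = 14 \<or> a = 15 \<or> a = 16 \<or> a = 17 \<or> a = 18 \<or> a = 19 \<or> a = 20 \<or> a = 21 \<or> a = 22 \<or> a = 23 \<or> a = 24"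
    using a(2,3) by presburger
  then show ?thesis using assms a(1) by (elim disjE) simp_all
qed

definition smult_mat :: "'a::comm_ring_1 \<Rightarrow> 'a^'m^'n \<Rightarrow> 'a^'m^'n" where
  "smult_mat c A = (\<chi> i j. c * A $ i $ j)"

lemma smult_mat_nth [simp]: "smult_mat c A $ i $ j = c * A $ i $ j"
  by (simp add: smult_mat_def)

lemma smult_mat_mult_left [simp]: "smult_mat c A ** B = smult_mat c (A ** B)"
  by (simp add: vec_eq_iff matrix_matrix_mult_def sum_distrib_left mult.assoc)

lemma smult_mat_mult_right [simp]: "A ** smult_mat c B = smult_mat c (A ** B)"
  by (simp add: vec_eq_iff matrix_matrix_mult_def sum_distrib_left mult.left_commute)

lemma smult_mat_smult_mat [simp]: "smult_mat c (smult_mat d A) = smult_mat (c * d) A"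
  by (simp add: vec_eq_iff mult.assoc)

lemma smult_mat_simps [simp]: "smult_mat 0 A = 0" "smult_mat 1 A = A" "smult_mat c 0 = 0"
  by (simp_all add: vec_eq_iff)

lemma smult_mat_add: "smult_mat c (A + B) = smult_mat c A + smult_mat c B"
  by (simp add: vec_eq_iff algebra_simps)

lemma matrix_add_rdistrib: "(A + B) ** C = A ** C + B ** C" for A :: "'a::comm_ring_1^'n^'m"
  by (simp add: vec_eq_iff matrix_matrix_mult_def distrib_right sum.distrib)

lemma matrix_sub_ldistrib: "A ** (B - C) = A ** B - A ** C" for A :: "'a::comm_ring_1^'n^'m"
  by (simp add: vec_eq_iff matrix_matrix_mult_def right_diff_distrib sum_subtractf)

lemma matrix_sub_rdistrib: "(A - B) ** C = A ** C - B ** C" for A :: "'a::comm_ring_1^'n^'m"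
  by (simp add: vec_eq_iff matrix_matrix_mult_def left_diff_distrib sum_subtractf)

definition special_orthogonal :: "'a::comm_ring_1^3^3 \<Rightarrow> bool" where
  "special_orthogonal M \<longleftrightarrow> M ** transpose M = mat 1 \<and> transpose M ** M = mat 1 \<and> det M = 1"

lemma special_orthogonal_mult:
  assumes "special_orthogonal M" "special_orthogonal M'"
  shows "special_orthogonal (M ** M')"
proof -
  have "M ** M' ** (transpose M' ** transpose M) = M ** (M' ** transpose M') ** transpose M"
    "transpose M' ** transpose M ** (M ** M') = transpose M' ** (transpose M ** M) ** M'"
    by (simp_all add: matrix_mul_assoc)
  then show ?thesis
    using assms by (simp add: special_orthogonal_def matrix_transpose_mul det_mul)
qed

lemma special_orthogonal_transpose:
  "special_orthogonal M \<Longrightarrow> special_orthogonal (transpose M)"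
  by (simp add: special_orthogonal_def)

lemma special_orthogonal_one: "special_orthogonal (mat 1)"
  by (simp add: special_orthogonal_def transpose_mat)

text \<open>The classical adjugate; its trace is the middle coefficient of the characteristic
  polynomial.\<close>

definition adj3 :: "'a::comm_ring_1^3^3 \<Rightarrow> 'a^3^3" where
  "adj3 M = vector
    [vector [M$2$2*M$3$3 - M$2$3*M$3$2, M$1$3*M$3$2 - M$1$2*M$3$3, M$1$2*M$2$3 - M$1$3*M$2$2],
     vector [M$2$3*M$3$1 - M$2$1*M$3$3, M$1$1*M$3$3 - M$1$3*M$3$1, M$1$3*M$2$1 - M$1$1*M$2$3],
     vector [M$2$1*M$3$2 - M$2$2*M$3$1, M$1$2*M$3$1 - M$1$1*M$3$2, M$1$1*M$2$2 - M$1$2*M$2$1]]"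

lemma adj3_mult: "adj3 M ** M = smult_mat (det M) (mat 1)"
  by (simp add: vec_eq_iff forall_3 adj3_def matrix_matrix_mult_def sum_3 det_3 mat_def algebra_simps)

lemma Cayley_Hamilton_3:
  fixes M :: "'a::comm_ring_1^3^3"
  shows "M ** M ** M + smult_mat (trace (adj3 M)) M = smult_mat (trace M) (M ** M) + smult_mat (det M) (mat 1)"
  by (simp add: vec_eq_iff forall_3 adj3_def matrix_matrix_mult_def sum_3 det_3 mat_def trace_def algebra_simps)

text \<open>The adjugate of \<open>M\<close> is its inverse, hence its transpose, so the two middle
  coefficients of the characteristic polynomial agree up to sign and it factors:
  \<open>n ** (M ** M - (trace M - 1) M + 1) = 0\<close>. The second factor equals
  \<open>n ** n - (trace M - 3) M\<close>.\<close>

lemma special_orthogonal_cubic: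
  fixes M :: "'a::comm_ring_1^3^3"
  assumes "special_orthogonal M"
  defines "n \<equiv> M - mat 1"
  shows "n ** n ** n = smult_mat (trace M - 3) (n ** M)"
proof -
  have "adj3 M = adj3 M ** (M ** transpose M)" using assms by (simp add: special_orthogonal_def)
  also have "\<dots> = transpose M"
    unfolding matrix_mul_assoc adj3_mult using assms by (simp add: special_orthogonal_def)
  finally have "trace (adj3 M) = trace M" by (simp add: trace_def transpose_def)
  then have CH: "M ** M ** M + smult_mat (trace M) M = smult_mat (trace M) (M ** M) + mat 1"
    using Cayley_Hamilton_3[of M] assms by (simp add: special_orthogonal_def)
  have M: "M = n + mat 1" by (simp add: n_def)
  have CHe: "(M ** M ** M)$i$j = trace M * (M ** M)$i$j - trace M * M$i$j + mat 1$i$j" for i j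
    using CH unfolding vec_eq_iff by (simp add: eq_diff_eq algebra_simps)
  have n2: "n ** n = M ** M - M - (M - mat 1)"
    by (simp add: n_def matrix_sub_ldistrib matrix_sub_rdistrib)
  have n3: "n ** n ** n = M ** M ** M - M ** M - (M ** M - M) - ((M ** M - M) - (M - mat 1))"
    unfolding n2 unfolding n_def by (simp only: matrix_sub_ldistrib matrix_sub_rdistrib matrix_mul_lid matrix_mul_rid)
  have nM: "n ** M = M ** M - M" 
    by (simp add: n_def matrix_sub_ldistrib matrix_sub_rdistrib)
  show ?thesis
    unfolding n3 nM by (simp add: vec_eq_iff CHe algebra_simps)
qed

text \<open>With \<open>c = trace M - 3\<close>, the cubic relation gives \<open>n^3 = c n M\<close>
  and \<open>n^5 = c^2 n M^2\<close>; these are inserted into the binomial expansion of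
  \<open>(1 + n)^5 = 1\<close>. If 5 divides \<open>c\<close>, only \<open>5 n + 10 n^2 = 0\<close>
  survives. Otherwise \<open>c\<close> is a unit, and multiplying the expansion by 5 leaves
  \<open>5 c^2 n M^2 = 0\<close>, where \<open>M\<close> can be cancelled.\<close>

lemma order5_special_orthogonal:
  fixes M :: "25^3^3"
  assumes M: "special_orthogonal M" and M5: "M ** M ** M ** M ** M = mat 1"
  shows "smult_mat 5 M = smult_mat 5 (mat 1)"
proof -
  define n where "n = M - mat 1"
  define c where "c = trace M - 3"
  have Mn: "M = mat 1 + n" by (simp add: n_def)
  have comm: "M ** n = n ** M"
    by (simp add: n_def matrix_sub_ldistrib matrix_sub_rdistrib)
  have n3: "n ** n ** n = smult_mat c (n ** M)"
    using special_orthogonal_cubic[OF M] by (simp add: n_def c_def)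
  have n5: "n ** n ** n ** n ** n = smult_mat (c * c) (n ** M ** M)"
  proof -
    have "n ** n ** n ** n ** n = smult_mat c (n ** M ** n ** n)" by (simp add: n3)
    also have "n ** M ** n ** n = n ** n ** n ** M"
      by (simp add: matrix_mul_assoc[symmetric] comm)
    finally show ?thesis by (simp add: n3)
  qed
  have "M ** M ** M ** M ** M = mat 1 + smult_mat 5 n + smult_mat 10 (n ** n) + smult_mat 10 (n ** n ** n)
      + smult_mat 5 (n ** n ** n ** n) + n ** n ** n ** n ** n"
    unfolding Mn
    by (simp only: matrix_add_ldistrib matrix_add_rdistrib matrix_mul_assoc matrix_mul_lid matrix_mul_rid
        vec_eq_iff vector_add_component smult_mat_nth) simp
  then have eq: "smult_mat 5 n + smult_mat 10 (n ** n) + smult_mat 10 (n ** n ** n)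
      + smult_mat 5 (n ** n ** n ** n) + n ** n ** n ** n ** n = 0"
    unfolding M5 by (simp add: add.assoc)
  have "smult_mat 5 n = 0"
  proof (cases "5 * c = 0")
    case True
    have cc: "c * c = 0" using mod25_square_zero[OF True, of 1] by simp
    have "10 * c = 2 * (5 * c)" by simp
    then have c10: "10 * c = 0" using True by simp
    have e1: "smult_mat 5 n + smult_mat 10 (n ** n) = 0"
      using eq unfolding n5 cc by (simp add: n3 c10 True)
    \<comment> \<open>One more factor \<open>n\<close> turns the second term into a multiple of
      \<open>10 c = 0\<close>, so \<open>5 n^2\<close> vanishes, and then so does
      \<open>5 n\<close>.\<close>
    then have "(smult_mat 5 n + smult_mat 10 (n ** n)) ** n = 0" by simp
    then have "smult_mat 5 (n ** n) = 0"
      by (simp add: matrix_add_rdistrib n3 c10)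
    then have "smult_mat 2 (smult_mat 5 (n ** n)) = 0" by (simp only: smult_mat_simps)
    then show ?thesis using e1 by simp
  next
    case False
    have "smult_mat 5 (smult_mat 5 n + smult_mat 10 (n ** n) + smult_mat 10 (n ** n ** n)
      + smult_mat 5 (n ** n ** n ** n) + n ** n ** n ** n ** n) = 0"
      unfolding eq by simp
    moreover have "(25 :: 25) = 0" "(50 :: 25) = 0" by simp_all
    ultimately have "smult_mat (5 * (c * c)) (n ** M ** M) = 0"
      by (simp add: smult_mat_add n5)
    then have "smult_mat (5 * (c * c)) (n ** M ** M) ** transpose M ** transpose M = 0" by simp
    moreover have "n ** M ** M ** transpose M ** transpose M = n"
    proof -
      have "n ** M ** M ** transpose M ** transpose M = n ** (M ** (M ** transpose M) ** transpose M)"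
        by (simp add: matrix_mul_assoc)
      then show ?thesis using M by (simp add: special_orthogonal_def)
    qed
    ultimately have z: "smult_mat (5 * (c * c)) n = 0" by simp
    have "5 * n$i$j = 0" for i j
    proof -
      have "5 * (c * (c * n$i$j)) = 0" using z by (simp add: vec_eq_iff mult.assoc)
      then show ?thesis using False mod25_domain by blast
    qed
    then show ?thesis by (simp add: vec_eq_iff)
  qed
  then show ?thesis by (simp add: n_def vec_eq_iff algebra_simps)
qed

section \<open>Five orthonormal frames modulo 5\<close>

definition dot3 :: "'a::comm_ring_1^3 \<Rightarrow> 'a^3 \<Rightarrow> 'a" where
  "dot3 u v = (\<Sum>j\<in>UNIV. u $ j * v $ j)"

lemma dot3_orthogonal:
  assumes "special_orthogonal M"
  shows "dot3 (M *v u) (M *v v) = dot3 u v"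
proof -
  have *: "dot3 (M *v u) w = dot3 u (transpose M *v w)" for w
    by (simp add: dot3_def matrix_vector_mult_def transpose_def sum_3 algebra_simps)
  show ?thesis
    using assms by (simp add: * matrix_vector_mul_assoc special_orthogonal_def)
qed

text \<open>The four patterns are the diagonals of the sign matrices of determinant 1. They form a
  Klein four-group under entrywise product and index the frames 1 to 4; any other index gives the
  trivial pattern.\<close>

definition diag_sign :: "nat \<Rightarrow> 25^3" where
  "diag_sign i = (if i = 2 then vector [1, -1, -1] else if i = 3 then vector [-1, 1, -1]
    else if i = 4 then vector [-1, -1, 1] else vector [1, 1, 1])"

text \<open>Lines of a frame are numbered modulo 3, but the index \<open>k\<close> is kept modulo 9: only \<open>3 * k\<close> matters.\<close>

definition axis_vec :: "9 \<Rightarrow> 25^3" where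
  "axis_vec k = vector [if 3 * k = 3 then 1 else 0, if 3 * k = 6 then 1 else 0, if 3 * k = 0 then 1 else 0]"

text \<open>Frames 1 to 4 consist of the sign changes of \<open>(1, 1, 2)\<close> and its
  permutations, of norm \<open>6\<close>, which is \<open>1\<close> modulo 5; frame 5 consists of
  the axes. The index is negated in frames 1 to 4 so that their relation to frame 5 also takes the
  symmetric form \<open>k + l = c\<close> instead of \<open>k - l = c\<close>.\<close>

definition frame :: "nat \<Rightarrow> 9 \<Rightarrow> 25^3" where
  "frame i k = (if i = 5 then axis_vec k else (\<chi> j. diag_sign i $ j * (1 + axis_vec (- k) $ j)))"

lemma thrice_cases: "3 * (k :: 9) = 0 \<or> 3 * k = 3 \<or> 3 * k = 6"
proof (cases k)
  case (of_int z)
  then have "z = 0 \<or> z = 1 \<or> z = 2 \<or> z = 3 \<or> z = 4 \<or> z = 5 \<or> z = 6 \<or> z = 7 \<or> z = 8"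
    by simp presburger
  then show ?thesis using of_int(1) by (elim disjE) simp_all
qed

lemma frame_cases:
  "frame 1 k = (if 3 * k = 0 then vector [1, 1, 2] else if 3 * k = 3 then vector [1, 2, 1] else vector [2, 1, 1])"
  "frame (Suc 0) k = (if 3 * k = 0 then vector [1, 1, 2] else if 3 * k = 3 then vector [1, 2, 1] else vector [2, 1, 1])"
  "frame 2 k = (if 3 * k = 0 then vector [1, -1, -2] else if 3 * k = 3 then vector [1, -2, -1] else vector [2, -1, -1])"
  "frame 3 k = (if 3 * k = 0 then vector [-1, 1, -2] else if 3 * k = 3 then vector [-1, 2, -1] else vector [-2, 1, -1])"
  "frame 4 k = (if 3 * k = 0 then vector [-1, -1, 2] else if 3 * k = 3 then vector [-1, -2, 1] else vector [-2, -1, 1])"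
  "frame 5 k = (if 3 * k = 0 then vector [0, 0, 1] else if 3 * k = 3 then vector [1, 0, 0] else vector [0, 1, 0])"
  using thrice_cases[of k]
  by (auto simp: frame_def axis_vec_def diag_sign_def vec_eq_iff forall_3)

lemma atMost5_cases:
  assumes "i \<in> {1..5::nat}"
  obtains "i = 1" | "i = 2" | "i = 3" | "i = 4" | "i = 5"
  using assms by force

lemma frame_cong: "3 * k = 3 * l \<Longrightarrow> frame i k = frame i l"
  by (simp add: frame_def axis_vec_def)

lemma frame_orthonormal:
  assumes "i \<in> {1..5}"
  shows "5 * dot3 (frame i k) (frame i l) = (if 3 * k = 3 * l then 5 else 0)"
  using assms thrice_cases[of k] thrice_cases[of l]
  by (elim atMost5_cases disjE) (simp_all add: frame_cases dot3_def sum_3)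

text \<open>The projections onto the three lines of an orthonormal frame add up to the
  identity.\<close>

lemma frame_complete:
  assumes "i \<in> {1..5}"
  shows "5 * (frame i 0 $ a * frame i 0 $ b + frame i 1 $ a * frame i 1 $ b + frame i 2 $ a * frame i 2 $ b)
    = (if a = b then 5 else 0)"
  using assms exhaust_3[of a] exhaust_3[of b]
  by (elim atMost5_cases disjE) (simp_all add: frame_cases)

text \<open>The entries \<open>\<plusminus>2\<close> of the Gram matrix of two frames (modulo 5) form a reflection \<open>k + l = c\<close>; this determines the shifts of a matrix preserving the frames.\<close>

lemma frame_gram:
  assumes "i \<in> {1..5}" "j \<in> {1..5}" "i \<noteq> j"
  shows "\<exists>c. \<forall>k l. 5 * dot3 (frame i k) (frame j l) \<in> (if 3 * k + 3 * l = 3 * c then {10, -10} else {5, -5})"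
proof -
  \<comment> \<open>For two of the frames 1 to 4, \<open>?c\<close> numbers the coordinate where the
    product of the two sign patterns differs from its other two entries, coordinate 3 being numbered
    0. For a pair containing frame 5 it is 0.\<close>
  let ?c = "if {i, j} = {1, 2} \<or> {i, j} = {3, 4} then 1 else if {i, j} = {1, 3} \<or> {i, j} = {2, 4} then 2 else 0 :: 9"
  have "5 * dot3 (frame i k) (frame j l) \<in> (if 3 * k + 3 * l = 3 * ?c then {10, -10} else {5, -5})" for k l
    using assms thrice_cases[of k] thrice_cases[of l]
    by (elim atMost5_cases disjE) (simp_all add: frame_cases dot3_def sum_3 doubleton_eq_iff)
  then show ?thesis by blast
qed

text \<open>Congruence modulo 5 is expressed inside the ring of integers modulo 25 by multiplying with 5.\<close>

definition line_eq :: "25^3 \<Rightarrow> 25^3 \<Rightarrow> bool" where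
  "line_eq u v \<longleftrightarrow> (\<exists>e. e * e = 1 \<and> 5 *s u = (5 * e) *s v)"

lemma line_eqI:
  assumes "5 *s u = 5 *s v \<or> 5 *s u = - (5 *s v)"
  shows "line_eq u v"
proof -
  have "5 *s u = (5 * 1) *s v \<or> 5 *s u = (5 * -1) *s v"
    using assms by (simp add: vec_eq_iff)
  then show ?thesis unfolding line_eq_def by (metis mult_1 minus_mult_minus)
qed

lemma matrix_vector_mult_smult: "M *v (c *s v) = c *s (M *v v)" for M :: "'a::comm_ring_1^'n^'m"
  by (simp add: vec_eq_iff matrix_vector_mult_def sum_distrib_left mult.left_commute)

lemma line_eq_mult:
  assumes "line_eq u v"
  shows "line_eq (M *v u) (M *v v)"
proof -
  obtain e where e: "e * e = 1" "5 *s u = (5 * e) *s v" using assms by (auto simp: line_eq_def)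
  have "5 *s (M *v u) = (5 * e) *s (M *v v)"
    using arg_cong[OF e(2), of "\<lambda>w. M *v w"] by (simp add: matrix_vector_mult_smult)
  then show ?thesis using e(1) by (auto simp: line_eq_def)
qed

lemma line_eq_trans:
  assumes "line_eq u v" "line_eq v w"
  shows "line_eq u w"
proof -
  obtain e f where ef: "e * e = 1" "5 *s u = (5 * e) *s v" "f * f = 1" "5 *s v = (5 * f) *s w"
    using assms by (auto simp: line_eq_def)
  have "5 *s u = e *s (5 *s v)" by (simp add: ef(2) vector_smult_assoc mult.commute)
  also have "\<dots> = (5 * (e * f)) *s w" by (simp add: ef(4) vector_smult_assoc mult_ac)
  finally have "5 *s u = (5 * (e * f)) *s w" .
  moreover have "(e * f) * (e * f) = 1"
    using ef by (metis mult.assoc mult.left_commute mult_1_right)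
  ultimately show ?thesis unfolding line_eq_def by blast
qed

lemma line_eq_sym:
  assumes "line_eq u v"
  shows "line_eq v u"
proof -
  obtain e where e: "e * e = 1" "5 *s u = (5 * e) *s v" using assms by (auto simp: line_eq_def)
  have "(5 * e) *s u = e *s (5 *s u)" by (simp add: vector_smult_assoc mult.commute)
  also have "\<dots> = (5 * (e * e)) *s v" by (simp add: e(2) vector_smult_assoc mult_ac)
  finally show ?thesis using e(1) unfolding line_eq_def by (metis mult_1_right)
qed

lemma line_eq_refl [simp]: "line_eq u u"
  by (rule line_eqI) simp

lemma line_eq_dot3:
  assumes "5 *s u = (5 * e) *s u'" "5 *s v = (5 * f) *s v'"
  shows "5 * dot3 u v = 5 * (e * f * dot3 u' v')"
proof -
  have "5 * u$j = 5 * (e * u'$j)" "5 * v$j = 5 * (f * v'$j)" for j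
    using assms by (simp_all add: vec_eq_iff mult.assoc)
  then have "5 * (u$j * v$j) = 5 * ((e * u'$j) * (f * v'$j))" for j
    by (rule times5_cong_mult)
  then show ?thesis by (simp add: dot3_def sum_distrib_left mult_ac)
qed

text \<open>Distinct lines of one frame are orthogonal, whereas lines of different frames have inner
  product \<open>1\<close> or \<open>2\<close> up to sign modulo 5, never 0. Comparing the inner
  products of the two lines with lines of frame \<open>i\<close> therefore separates all
  fifteen.\<close>

lemma line_eq_frame_iff:
  assumes ij: "i \<in> {1..5}" "j \<in> {1..5}" and "line_eq (frame i k) (frame j l)"
  shows "i = j \<and> 3 * k = 3 * l"
proof -
  obtain e where e: "e * e = 1" "5 *s frame i k = (5 * e) *s frame j l"
    using assms by (auto simp: line_eq_def)
  have *: "5 * dot3 (frame i k) (frame i m) = e * (5 * dot3 (frame j l) (frame i m))" for m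
    using line_eq_dot3[OF e(2), of "frame i m" 1 "frame i m"] by (simp add: mult_ac)
  have e': "e = 1 \<or> e = -1" using mod25_square_one[OF e(1)] .
  have "i = j"
  proof (rule ccontr)
    assume "i \<noteq> j"
    then obtain c where c: "\<And>k l. 5 * dot3 (frame j k) (frame i l) \<in> (if 3 * k + 3 * l = 3 * c then {10, -10} else {5, -5})"
      using frame_gram[of j i] ij by metis
    have "3 * (k + 1) \<noteq> 3 * k" by (simp add: distrib_left)
    then have "e * (5 * dot3 (frame j l) (frame i (k + 1))) = 0"
      using *[of "k + 1"] frame_orthonormal[OF ij(1), of k "k + 1"] by simp
    then show False using c[of l "k + 1"] e' by (auto split: if_splits)
  qed
  moreover have "3 * k = 3 * l"
    using *[of k] frame_orthonormal[OF ij(1), of k k] frame_orthonormal[OF ij(1), of l k] \<open>i = j\<close>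
    by (auto split: if_splits)
  ultimately show ?thesis by simp
qed

section \<open>The group and its kernel over the alternating group\<close>

type_synonym triple = "(nat \<Rightarrow> nat) \<times> (nat \<Rightarrow> 9) \<times> (25^3^3)"

text \<open>The geometric condition sees \<open>t\<close> only modulo 3, since lines are numbered
  modulo 3, while the sum must vanish modulo 9. This leaves \<open>3^4\<close> choices of
  \<open>t\<close> for given \<open>s\<close> and \<open>M\<close>. The value 0 outside the five
  points makes the representation unique.\<close>

definition icos_carrier :: "triple set" where
  "icos_carrier = {(s, t, M). s \<in> carrier (alt_group 5) \<and> (\<forall>i. i \<notin> {1..5} \<longrightarrow> t i = 0) \<and>
    (\<Sum>i\<in>{1..5}. t i) = 0 \<and> special_orthogonal M \<and>
    (\<forall>i\<in>{1..5}. \<forall>k. line_eq (M *v frame i k) (frame (s i) (k + t i)))}"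

text \<open>The first two components multiply as the maps sending \<open>(i, k)\<close> to
  \<open>(s i, k + t i)\<close> compose, that is, as in a wreath product.\<close>

definition icos :: "triple monoid" where
  "icos = \<lparr>carrier = icos_carrier,
    monoid.mult = (\<lambda>(s, t, M) (s', t', M'). (s \<circ> s', \<lambda>i. t (s' i) + t' i, M ** M')),
    one = (id, \<lambda>_. 0, mat 1)\<rparr>"

lemma icos_simps [simp]:
  "carrier icos = icos_carrier"
  "(s, t, M) \<otimes>\<^bsub>icos\<^esub> (s', t', M') = (s \<circ> s', \<lambda>i. t (s' i) + t' i, M ** M')"
  "\<one>\<^bsub>icos\<^esub> = (id, \<lambda>_. 0, mat 1)"
  by (simp_all add: icos_def)

lemma icos_carrierI:
  assumes "s \<in> carrier (alt_group 5)" "\<And>i. i \<notin> {1..5} \<Longrightarrow> t i = 0" "(\<Sum>i\<in>{1..5}. t i) = 0"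
    "special_orthogonal M" "\<And>i k. i \<in> {1..5} \<Longrightarrow> line_eq (M *v frame i k) (frame (s i) (k + t i))"
  shows "(s, t, M) \<in> icos_carrier"
  unfolding icos_carrier_def using assms by blast

lemma icos_carrierD:
  assumes "(s, t, M) \<in> icos_carrier"
  shows "s \<in> carrier (alt_group 5)" "s permutes {1..5}" "\<And>i. i \<notin> {1..5} \<Longrightarrow> t i = 0"
    "(\<Sum>i\<in>{1..5}. t i) = 0" "special_orthogonal M"
    "\<And>i k. i \<in> {1..5} \<Longrightarrow> line_eq (M *v frame i k) (frame (s i) (k + t i))"
    "\<And>i. i \<in> {1..5} \<Longrightarrow> s i \<in> {1..5}"
proof -
  show s: "s permutes {1..5}" using assms by (auto simp: icos_carrier_def alt_group_carrier)
  show "\<And>i. i \<in> {1..5} \<Longrightarrow> s i \<in> {1..5}" using permutes_in_image[OF s] by blast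
qed (use assms in \<open>auto simp: icos_carrier_def\<close>)

lemma icos_mult_closed:
  assumes x: "(s, t, M) \<in> icos_carrier" and y: "(s', t', M') \<in> icos_carrier"
  shows "(s \<circ> s', \<lambda>i. t (s' i) + t' i, M ** M') \<in> icos_carrier"
proof (rule icos_carrierI)
  note X = icos_carrierD[OF x] and Y = icos_carrierD[OF y]
  interpret A: group "alt_group 5" by (rule alt_group_is_group)
  show "s \<circ> s' \<in> carrier (alt_group 5)" using A.m_closed[OF X(1) Y(1)] by (simp add: alt_group_mult)
  show "t (s' i) + t' i = 0" if "i \<notin> {1..5}" for i
    using that X(3) Y(2,3) by (simp add: permutes_not_in)
  have "(\<Sum>i\<in>{1..5}. t (s' i)) = (\<Sum>i\<in>{1..5}. t i)"
    using sum.permute[OF Y(2), of t] by (simp add: comp_def)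
  then show "(\<Sum>i\<in>{1..5}. t (s' i) + t' i) = 0" using X(4) Y(4) by (simp add: sum.distrib)
  show "special_orthogonal (M ** M')" using X(5) Y(5) by (rule special_orthogonal_mult)
  fix i k assume i: "i \<in> {1..5::nat}"
  have "line_eq (M *v (M' *v frame i k)) (M *v frame (s' i) (k + t' i))"
    by (rule line_eq_mult[OF Y(6)[OF i]])
  moreover have "line_eq (M *v frame (s' i) (k + t' i)) (frame (s (s' i)) (k + t' i + t (s' i)))"
    by (rule X(6)[OF Y(7)[OF i]])
  ultimately have "line_eq (M *v (M' *v frame i k)) (frame (s (s' i)) (k + t' i + t (s' i)))"
    by (rule line_eq_trans)
  then show "line_eq ((M ** M') *v frame i k) (frame ((s \<circ> s') i) (k + (t (s' i) + t' i)))"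
    by (simp add: matrix_vector_mul_assoc add_ac)
qed

lemma icos_inv_closed:
  assumes x: "(s, t, M) \<in> icos_carrier"
  shows "(inv' s, \<lambda>i. - t (inv' s i), transpose M) \<in> icos_carrier"
proof (rule icos_carrierI)
  note X = icos_carrierD[OF x]
  show "inv' s \<in> carrier (alt_group 5)" by (rule alt_group_inv_closed[OF X(1)])
  have si: "inv' s permutes {1..5}" using permutes_inv[OF X(2)] .
  show "- t (inv' s i) = 0" if "i \<notin> {1..5}" for i
    using that X(3) si by (simp add: permutes_not_in)
  have "(\<Sum>i\<in>{1..5}. t (inv' s i)) = (\<Sum>i\<in>{1..5}. t i)"
    using sum.permute[OF si, of t] by (simp add: comp_def)
  then show "(\<Sum>i\<in>{1..5}. - t (inv' s i)) = 0" using X(4) by (simp add: sum_negf)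
  show "special_orthogonal (transpose M)" using X(5) by (rule special_orthogonal_transpose)
  fix i k assume i: "i \<in> {1..5::nat}"
  let ?j = "inv' s i"
  have j: "?j \<in> {1..5}" "s ?j = i"
    using i permutes_in_image[OF si] permutes_inverses(1)[OF X(2)] by auto
  have "line_eq (M *v frame ?j (k - t ?j)) (frame i k)"
    using X(6)[OF j(1), of "k - t ?j"] j(2) by simp
  from line_eq_mult[OF this, of "transpose M"]
  have "line_eq (frame ?j (k - t ?j)) (transpose M *v frame i k)"
    using X(5) by (simp add: matrix_vector_mul_assoc special_orthogonal_def matrix_vector_mul_lid)
  then show "line_eq (transpose M *v frame i k) (frame ?j (k + - t ?j))"
    using line_eq_sym by simp
qed

lemma icos_one_closed: "(id, \<lambda>_. 0, mat 1) \<in> icos_carrier"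
  by (rule icos_carrierI)
    (simp_all add: alt_group_carrier permutes_id evenperm_id special_orthogonal_one matrix_vector_mul_lid)

lemma group_icos: "group icos"
proof (rule groupI)
  fix x y z assume "x \<in> carrier icos" "y \<in> carrier icos" "z \<in> carrier icos"
  then show "x \<otimes>\<^bsub>icos\<^esub> y \<otimes>\<^bsub>icos\<^esub> z = x \<otimes>\<^bsub>icos\<^esub> (y \<otimes>\<^bsub>icos\<^esub> z)"
    by (cases x; cases y; cases z) (auto simp: matrix_mul_assoc add_ac)
next
  fix x assume "x \<in> carrier icos"
  obtain s t M where x: "x = (s, t, M)" by (cases x)
  with \<open>x \<in> carrier icos\<close> have X: "(s, t, M) \<in> icos_carrier" by simp
  have "(inv' s, \<lambda>i. - t (inv' s i), transpose M) \<otimes>\<^bsub>icos\<^esub> x = \<one>\<^bsub>icos\<^esub>"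
    using icos_carrierD(2,5)[OF X]
    by (simp add: x permutes_inv_o permutes_inverses special_orthogonal_def)
  then show "\<exists>y\<in>carrier icos. y \<otimes>\<^bsub>icos\<^esub> x = \<one>\<^bsub>icos\<^esub>"
    using icos_inv_closed[OF X] by (metis icos_simps(1))
qed (auto simp: icos_one_closed icos_mult_closed)

lemma icos_inv:
  assumes "(s, t, M) \<in> icos_carrier"
  shows "inv\<^bsub>icos\<^esub> (s, t, M) = (inv' s, \<lambda>i. - t (inv' s i), transpose M)"
proof (rule group.inv_equality[OF group_icos])
  show "(inv' s, \<lambda>i. - t (inv' s i), transpose M) \<otimes>\<^bsub>icos\<^esub> (s, t, M) = \<one>\<^bsub>icos\<^esub>"
    using icos_carrierD(2,5)[OF assms]
    by (simp add: permutes_inv_o permutes_inverses special_orthogonal_def)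
qed (use assms icos_inv_closed in auto)

lemma finite_icos: "finite (carrier icos)"
proof (rule finite_subset)
  show "carrier icos \<subseteq> {s. s permutes {1..5}} \<times> {t. \<forall>i. (i \<in> {1..5} \<longrightarrow> t i \<in> UNIV) \<and> (i \<notin> {1..5} \<longrightarrow> t i = 0)} \<times> UNIV"
    using icos_carrierD(2,3) by fastforce
  show "finite ({s. s permutes {1..5::nat}} \<times> {t :: nat \<Rightarrow> 9. \<forall>i. (i \<in> {1..5} \<longrightarrow> t i \<in> UNIV) \<and> (i \<notin> {1..5} \<longrightarrow> t i = 0)} \<times> (UNIV :: (25^3^3) set))"
    by (intro finite_cartesian_product finite_permutations finite_set_of_finite_funs) simp_all
qed

text \<open>Modulo 5, \<open>M\<close> maps every line of frame \<open>i\<close> and one line of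
  frame \<open>j\<close> to itself, each up to a sign. Inner products between the frames are nonzero
  modulo 5 and preserved, so all signs equal one \<open>f\<close>. Completeness of frame
  \<open>i\<close> gives \<open>M = f\<close> modulo 5, and determinant 1 forces
  \<open>f * f * f = f\<close> to be 1.\<close>

lemma icos_two_fixed_points:
  assumes x: "(s, t, M) \<in> icos_carrier" and ij: "i \<in> {1..5}" "j \<in> {1..5}" "i \<noteq> j"
    and fp: "s i = i" "s j = j" "3 * t i = 0" "3 * t j = 0"
  shows "smult_mat 5 M = smult_mat 5 (mat 1)"
proof -
  note X = icos_carrierD[OF x]
  have "\<exists>e. e * e = 1 \<and> 5 *s (M *v frame i k) = (5 * e) *s frame i k" for k
    using X(6)[OF ij(1), of k] fp frame_cong[of "k + t i" k i]
    by (simp add: line_eq_def distrib_left)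
  then obtain e where e: "\<And>k. e k * e k = 1" "\<And>k. 5 *s (M *v frame i k) = (5 * e k) *s frame i k"
    by metis
  obtain f where f: "f * f = 1" "5 *s (M *v frame j 0) = (5 * f) *s frame j 0"
    using X(6)[OF ij(2), of 0] fp frame_cong[of "t j" 0 j] by (auto simp: line_eq_def)
  obtain c where c: "\<And>k l. 5 * dot3 (frame i k) (frame j l) \<in> (if 3 * k + 3 * l = 3 * c then {10, -10} else {5, -5})"
    using frame_gram[OF ij] by blast
  have ef: "e k = f" for k
  proof -
    have "5 * dot3 (frame i k) (frame j 0) = e k * f * (5 * dot3 (frame i k) (frame j 0))"
      using line_eq_dot3[OF e(2)[of k] f(2)] by (simp add: dot3_orthogonal[OF X(5)] mult_ac)
    then show ?thesis
      using c[of k 0] mod25_square_one[OF e(1)[of k]] mod25_square_one[OF f(1)]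
      by (auto split: if_splits)
  qed
  have M5: "5 * M $ a $ b = 5 * (f * mat 1 $ a $ b)" for a b
  proof -
    \<comment> \<open>\<open>P\<close> is the sum of the projections onto frame \<open>i\<close>,
      congruent to the identity; evaluating \<open>M ** P\<close> uses the action of
      \<open>M\<close> on the lines only.\<close>
    define P where "P = (\<chi> c d. frame i 0 $ c * frame i 0 $ d + frame i 1 $ c * frame i 1 $ d + frame i 2 $ c * frame i 2 $ d)"
    have P: "5 * P $ c $ d = 5 * mat 1 $ c $ d" for c d
      using frame_complete[OF ij(1), of c d] by (simp add: P_def mat_def)
    have "5 * M $ a $ b = (\<Sum>c\<in>UNIV. M $ a $ c * (5 * mat 1 $ c $ b))"
      using matrix_mul_rid[of M] by (simp add: matrix_matrix_mult_def vec_eq_iff sum_distrib_left mult.left_commute flip: sum_distrib_left)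
    also have "\<dots> = (\<Sum>c\<in>UNIV. M $ a $ c * (5 * P $ c $ b))" by (simp only: P)
    also have "\<dots> = (5 *s (M *v frame i 0)) $ a * frame i 0 $ b + (5 *s (M *v frame i 1)) $ a * frame i 1 $ b
        + (5 *s (M *v frame i 2)) $ a * frame i 2 $ b"
      by (simp add: P_def matrix_vector_mult_def sum_3 algebra_simps)
    also have "\<dots> = f * (5 * P $ a $ b)"
      unfolding e(2) ef by (simp add: P_def algebra_simps)
    also have "\<dots> = 5 * (f * mat 1 $ a $ b)" by (simp add: P)
    finally show ?thesis .
  qed
  have prod: "5 * (M $ a $ b * M $ c $ d * M $ g $ h) = 5 * (f * mat 1 $ a $ b * (f * mat 1 $ c $ d) * (f * mat 1 $ g $ h))"
    for a b c d g h by (intro times5_cong_mult M5)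
  have "5 * det M = 5 * (f * f * f)"
    unfolding det_3 right_diff_distrib distrib_left prod by (simp add: mat_def)
  then have "5 * f = 5" using X(5) f(1) by (simp add: special_orthogonal_def)
  then show ?thesis
    unfolding vec_eq_iff by (simp add: M5) (simp add: mult.assoc[symmetric])
qed

text \<open>A matrix congruent to 1 moves no line, and the fifteen numbered lines are pairwise
  different modulo 5.\<close>

lemma icos_matrix_trivial:
  assumes x: "(s, t, M) \<in> icos_carrier" and M: "smult_mat 5 M = smult_mat 5 (mat 1)"
  shows "s = id" "3 * t i = 0"
proof -
  note X = icos_carrierD[OF x]
  have st: "s i = i \<and> 3 * t i = 0" if i: "i \<in> {1..5}" for i
  proof -
    have "5 *s (M *v frame i 0) = smult_mat 5 M *v frame i 0"
      by (simp add: vec_eq_iff matrix_vector_mult_def sum_distrib_left mult.assoc)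
    also have "\<dots> = 5 *s frame i 0"
      unfolding M by (simp add: vec_eq_iff forall_3 matrix_vector_mult_def sum_3 mat_def)
    finally have "line_eq (frame i 0) (M *v frame i 0)" using line_eqI by simp
    then have "line_eq (frame i 0) (frame (s i) (0 + t i))"
      using X(6)[OF i] line_eq_trans by blast
    then show ?thesis using line_eq_frame_iff[OF i X(7)[OF i]] by fastforce
  qed
  show "s = id"
  proof
    fix i show "s i = id i"
      using st X(2) by (cases "i \<in> {1..5}") (auto simp: permutes_not_in)
  qed
  show "3 * t i = 0" using st X(3) by (cases "i \<in> {1..5}") auto
qed

text \<open>For two frames mapped to themselves, \<open>M\<close> preserves the relation
  \<open>k + l = c\<close> that marks the inner products \<open>2\<close> and \<open>-2\<close>, so
  \<open>t i + t j = 0\<close> modulo 3. Applied to the three pairs among three frames, this gives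
  \<open>t i = - t i\<close>, hence 0 modulo 3.\<close>

lemma icos_perm_trivial:
  assumes x: "(id, t, M) \<in> icos_carrier"
  shows "3 * t i = 0" "smult_mat 5 M = smult_mat 5 (mat 1)"
proof -
  note X = icos_carrierD[OF x]
  have pair: "3 * t i + 3 * t j = 0" if ij: "i \<in> {1..5}" "j \<in> {1..5}" "i \<noteq> j" for i j
  proof -
    obtain c where c: "\<And>k l. 5 * dot3 (frame i k) (frame j l) \<in> (if 3 * k + 3 * l = 3 * c then {10, -10} else {5, -5})"
      using frame_gram[OF ij] by blast
    obtain e where e: "e * e = 1" "5 *s (M *v frame i c) = (5 * e) *s frame i (c + t i)"
      using X(6)[OF ij(1), of c] by (auto simp: line_eq_def)
    obtain f where f: "f * f = 1" "5 *s (M *v frame j 0) = (5 * f) *s frame j (t j)"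
      using X(6)[OF ij(2), of 0] by (auto simp: line_eq_def)
    have "5 * dot3 (frame i c) (frame j 0) = e * f * (5 * dot3 (frame i (c + t i)) (frame j (t j)))"
      using line_eq_dot3[OF e(2) f(2)] by (simp add: dot3_orthogonal[OF X(5)] mult_ac)
    then have "3 * (c + t i) + 3 * t j = 3 * c"
      using c[of c 0] c[of "c + t i" "t j"] mod25_square_one[OF e(1)] mod25_square_one[OF f(1)]
      by (auto split: if_splits)
    then show ?thesis by (simp add: distrib_left)
  qed
  have t: "3 * t i = 0" if i: "i \<in> {1..5}" for i
  proof -
    obtain j h where jh: "j \<in> {1..5}" "h \<in> {1..5}" "i \<noteq> j" "i \<noteq> h" "j \<noteq> h"
    proof -
      have "i = 1 \<or> i = 2 \<or> (1 \<noteq> i \<and> 2 \<noteq> i)" by auto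
      then show ?thesis using that[of 2 3] that[of 1 3] that[of 1 2] by auto
    qed
    have "3 * t i = - (3 * t i)"
      using pair[OF i jh(1,3)] pair[OF jh(1,2,5)] pair[OF i jh(2,4)] 
      by (metis add.commute add_eq_0_iff)
    moreover have "a = - a \<Longrightarrow> a = 0 \<or> a = 3 \<or> a = 6 \<Longrightarrow> a = 0" for a :: 9
      by (elim disjE) simp_all
    ultimately show ?thesis using thrice_cases[of "t i"] by blast
  qed
  then show "3 * t i = 0" using X(3) by (cases "i \<in> {1..5}") auto
  show "smult_mat 5 M = smult_mat 5 (mat 1)"
    using icos_two_fixed_points[OF x, of 1 2] t by simp
qed

section \<open>Explicit elements over the Klein group, a 3-cycle and a further double
  transposition\<close>

abbreviation swap_pts :: "nat \<Rightarrow> nat \<Rightarrow> nat \<Rightarrow> nat" where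
  "swap_pts \<equiv> Transposition.transpose"

lemma alt_groupI:
  assumes "a \<noteq> b" "c \<noteq> d" "{a, b, c, d} \<subseteq> {1..n}"
  shows "swap_pts a b \<circ> swap_pts c d \<in> carrier (alt_group n)"
  using assms
  by (auto simp: alt_group_carrier evenperm_comp evenperm_swap permutation_swap_id
      intro!: permutes_compose permutes_swap_id)

definition klein :: "nat \<Rightarrow> nat \<Rightarrow> nat" where
  "klein a = (if a = 2 then swap_pts 1 2 \<circ> swap_pts 3 4
    else if a = 3 then swap_pts 1 3 \<circ> swap_pts 2 4
    else if a = 4 then swap_pts 1 4 \<circ> swap_pts 2 3 else id)"

definition diag_mat :: "nat \<Rightarrow> 25^3^3" where
  "diag_mat a = (\<chi> i j. if i = j then diag_sign a $ i else 0)"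

definition klein_elt :: "nat \<Rightarrow> triple" where
  "klein_elt a = (klein a, \<lambda>_. 0, diag_mat a)"

text \<open>The matrix permutes the axes cyclically. This raises the line number by 1 in frame 5 and
  lowers it by 1 in the other frames, where the number is negated. The shift \<open>4\<close> agrees
  with \<open>1\<close> modulo 3 and makes the total vanish modulo 9.\<close>

definition cycle_elt :: triple where
  "cycle_elt = (swap_pts 2 3 \<circ> swap_pts 3 4, \<lambda>i. if i \<in> {1..4} then -1 else if i = 5 then 4 else 0,
    vector [vector [0, 0, 1], vector [1, 0, 0], vector [0, 1, 0]])"

text \<open>The matrix is \<open>n n\<^sup>T / 3 - 1\<close>, the half-turn about \<open>n = (1, 1, 2)\<close>; note \<open>1 / 3 = 17\<close> modulo 25.\<close>

definition turn_elt :: triple where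
  "turn_elt = (swap_pts 2 3 \<circ> swap_pts 4 5, \<lambda>i. if i = 2 then 1 else if i = 3 then -1 else 0,
    vector [vector [16, 17, 9], vector [17, 16, 9], vector [9, 9, 17]])"

lemma sum_1_5: "(\<Sum>i\<in>{1..5::nat}. f i) = f 1 + f 2 + f 3 + f 4 + f 5"
  by (simp add: numeral_eq_Suc add.assoc)

lemmas matrix_3_simps = vec_eq_iff forall_3 matrix_matrix_mult_def sum_3 mat_def Finite_Cartesian_Product.transpose_def det_3 matrix_vector_mult_def

lemma line_eqI':
  "u = v \<or> u = - v \<Longrightarrow> line_eq u v"
  by (rule line_eqI) (auto simp: vec_eq_iff)

text \<open>For frames 1 to 4 the product of the patterns \<open>diag_sign a\<close> and
  \<open>diag_sign i\<close> is \<open>diag_sign (klein a i)\<close>, and the position of the entry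
  of absolute value 2 is unchanged. The axes are only multiplied by signs. Hence all shifts are
  0.\<close>

lemma klein_elt_closed: "klein_elt a \<in> icos_carrier"
  unfolding klein_elt_def
proof (rule icos_carrierI)
  interpret A: group "alt_group 5" by (rule alt_group_is_group)
  show "klein a \<in> carrier (alt_group 5)"
    using A.one_closed by (auto simp: klein_def alt_group_one intro!: alt_groupI)
  show "special_orthogonal (diag_mat a)"
    by (simp add: special_orthogonal_def matrix_3_simps diag_mat_def diag_sign_def)
  fix i k assume i: "i \<in> {1..5::nat}"
  have mv: "diag_mat a *v v = (\<chi> j. diag_sign a $ j * v $ j)" for v
    by (simp add: vec_eq_iff forall_3 diag_mat_def matrix_vector_mult_def sum_3)
  consider "a = 2" | "a = 3" | "a = 4" | "diag_sign a = vector [1, 1, 1]" "klein a = id"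
    by (metis diag_sign_def klein_def)
  then show "line_eq (diag_mat a *v frame i k) (frame (klein a i) (k + 0))"
  proof cases
    case 1
    show ?thesis
      unfolding mv unfolding 1 using i thrice_cases[of k]
      by (intro line_eqI', elim atMost5_cases disjE)
        (simp_all add: frame_cases klein_def diag_sign_def vec_eq_iff forall_3 Transposition.transpose_def)
  next
    case 2
    show ?thesis
      unfolding mv unfolding 2 using i thrice_cases[of k]
      by (intro line_eqI', elim atMost5_cases disjE)
        (simp_all add: frame_cases klein_def diag_sign_def vec_eq_iff forall_3 Transposition.transpose_def)
  next
    case 3
    show ?thesis
      unfolding mv unfolding 3 using i thrice_cases[of k]
      by (intro line_eqI', elim atMost5_cases disjE)
        (simp_all add: frame_cases klein_def diag_sign_def vec_eq_iff forall_3 Transposition.transpose_def)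
  next
    case 4
    have "(\<chi> j. vector [1, 1, 1] $ j * v $ j) = v" for v :: "25^3"
      by (simp add: vec_eq_iff forall_3)
    then show ?thesis by (simp add: mv 4)
  qed
qed simp_all

lemma cycle_elt_closed: "cycle_elt \<in> icos_carrier"
  unfolding cycle_elt_def
proof (rule icos_carrierI)
  show "swap_pts 2 3 \<circ> swap_pts 3 4 \<in> carrier (alt_group 5)" by (rule alt_groupI) auto
  fix i k assume i: "i \<in> {1..5::nat}"
  show "line_eq (vector [vector [0, 0, 1], vector [1, 0, 0], vector [0, 1, 0]] *v frame i k)
      (frame ((swap_pts 2 3 \<circ> swap_pts 3 4) i) (k + (if i \<in> {1..4} then -1 else if i = 5 then 4 else 0)))"
    using i thrice_cases[of k]
    by (intro line_eqI', elim atMost5_cases disjE)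
      (simp_all add: frame_cases matrix_3_simps Transposition.transpose_def distrib_left)
next
  show "special_orthogonal (vector [vector [0, 0, 1], vector [1, 0, 0], vector [0, 1, 0]] :: 25^3^3)"
    by (simp add: special_orthogonal_def matrix_3_simps)
  show "(\<Sum>i\<in>{1..5::nat}. if i \<in> {1..4} then -1 else if i = 5 then 4 else 0 :: 9) = 0"
    unfolding sum_1_5 by simp
qed auto

lemma turn_elt_closed: "turn_elt \<in> icos_carrier"
  unfolding turn_elt_def
proof (rule icos_carrierI)
  show "swap_pts 2 3 \<circ> swap_pts 4 5 \<in> carrier (alt_group 5)" by (rule alt_groupI) auto
  fix i k assume i: "i \<in> {1..5::nat}"
  show "line_eq (vector [vector [16, 17, 9], vector [17, 16, 9], vector [9, 9, 17]] *v frame i k)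
      (frame ((swap_pts 2 3 \<circ> swap_pts 4 5) i) (k + (if i = 2 then 1 else if i = 3 then -1 else 0)))"
    using i thrice_cases[of k]
    \<comment> \<open>Diagonal and permutation matrices map the chosen vectors to each other exactly
      up to sign; the half-turn does so only modulo 5, hence \<open>line_eqI\<close> in place of
      \<open>line_eqI'\<close>.\<close>
    by (intro line_eqI, elim atMost5_cases disjE)
      (simp_all add: frame_cases matrix_3_simps Transposition.transpose_def distrib_left)
next
  show "special_orthogonal (vector [vector [16, 17, 9], vector [17, 16, 9], vector [9, 9, 17]] :: 25^3^3)"
    by (simp add: special_orthogonal_def matrix_3_simps)
  show "(\<Sum>i\<in>{1..5::nat}. if i = 2 then 1 else if i = 3 then -1 else 0 :: 9) = 0"
    unfolding sum_1_5 by simp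
qed auto

section \<open>Surjectivity onto the alternating group\<close>

lemma fst_hom: "fst \<in> hom icos (alt_group 5)"
  by (auto simp: hom_def alt_group_mult icos_carrierD(1))

lemma klein_mult: "klein a \<circ> klein b \<in> klein ` {1, 2, 3, 4}"
proof -
  have "klein a \<in> {klein 1, klein 2, klein 3, klein 4}" "klein b \<in> {klein 1, klein 2, klein 3, klein 4}"
    by (simp_all add: klein_def)
  then have "klein a \<circ> klein b \<in> {klein 1, klein 2, klein 3, klein 4}"
    by (simp only: insert_iff empty_iff, elim disjE)
      (simp_all add: klein_def fun_eq_iff Transposition.transpose_def)
  then show ?thesis by simp
qed

lemma klein_self [simp]: "klein a \<circ> klein a = id"
  by (simp add: klein_def fun_eq_iff Transposition.transpose_def)

lemma prime_dvd_order:
  assumes "group G" "finite (carrier G)" "x \<in> carrier G" "x \<noteq> \<one>\<^bsub>G\<^esub>" "x [^]\<^bsub>G\<^esub> p = \<one>\<^bsub>G\<^esub>"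
    "Factorial_Ring.prime (p :: nat)"
  shows "p dvd order G"
proof -
  interpret group G by fact
  have "group.ord G x dvd p" using assms(3,5) pow_eq_id by blast
  moreover have "group.ord G x \<noteq> 1" using assms(3,4) ord_eq_1 by blast
  ultimately have "group.ord G x = p" using assms(6) unfolding prime_nat_iff by auto
  then show ?thesis using ord_dvd_group_order[OF assms(3)] by simp
qed

lemma card_alt_5: "card (carrier (alt_group 5)) = 60"
  using alt_group_card_carrier[of 5] by (simp add: fact_numeral)

lemma group_hom_fst: "group_hom icos (alt_group 5) fst"
  using fst_hom group_icos alt_group_is_group by (simp add: group_hom_def group_hom_axioms_def)

lemma klein_subgroup: "subgroup (klein ` {1, 2, 3, 4}) (alt_group 5)"
proof -
  interpret A: group "alt_group 5" by (rule alt_group_is_group)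
  have closed: "klein a \<in> carrier (alt_group 5)" for a
    using icos_carrierD(1)[OF klein_elt_closed[of a, unfolded klein_elt_def]] .
  show ?thesis
  proof (rule A.subgroupI)
    fix x assume "x \<in> klein ` {1, 2, 3, 4}"
    then obtain a where a: "x = klein a" "a \<in> {1, 2, 3, 4}" by blast
    have "inv\<^bsub>alt_group 5\<^esub> x = x"
      by (rule A.inv_equality) (use closed a in \<open>simp_all add: alt_group_mult alt_group_one\<close>)
    then show "inv\<^bsub>alt_group 5\<^esub> x \<in> klein ` {1, 2, 3, 4}" using a by (metis image_eqI)
  next
    fix x y assume "x \<in> klein ` {1, 2, 3, 4}" "y \<in> klein ` {1, 2, 3, 4}"
    then show "x \<otimes>\<^bsub>alt_group 5\<^esub> y \<in> klein ` {1, 2, 3, 4}"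
      using klein_mult by (auto simp only: alt_group_mult)
  qed (use closed in auto)
qed

lemma klein_inj: "inj_on klein {1, 2, 3, 4}"
proof -
  have "klein 1 1 = 1" "klein 2 1 = 2" "klein 3 1 = 3" "klein 4 1 = 4"
    by (simp_all add: klein_def Transposition.transpose_def)
  then show ?thesis unfolding inj_on_def by (metis insertE empty_iff)
qed

lemma card_klein: "card (klein ` {1, 2, 3, 4}) = 4"
  by (subst card_image[OF klein_inj]) simp

text \<open>The image has an element of order 3, one of order 5 and the Klein group as a subgroup,
  so its order is divisible by 60.\<close>

lemma fst_surj: "fst ` icos_carrier = carrier (alt_group 5)"
proof -
  interpret gh: group_hom icos "alt_group 5" fst by (rule group_hom_fst)
  let ?I = "fst ` icos_carrier"
  let ?J = "alt_group 5\<lparr>carrier := ?I\<rparr>"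
  have I: "subgroup ?I (alt_group 5)" using gh.img_is_subgroup by simp
  then have sub: "?I \<subseteq> carrier (alt_group 5)" by (rule subgroup.subset)
  have J: "group ?J" using gh.H.subgroup_imp_group[OF I] .
  have finA: "finite (carrier (alt_group 5))" using card_alt_5 card.infinite by fastforce
  have finJ: "finite (carrier ?J)" using sub finA finite_subset by auto
  have mem: "fst x \<in> ?I" if "x \<in> icos_carrier" for x using that by blast
  have 3: "3 dvd order ?J"
  proof (rule prime_dvd_order[OF J finJ])
    show "fst cycle_elt \<in> carrier ?J" using mem cycle_elt_closed by simp
    have "fst cycle_elt 2 = 3" by (simp add: cycle_elt_def Transposition.transpose_def)
    then show "fst cycle_elt \<noteq> \<one>\<^bsub>?J\<^esub>" by (auto simp: alt_group_one)
    show "fst cycle_elt [^]\<^bsub>?J\<^esub> (3::nat) = \<one>\<^bsub>?J\<^esub>"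
      by (simp add: numeral_eq_Suc nat_pow_def alt_group_mult alt_group_one)
        (simp add: cycle_elt_def fun_eq_iff Transposition.transpose_def)
  qed simp
  have 5: "5 dvd order ?J"
  proof (rule prime_dvd_order[OF J finJ])
    \<comment> \<open>The product of these two involutions lies over the 5-cycle
      \<open>1, 2, 5, 4, 3\<close>.\<close>
    let ?x = "turn_elt \<otimes>\<^bsub>icos\<^esub> klein_elt 3"
    have x: "fst ?x = swap_pts 2 3 \<circ> swap_pts 4 5 \<circ> (swap_pts 1 3 \<circ> swap_pts 2 4)"
      by (simp add: turn_elt_def klein_elt_def klein_def)
    show "fst ?x \<in> carrier ?J"
      using mem[OF gh.G.m_closed[of turn_elt "klein_elt 3", simplified]] turn_elt_closed klein_elt_closed by simp
    have "fst ?x 1 = 2" unfolding x by (simp add: Transposition.transpose_def)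
    then show "fst ?x \<noteq> \<one>\<^bsub>?J\<^esub>" by (auto simp: alt_group_one)
    show "fst ?x [^]\<^bsub>?J\<^esub> (5::nat) = \<one>\<^bsub>?J\<^esub>"
    proof -
      have "fst ?x 1 = 2" "fst ?x 2 = 5" "fst ?x 3 = 1" "fst ?x 4 = 3" "fst ?x 5 = 4"
        unfolding x by (simp_all add: Transposition.transpose_def)
      moreover have "fst ?x i = i" if "i \<noteq> 1" "i \<noteq> 2" "i \<noteq> 3" "i \<noteq> 4" "i \<noteq> 5" for i
        using that unfolding x by (simp add: Transposition.transpose_def)
      ultimately have "fst ?x (fst ?x (fst ?x (fst ?x (fst ?x i)))) = i" for i by metis
      then have "fst ?x \<circ> fst ?x \<circ> fst ?x \<circ> fst ?x \<circ> fst ?x = id" by (auto simp: fun_eq_iff)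
      then show ?thesis
        by (simp add: eval_nat_numeral nat_pow_def alt_group_mult alt_group_one del: icos_simps(2))
    qed
  qed simp
  have 4: "4 dvd order ?J"
  proof -
    have "klein ` {1, 2, 3, 4} \<subseteq> ?I"
      using mem[OF klein_elt_closed] by (auto simp: klein_elt_def)
    then have "subgroup (klein ` {1, 2, 3, 4}) ?J"
      using gh.H.subgroup_incl[OF klein_subgroup I] by simp
    then show ?thesis using group.lagrange[OF J] card_klein by (metis dvd_triv_right)
  qed
  have "60 dvd order ?J" using 3 4 5 by presburger
  moreover have "order ?J > 0"
    using finJ mem[OF icos_one_closed] by (auto simp: order_def card_gt_0_iff)
  ultimately have "60 \<le> card ?I" by (auto simp: order_def dest: dvd_imp_le)
  then show ?thesis using card_seteq[OF finA sub] card_alt_5 by simp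
qed

section \<open>Coordinates on the kernel\<close>

lemma mod9_thrice_eq_0_iff: "3 * (of_int z :: 9) = 0 \<longleftrightarrow> 3 dvd z"
proof -
  have "3 * (of_int z :: 9) = of_int (3 * z)" by simp
  also have "\<dots> = 0 \<longleftrightarrow> int CHAR(9) dvd 3 * z"
    by (simp only: of_int_eq_0_iff_char_dvd)
  also have "\<dots> \<longleftrightarrow> 3 dvd z" by simp presburger
  finally show ?thesis .
qed

lemma mod9_thrice_eq_iff: "3 * (of_int a :: 9) = 3 * of_int b \<longleftrightarrow> 3 dvd a - b"
proof -
  have "3 * (of_int a :: 9) = 3 * of_int b \<longleftrightarrow> 3 * (of_int (a - b) :: 9) = 0"
    by (simp add: right_diff_distrib)
  then show ?thesis by (simp only: mod9_thrice_eq_0_iff)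
qed

lemma mod25_times5_eq_iff: "5 * (of_int a :: 25) = 5 * of_int b \<longleftrightarrow> 5 dvd a - b"
proof -
  have "5 * (of_int a :: 25) = 5 * of_int b \<longleftrightarrow> 5 * (of_int (a - b) :: 25) = 0"
    by (simp add: right_diff_distrib)
  then show ?thesis by (simp only: mod25_times5_eq_0_iff)
qed

lemma mod9_thrice_zeroE:
  assumes "3 * (t :: 9) = 0"
  shows "\<exists>a. t = 3 * of_int a"
proof -
  obtain z where z: "t = of_int z" by (metis bit1_cases)
  then obtain a where "z = 3 * a" using assms by (auto simp: mod9_thrice_eq_0_iff)
  then show ?thesis using z by auto
qed

lemma mod25_times5_zeroE:
  assumes "5 * (x :: 25) = 0"
  shows "\<exists>a. x = 5 * of_int a"
proof -
  obtain z where z: "x = of_int z" by (metis bit1_cases)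
  then obtain a where "z = 5 * a" using assms by (auto simp: mod25_times5_eq_0_iff)
  then show ?thesis using z by auto
qed

lemma mod25_25 [simp]: "25 * x = (0 :: 25)" "x * 25 = (0 :: 25)"
proof -
  have "(25 :: 25) = 0" by simp
  then show "25 * x = (0 :: 25)" "x * 25 = (0 :: 25)" by (metis mult_zero_left mult_zero_right)+
qed

lemma mod25_five_five [simp]: "5 * x * (5 * y) = (0 :: 25)" "5 * (5 * y) = (0 :: 25)" "5 * (x * (5 * y)) = (0 :: 25)"
proof -
  have *: "5 * x * (5 * y) = 25 * (x * y)" for y by (simp add: algebra_simps)
  then show "5 * x * (5 * y) = 0" "5 * (x * (5 * y)) = 0"
    by (simp_all add: mult.assoc[symmetric])
  have "5 * (5 * y) = 25 * y" by simp
  then show "5 * (5 * y) = 0" by simp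
qed

text \<open>These are the matrices \<open>1 + 5 X\<close> with \<open>X\<close> skew-symmetric.
  Since 25 vanishes, they multiply by adding the \<open>X\<close>; integer coordinates make this
  additivity literal.\<close>

definition kmat :: "int \<Rightarrow> int \<Rightarrow> int \<Rightarrow> 25^3^3" where
  "kmat x y z = vector [vector [1, 5 * of_int x, 5 * of_int y],
    vector [- (5 * of_int x), 1, 5 * of_int z], vector [- (5 * of_int y), - (5 * of_int z), 1]]"

lemma kmat_mult: "kmat x y z ** kmat x' y' z' = kmat (x + x') (y + y') (z + z')"
  by (simp add: kmat_def matrix_3_simps distrib_left)

lemma kmat_zero: "kmat 0 0 0 = mat 1"
  by (simp add: kmat_def matrix_3_simps)

lemma kmat_transpose: "transpose (kmat x y z) = kmat (- x) (- y) (- z)"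
  by (simp add: kmat_def matrix_3_simps)

lemma kmat_eq_iff:
  "kmat x y z = kmat x' y' z' \<longleftrightarrow> 5 dvd x - x' \<and> 5 dvd y - y' \<and> 5 dvd z - z'"
  by (auto simp: kmat_def vec_eq_iff forall_3 mod25_times5_eq_iff)

lemma special_orthogonal_kmat: "special_orthogonal (kmat x y z)"
proof -
  have "det (kmat x y z) = 1"
    by (simp add: kmat_def det_3 mult.assoc)
  then show ?thesis by (simp add: special_orthogonal_def kmat_transpose kmat_mult kmat_zero)
qed

text \<open>For \<open>M = 1 + 5 W\<close>, orthogonality reduces to
  \<open>5 (W + transpose W) = 0\<close>.\<close>

lemma kmat_exists:
  assumes M: "special_orthogonal M" and M5: "smult_mat 5 M = smult_mat 5 (mat 1)"
  shows "\<exists>x y z. M = kmat x y z"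
proof -
  have "\<exists>w. M $ a $ b = mat 1 $ a $ b + 5 * of_int w" for a b
  proof -
    have "5 * (M $ a $ b - mat 1 $ a $ b) = 0"
      using M5 by (simp add: vec_eq_iff right_diff_distrib)
    then show ?thesis by (metis mod25_times5_zeroE add_diff_cancel_left' diff_add_cancel add.commute)
  qed
  then obtain w where w: "\<And>a b. M $ a $ b = mat 1 $ a $ b + 5 * of_int (w a b)" by metis
  have orth: "(M ** transpose M) $ a $ b = mat 1 $ a $ b" for a b
    using M by (simp add: special_orthogonal_def)
  have anti: "5 * of_int (w b a) = - (5 * of_int (w a b) :: 25)" if "a \<noteq> b" for a b
  proof -
    have "5 * of_int (w a b) + 5 * of_int (w b a) = (0 :: 25)"
      using orth[of a b] exhaust_3[of a] exhaust_3[of b] that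
      by (elim disjE) (simp_all add: matrix_3_simps w algebra_simps)
    then show ?thesis by (simp add: add_eq_0_iff)
  qed
  have diag: "5 * of_int (w a a) = (0 :: 25)" for a
  proof -
    have "10 * of_int (w a a) = (0 :: 25)"
      using orth[of a a] exhaust_3[of a]
      by (elim disjE) (simp_all add: matrix_3_simps w algebra_simps)
    \<comment> \<open>\<open>13\<close> is the inverse of 2 modulo 25.\<close>
    then have "13 * (10 * of_int (w a a)) = (0 :: 25)" by simp
    moreover have "13 * (10 * of_int (w a a)) = (130 :: 25) * of_int (w a a)" by simp
    moreover have "(130 :: 25) = 5" by simp
    ultimately show ?thesis by metis
  qed
  have "M = kmat (w 1 2) (w 1 3) (w 2 3)"
    by (simp add: vec_eq_iff forall_3 kmat_def w diag anti[of 1 2] anti[of 1 3] anti[of 2 3] mat_def)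
  then show ?thesis by blast
qed

definition kelt :: "(nat \<Rightarrow> int) \<Rightarrow> int \<Rightarrow> int \<Rightarrow> int \<Rightarrow> triple" where
  "kelt u x y z = (id, \<lambda>i. if i \<in> {1..5} then 3 * of_int (u i) else 0, kmat x y z)"

lemma kelt_closed:
  assumes "3 dvd (\<Sum>i\<in>{1..5}. u i)"
  shows "kelt u x y z \<in> icos_carrier"
  unfolding kelt_def
proof (rule icos_carrierI)
  show "id \<in> carrier (alt_group 5)" by (simp add: alt_group_carrier permutes_id evenperm_id)
  have "(\<Sum>i\<in>{1..5}. if i \<in> {1..5} then 3 * of_int (u i) else 0) = 3 * (of_int (\<Sum>i\<in>{1..5}. u i) :: 9)"
    by (simp add: sum_distrib_left)
  then show "(\<Sum>i\<in>{1..5}. if i \<in> {1..5} then 3 * of_int (u i) else (0 :: 9)) = 0"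
    using assms by (simp only: mod9_thrice_eq_0_iff)
  fix i k assume i: "i \<in> {1..5::nat}"
  have nine: "3 * (3 * of_int (u i)) = (0 :: 9)"
    by (metis dvd_triv_left mod9_thrice_eq_0_iff of_int_mult of_int_numeral)
  have "frame (id i) (k + (if i \<in> {1..5} then 3 * of_int (u i) else 0)) = frame i k"
    using i frame_cong[of "k + 3 * of_int (u i)" k i] by (simp only: id_apply if_True distrib_left nine add_0_right)
  moreover have "5 *s (kmat x y z *v frame i k) = 5 *s frame i k"
    by (simp add: kmat_def matrix_3_simps distrib_left mult.assoc[symmetric]) 
  ultimately show "line_eq (kmat x y z *v frame i k) (frame (id i) (k + (if i \<in> {1..5} then 3 * of_int (u i) else 0)))"
    using line_eqI by simp
qed (auto simp: special_orthogonal_kmat)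

lemma kelt_mult:
  "kelt u x y z \<otimes>\<^bsub>icos\<^esub> kelt u' x' y' z' = kelt (\<lambda>i. u i + u' i) (x + x') (y + y') (z + z')"
  by (auto simp: kelt_def kmat_mult distrib_left)

lemma kelt_eq_iff:
  "kelt u x y z = kelt u' x' y' z' \<longleftrightarrow>
    (\<forall>i\<in>{1..5}. 3 dvd u i - u' i) \<and> 5 dvd x - x' \<and> 5 dvd y - y' \<and> 5 dvd z - z'"
proof -
  have "(\<lambda>i. if i \<in> {1..5} then 3 * of_int (u i) else (0 :: 9)) =
      (\<lambda>i. if i \<in> {1..5} then 3 * of_int (u' i) else 0) \<longleftrightarrow> (\<forall>i\<in>{1..5}. 3 dvd u i - u' i)"
    unfolding fun_eq_iff mod9_thrice_eq_iff[symmetric] by meson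
  then show ?thesis by (simp add: kelt_def kmat_eq_iff)
qed

lemma kelt_zero: "kelt (\<lambda>_. 0) 0 0 0 = \<one>\<^bsub>icos\<^esub>"
  by (auto simp: kelt_def kmat_zero)

lemma kelt_pow:
  "kelt u x y z [^]\<^bsub>icos\<^esub> (n :: nat) = kelt (\<lambda>i. int n * u i) (int n * x) (int n * y) (int n * z)"
proof (induction n)
  case 0
  then show ?case using kelt_zero by (simp add: nat_pow_def)
next
  case (Suc n)
  then show ?case by (simp add: nat_pow_def kelt_mult algebra_simps)
qed

lemma kelt_exists:
  assumes "(id, t, M) \<in> icos_carrier"
  obtains u x y z where "(id, t, M) = kelt u x y z" "3 dvd (\<Sum>i\<in>{1..5}. u i)"
proof -
  note X = icos_carrierD[OF assms]
  obtain x y z where M: "M = kmat x y z"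
    using kmat_exists[OF X(5) icos_perm_trivial(2)[OF assms]] by blast
  have "\<exists>a. t i = 3 * of_int a" for i
    using mod9_thrice_zeroE icos_perm_trivial(1)[OF assms] by blast
  then obtain u where u: "\<And>i. t i = 3 * of_int (u i)" by metis
  have "3 * (of_int (\<Sum>i\<in>{1..5}. u i) :: 9) = 0"
    using X(4) by (simp add: u sum_distrib_left)
  then have "3 dvd (\<Sum>i\<in>{1..5}. u i)" by (simp only: mod9_thrice_eq_0_iff)
  moreover have "(id, t, M) = kelt u x y z" using X(3) u by (auto simp: kelt_def M fun_eq_iff)
  ultimately show ?thesis using that by blast
qed

lemma kernel_fst: "kernel icos (alt_group 5) fst = {x \<in> icos_carrier. fst x = id}"
  by (simp add: kernel_def alt_group_one)

lemma ball_1_5: "(\<forall>i\<in>{1..5::nat}. P i) \<longleftrightarrow> P 1 \<and> P 2 \<and> P 3 \<and> P 4 \<and> P 5"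
proof -
  have "{1..5::nat} = {1, 2, 3, 4, 5}" by auto
  then show ?thesis by simp
qed

lemma all_less_4: "(\<forall>i<4. P i) \<longleftrightarrow> P (0::nat) \<and> P 1 \<and> P 2 \<and> P 3"
  by (auto simp: numeral_eq_Suc less_Suc_eq)

lemma all_less_3: "(\<forall>i<3. P i) \<longleftrightarrow> P (0::nat) \<and> P 1 \<and> P 2"
  by (auto simp: numeral_eq_Suc less_Suc_eq)

lemma all_less_2: "(\<forall>i<2. P i) \<longleftrightarrow> P (0::nat) \<and> P 1"
  by (auto simp: numeral_eq_Suc less_Suc_eq)

lemma kernel_iso:
  "icos\<lparr>carrier := {x \<in> icos_carrier. fst x = id}\<rparr> \<cong> elem_ab 3 4 \<times>\<times> elem_ab 5 3"
proof -
  let ?N = "{x \<in> icos_carrier. fst x = id}"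
  \<comment> \<open>The coordinates 0 to 3 become the values at the points 1 to 4; the value at 5
    makes the integer sum exactly 0.\<close>
  define u :: "(nat \<Rightarrow> int) \<Rightarrow> nat \<Rightarrow> int" where "u = (\<lambda>a i. if i = 5 then - (a 0 + a 1 + a 2 + a 3) else a (i - 1))"
  define f where "f = (\<lambda>a (b :: nat \<Rightarrow> int). kelt (u a) (b 0) (b 1) (b 2))"
  have u_vals: "u a 1 = a 0" "u a 2 = a 1" "u a 3 = a 2" "u a 4 = a 3" "u a 5 = - (a 0 + a 1 + a 2 + a 3)" for a
    by (simp_all add: u_def)
  interpret gh: group_hom icos "alt_group 5" fst by (rule group_hom_fst)
  show ?thesis
  proof (rule iso_elem_ab_DirProd[where f = f])
    show "group (icos\<lparr>carrier := ?N\<rparr>)"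
      using gh.G.subgroup_imp_group[OF gh.subgroup_kernel] by (simp add: kernel_fst)
    have su: "(\<Sum>i\<in>{1..5}. u a i) = 0" for a unfolding sum_1_5 u_vals by simp
    show "f a b \<in> carrier (icos\<lparr>carrier := ?N\<rparr>)" for a b
    proof -
      have "f a b \<in> icos_carrier" unfolding f_def by (rule kelt_closed) (simp only: su dvd_0_right)
      then show ?thesis by (simp add: f_def kelt_def)
    qed
    show "f (\<lambda>i. a i + c i) (\<lambda>i. b i + d i) = f a b \<otimes>\<^bsub>icos\<lparr>carrier := ?N\<rparr>\<^esub> f c d" for a b c d
    proof -
      have "u (\<lambda>i. a i + c i) = (\<lambda>i. u a i + u c i)" by (auto simp: u_def)
      then show ?thesis by (simp add: f_def kelt_mult)
    qed
    show "f a b = \<one>\<^bsub>icos\<lparr>carrier := ?N\<rparr>\<^esub> \<longleftrightarrow> (\<forall>i<4. int 3 dvd a i) \<and> (\<forall>i<3. int 5 dvd b i)" for a b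
    proof -
      have "f a b = \<one>\<^bsub>icos\<lparr>carrier := ?N\<rparr>\<^esub> \<longleftrightarrow> f a b = kelt (\<lambda>_. 0) 0 0 0"
        unfolding kelt_zero by simp
      also have "\<dots> \<longleftrightarrow> (3 dvd a 0 \<and> 3 dvd a 1 \<and> 3 dvd a 2 \<and> 3 dvd a 3) \<and> 5 dvd b 0 \<and> 5 dvd b 1 \<and> 5 dvd b 2"
        unfolding f_def kelt_eq_iff diff_0_right ball_1_5 u_vals by (auto simp only: dvd_minus_iff intro: dvd_add)
      finally show ?thesis by (simp add: all_less_4 all_less_3)
    qed
    fix v assume "v \<in> carrier (icos\<lparr>carrier := ?N\<rparr>)"
    then obtain t M where v: "v = (id, t, M)" "(id, t, M) \<in> icos_carrier" by (cases v) auto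
    then obtain w x y z where w: "v = kelt w x y z" "3 dvd (\<Sum>i\<in>{1..5}. w i)"
      using kelt_exists by metis
    have "v = f (\<lambda>i. w (i + 1)) (\<lambda>i. if i = 0 then x else if i = 1 then y else z)"
      using w(2) unfolding w(1) f_def kelt_eq_iff sum_1_5 ball_1_5 u_vals
      by (simp add: eval_nat_numeral algebra_simps)
    then show "\<exists>a b. v = f a b" by blast
  qed simp_all
qed

section \<open>The point stabilizers\<close>

lemma card_group_hom:
  assumes "group_hom G H h" "finite (carrier G)"
  shows "order G = card (h ` carrier G) * card (kernel G H h)"
proof -
  interpret gh: group_hom G H h by fact
  let ?I = "H\<lparr>carrier := h ` carrier G\<rparr>"
  have "group ?I" using gh.H.subgroup_imp_group[OF gh.img_is_subgroup] .
  then have gh': "group_hom G ?I h"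
    using gh.group_hom_axioms gh.G.group_axioms by (auto simp: group_hom_def group_hom_axioms_def hom_def)
  have "kernel G ?I h = kernel G H h" by (simp add: kernel_def)
  then have "G Mod kernel G H h \<cong> ?I"
    using group_hom.FactGroup_iso[OF gh'] by simp
  then have "card (rcosets\<^bsub>G\<^esub> kernel G H h) = card (h ` carrier G)"
    using iso_same_card by (fastforce simp: FactGroup_def)
  then show ?thesis using gh.G.lagrange[OF gh.subgroup_kernel] by simp
qed

text \<open>The equation on \<open>t\<close> and the one on \<open>M\<close> each cut out a
  hyperplane of the corresponding kernel module. They keep this meaning over the Klein group,
  because its lifts have zero shifts and diagonal matrices. \<open>A = {1, 2, 3, 4}\<close> yields
  degree 225 and \<open>A = {1, 2}\<close> degree 450.\<close>

definition stab :: "nat set \<Rightarrow> triple set" where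
  "stab A = {(s, t, M) \<in> icos_carrier. s \<in> klein ` A \<and> t 1 + t 2 = t 3 + t 4 \<and> M $ 2 $ 3 = 0}"

lemma klein_elt_1: "klein_elt 1 = \<one>\<^bsub>icos\<^esub>"
  by (simp add: klein_elt_def klein_def diag_mat_def diag_sign_def vec_eq_iff forall_3 mat_def)

text \<open>Two different labels among 2, 3, 4 multiply to the third, which is
  \<open>9 - a - b\<close> because \<open>2 + 3 + 4 = 9\<close>.\<close>

lemma klein_compose:
  assumes "a \<in> {1, 2, 3, 4}" "b \<in> {1, 2, 3, 4}"
  shows "klein a \<circ> klein b = klein (if a = b then 1 else if a = 1 then b else if b = 1 then a else 9 - a - b)"
  using assms
  by (simp only: insert_iff empty_iff, elim disjE)
    (simp_all add: klein_def fun_eq_iff Transposition.transpose_def)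

lemma klein_elt_mult:
  assumes "a \<in> {1, 2, 3, 4}" "b \<in> {1, 2, 3, 4}"
  shows "klein_elt a \<otimes>\<^bsub>icos\<^esub> klein_elt b = klein_elt (if a = b then 1 else if a = 1 then b else if b = 1 then a else 9 - a - b)"
proof -
  have "diag_mat a ** diag_mat b = diag_mat (if a = b then 1 else if a = 1 then b else if b = 1 then a else 9 - a - b)"
    using assms
    by (simp only: insert_iff empty_iff, elim disjE)
      (simp_all add: diag_mat_def diag_sign_def matrix_3_simps)
  then show ?thesis unfolding klein_elt_def by (simp add: klein_compose[OF assms])
qed

lemma klein_elt_self:
  assumes "a \<in> {1, 2, 3, 4}"
  shows "klein_elt a \<otimes>\<^bsub>icos\<^esub> klein_elt a = \<one>\<^bsub>icos\<^esub>"
  using klein_elt_mult[OF assms assms] klein_elt_1 by simp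

lemma diag_sign_int: "\<exists>e :: int. diag_sign a $ i = of_int e \<and> e * e = 1"
proof -
  have "diag_sign a $ i = of_int 1 \<or> diag_sign a $ i = of_int (- 1)"
    using exhaust_3[of i] by (auto simp: diag_sign_def)
  then show ?thesis by (metis mult_1 mult_minus1_right minus_minus)
qed

text \<open>Conjugation by a diagonal sign matrix multiplies the entry in row \<open>i\<close> and
  column \<open>j\<close> by the product of the two signs. Only this diagonal shape matters later: a
  coordinate \<open>z = 0\<close> stays 0.\<close>

lemma klein_elt_kelt:
  obtains e f g :: int where
    "\<And>u x y z. klein_elt a \<otimes>\<^bsub>icos\<^esub> kelt u x y z = kelt (u \<circ> klein a) (e * x) (f * y) (g * z) \<otimes>\<^bsub>icos\<^esub> klein_elt a"
proof -
  obtain d :: "3 \<Rightarrow> int" where d: "\<And>i. diag_sign a $ i = of_int (d i)" "\<And>i. d i * d i = 1"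
    using diag_sign_int by metis
  have D: "of_int (d i) * of_int (d i) = (1 :: 25)" for i
    using d(2)[of i] by (metis of_int_1 of_int_mult)
  have k: "klein a i \<in> {1..5} \<longleftrightarrow> i \<in> {1..5}" for i
    using icos_carrierD(2)[OF klein_elt_closed[of a, unfolded klein_elt_def]] by (rule permutes_in_image)
  have kk: "klein a (klein a i) = i" for i
    using fun_cong[OF klein_self[of a], of i] by (simp only: comp_apply id_apply)
  have D': "of_int (d i) * (of_int (d i) * w) = (w :: 25)" for i w
    by (simp add: D mult.assoc[symmetric])
  have "diag_mat a ** kmat x y z = kmat (d 1 * d 2 * x) (d 1 * d 3 * y) (d 2 * d 3 * z) ** diag_mat a" for x y z
    by (simp add: kmat_def diag_mat_def d(1) matrix_3_simps mult_ac D D')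
  then have "klein_elt a \<otimes>\<^bsub>icos\<^esub> kelt u x y z =
      kelt (u \<circ> klein a) (d 1 * d 2 * x) (d 1 * d 3 * y) (d 2 * d 3 * z) \<otimes>\<^bsub>icos\<^esub> klein_elt a" for u x y z
    using k by (simp add: klein_elt_def kelt_def fun_eq_iff kk del: atLeastAtMost_iff)
  then show ?thesis using that by blast
qed

text \<open>Multiplying by the involution \<open>klein_elt a\<close> lands in the kernel;
  multiplying once more restores the element.\<close>

lemma klein_coset:
  assumes x: "(klein a, t, M) \<in> icos_carrier"
  obtains u x y z where "(klein a, t, M) = kelt u x y z \<otimes>\<^bsub>icos\<^esub> klein_elt a" "3 dvd (\<Sum>i\<in>{1..5}. u i)"
proof -
  interpret group icos by (rule group_icos)
  obtain b where b: "klein b = klein a" "klein_elt b = klein_elt a" "b \<in> {1, 2, 3, 4}"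
  proof (cases "a \<in> {2, 3, 4}")
    case False
    then have eqs: "klein 1 = klein a" "diag_sign 1 = diag_sign a"
      by (simp_all add: klein_def diag_sign_def)
    show ?thesis
      by (rule that[of 1]) (simp_all only: klein_elt_def diag_mat_def eqs insert_iff simp_thms)
  qed (use that[of a] in auto)
  let ?v = "(klein a, t, M)"
  have inc: "?v \<otimes>\<^bsub>icos\<^esub> klein_elt a \<in> icos_carrier"
    using m_closed[of ?v "klein_elt a"] x klein_elt_closed by simp
  moreover obtain t' M' where v': "?v \<otimes>\<^bsub>icos\<^esub> klein_elt a = (id, t', M')"
    by (simp add: klein_elt_def)
  ultimately obtain u x y z where u: "?v \<otimes>\<^bsub>icos\<^esub> klein_elt a = kelt u x y z" "3 dvd (\<Sum>i\<in>{1..5}. u i)"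
    using kelt_exists[of t' M'] by metis
  have "?v = ?v \<otimes>\<^bsub>icos\<^esub> (klein_elt a \<otimes>\<^bsub>icos\<^esub> klein_elt a)"
    using klein_elt_self[OF b(3)] x r_one[of ?v] unfolding b by simp
  also have "\<dots> = ?v \<otimes>\<^bsub>icos\<^esub> klein_elt a \<otimes>\<^bsub>icos\<^esub> klein_elt a"
    using x klein_elt_closed m_assoc[of ?v "klein_elt a" "klein_elt a"] by simp
  finally show ?thesis using that u by metis
qed

definition balanced :: "(nat \<Rightarrow> int) \<Rightarrow> bool" where
  "balanced u \<longleftrightarrow> 3 dvd (\<Sum>i\<in>{1..5}. u i) \<and> 3 dvd u 1 + u 2 - (u 3 + u 4)"

lemma klein_vals:
  "(klein a 1, klein a 2, klein a 3, klein a 4, klein a 5) \<in> {(1, 2, 3, 4, 5), (2, 1, 4, 3, 5), (3, 4, 1, 2, 5), (4, 3, 2, 1, 5)}"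
  by (simp add: klein_def Transposition.transpose_def)

lemma klein_sum_iff:
  fixes t :: "nat \<Rightarrow> 'a::comm_monoid_add"
  shows "t (klein a 1) + t (klein a 2) = t (klein a 3) + t (klein a 4) \<longleftrightarrow> t 1 + t 2 = t 3 + t 4"
  by (auto simp: klein_def Transposition.transpose_def add_ac)

lemma balanced_klein:
  assumes "balanced u"
  shows "balanced (u \<circ> klein a)"
proof -
  have eq: "u 3 + u 4 - (u 1 + u 2) = - (u 1 + u 2 - (u 3 + u 4))" by simp
  have "3 dvd u 3 + u 4 - (u 1 + u 2)" using assms unfolding eq balanced_def by (simp only: dvd_minus_iff)
  then show ?thesis
    using klein_vals[of a] assms unfolding balanced_def sum_1_5
    by (auto simp: add_ac)
qed

text \<open>The factor \<open>klein_elt a\<close> permutes the shifts by a permutation that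
  preserves or exchanges the pairs \<open>{1, 2}\<close> and \<open>{3, 4}\<close>, and it changes
  the entry in row 2 and column 3 at most by a sign. So both equations can be read off from the
  kernel part.\<close>

lemma stab_iff:
  assumes "a \<in> {1, 2, 3, 4}" "A \<subseteq> {1, 2, 3, 4}" "3 dvd (\<Sum>i\<in>{1..5}. u i)"
  shows "kelt u x y z \<otimes>\<^bsub>icos\<^esub> klein_elt a \<in> stab A \<longleftrightarrow> a \<in> A \<and> balanced u \<and> 5 dvd z"
proof -
  interpret group icos by (rule group_icos)
  have inc: "kelt u x y z \<otimes>\<^bsub>icos\<^esub> klein_elt a \<in> icos_carrier"
    using m_closed[of "kelt u x y z" "klein_elt a"] kelt_closed[OF assms(3)] klein_elt_closed by simp
  let ?t = "\<lambda>i. if i \<in> {1..5} then 3 * of_int (u i) else 0 :: 9"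
  have v: "kelt u x y z \<otimes>\<^bsub>icos\<^esub> klein_elt a = (klein a, \<lambda>i. ?t (klein a i), kmat x y z ** diag_mat a)"
    by (simp add: kelt_def klein_elt_def)
  have bal: "?t (klein a 1) + ?t (klein a 2) = ?t (klein a 3) + ?t (klein a 4) \<longleftrightarrow> balanced u"
  proof -
    have "?t (klein a 1) + ?t (klein a 2) = ?t (klein a 3) + ?t (klein a 4) \<longleftrightarrow> ?t 1 + ?t 2 = ?t 3 + ?t 4"
      by (rule klein_sum_iff)
    also have "\<dots> \<longleftrightarrow> 3 * (of_int (u 1 + u 2) :: 9) = 3 * of_int (u 3 + u 4)"
      by (simp add: distrib_left)
    also have "\<dots> \<longleftrightarrow> balanced u"
      unfolding mod9_thrice_eq_iff balanced_def using assms(3) by simp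
    finally show ?thesis .
  qed
  have M: "(kmat x y z ** diag_mat a) $ 2 $ 3 = 0 \<longleftrightarrow> 5 dvd z"
  proof -
    have "(kmat x y z ** diag_mat a) $ 2 $ 3 = 5 * of_int z * diag_sign a $ 3"
      by (simp add: kmat_def diag_mat_def matrix_matrix_mult_def sum_3)
    also have "\<dots> = 0 \<longleftrightarrow> 5 * (of_int z :: 25) = 0" by (auto simp: diag_sign_def)
    finally show ?thesis by (simp add: mod25_times5_eq_0_iff)
  qed
  have A: "klein a \<in> klein ` A \<longleftrightarrow> a \<in> A"
    using klein_inj assms(1,2) by (metis inj_on_image_mem_iff)
  show ?thesis using inc A bal M unfolding v stab_def mem_Collect_eq prod.case by blast
qed

lemma stabE:
  assumes "v \<in> stab A" "A \<subseteq> {1, 2, 3, 4}"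
  obtains a u x y where "a \<in> A" "balanced u" "v = kelt u x y 0 \<otimes>\<^bsub>icos\<^esub> klein_elt a"
proof -
  obtain a t M where v: "v = (klein a, t, M)" "a \<in> A" "(klein a, t, M) \<in> icos_carrier"
    using assms(1) by (auto simp: stab_def)
  obtain u x y z where u: "v = kelt u x y z \<otimes>\<^bsub>icos\<^esub> klein_elt a" "3 dvd (\<Sum>i\<in>{1..5}. u i)"
    using klein_coset[OF v(3)] v(1) by metis
  have "balanced u" "5 dvd z"
    using stab_iff[of a A u x y z] assms v(2) u by auto
  moreover from \<open>5 dvd z\<close> have "kelt u x y z = kelt u x y 0" by (simp add: kelt_eq_iff)
  ultimately show ?thesis using that v(2) u by metis
qed

lemma stabI:
  assumes "a \<in> A" "A \<subseteq> {1, 2, 3, 4}" "balanced u"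
  shows "kelt u x y 0 \<otimes>\<^bsub>icos\<^esub> klein_elt a \<in> stab A"
  using stab_iff[of a A u x y 0] assms by (auto simp: balanced_def)

lemma balanced_add:
  assumes "balanced u" "balanced u'"
  shows "balanced (\<lambda>i. u i + u' i)"
proof -
  have "u 1 + u' 1 + (u 2 + u' 2) - (u 3 + u' 3 + (u 4 + u' 4)) = (u 1 + u 2 - (u 3 + u 4)) + (u' 1 + u' 2 - (u' 3 + u' 4))"
    by simp
  then show ?thesis using assms by (simp only: balanced_def sum.distrib dvd_add simp_thms)
qed

lemma balanced_minus:
  assumes "balanced u"
  shows "balanced (\<lambda>i. - u i)"
proof -
  have "- u 1 + - u 2 - (- u 3 + - u 4) = - (u 1 + u 2 - (u 3 + u 4))" by simp
  then show ?thesis using assms by (simp only: balanced_def sum_negf dvd_minus_iff simp_thms)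
qed

lemma klein_elts_subgroup:
  assumes A: "A \<in> {{1, 2}, {1, 2, 3, 4}}"
  shows "subgroup (klein_elt ` A) icos"
proof -
  interpret group icos by (rule group_icos)
  have sub: "A \<subseteq> {1, 2, 3, 4}" and A1: "1 \<in> A" using A by auto
  show ?thesis
  proof (rule subgroupI)
    fix v assume "v \<in> klein_elt ` A"
    then obtain a where a: "v = klein_elt a" "a \<in> A" by blast
    have "inv\<^bsub>icos\<^esub> v = v"
      by (rule inv_equality) (use a sub klein_elt_self klein_elt_closed in auto)
    then show "inv\<^bsub>icos\<^esub> v \<in> klein_elt ` A" using a by (metis image_eqI)
  next
    fix v w assume "v \<in> klein_elt ` A" "w \<in> klein_elt ` A"
    then obtain a b where ab: "v = klein_elt a" "a \<in> A" "w = klein_elt b" "b \<in> A" by blast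
    have "(if a = b then 1 else if a = 1 then b else if b = 1 then a else 9 - a - b) \<in> A"
      using A ab by auto
    then show "v \<otimes>\<^bsub>icos\<^esub> w \<in> klein_elt ` A"
      by (simp only: ab(1,3) klein_elt_mult[OF subsetD[OF sub ab(2)] subsetD[OF sub ab(4)]] imageI)
  qed (use A1 klein_elt_closed in auto)
qed

text \<open>Elements are products of a kernel part and a Klein part. Moving the Klein part across
  the next kernel part keeps it in the hyperplanes, which are invariant under the Klein
  group.\<close>

lemma stab_subgroup:
  assumes A: "A \<in> {{1, 2}, {1, 2, 3, 4}}"
  shows "subgroup (stab A) icos"
proof -
  interpret group icos by (rule group_icos)
  interpret L: subgroup "klein_elt ` A" icos by (rule klein_elts_subgroup[OF A])
  have sub: "A \<subseteq> {1, 2, 3, 4}" using A by auto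
  have kc: "kelt u x y z \<in> carrier icos" if "balanced u" for u x y z
    using kelt_closed that by (simp add: balanced_def)
  have dc: "klein_elt a \<in> carrier icos" for a using klein_elt_closed by simp
  have assoc4: "d \<otimes>\<^bsub>icos\<^esub> k \<otimes>\<^bsub>icos\<^esub> (l \<otimes>\<^bsub>icos\<^esub> e) = d \<otimes>\<^bsub>icos\<^esub> (k \<otimes>\<^bsub>icos\<^esub> l) \<otimes>\<^bsub>icos\<^esub> e"
    and assoc4': "d \<otimes>\<^bsub>icos\<^esub> (k \<otimes>\<^bsub>icos\<^esub> l) \<otimes>\<^bsub>icos\<^esub> e = d \<otimes>\<^bsub>icos\<^esub> k \<otimes>\<^bsub>icos\<^esub> (l \<otimes>\<^bsub>icos\<^esub> e)"
    if "d \<in> carrier icos" "k \<in> carrier icos" "l \<in> carrier icos" "e \<in> carrier icos" for d k l e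
    using that by (simp_all add: m_assoc del: icos_simps)
  show ?thesis
  proof (rule subgroupI)
    show "stab A \<subseteq> carrier icos" by (auto simp: stab_def)
    have "\<one>\<^bsub>icos\<^esub> \<in> stab A"
      using A icos_one_closed by (auto simp: stab_def klein_def mat_def)
    then show "stab A \<noteq> {}" by blast
  next
    fix v assume "v \<in> stab A"
    then obtain a u x y where a: "a \<in> A" "balanced u" "v = kelt u x y 0 \<otimes>\<^bsub>icos\<^esub> klein_elt a"
      using sub by (rule stabE)
    obtain e f g :: int where c: "\<And>u x y z. klein_elt a \<otimes>\<^bsub>icos\<^esub> kelt u x y z = kelt (u \<circ> klein a) (e * x) (f * y) (g * z) \<otimes>\<^bsub>icos\<^esub> klein_elt a"
      using klein_elt_kelt[of a] by metis
    have "inv\<^bsub>icos\<^esub> v = klein_elt a \<otimes>\<^bsub>icos\<^esub> kelt (\<lambda>i. - u i) (- x) (- y) 0"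
    proof (rule inv_equality)
      have "kelt (\<lambda>i. - u i) (- x) (- y) 0 \<otimes>\<^bsub>icos\<^esub> kelt u x y 0 = \<one>\<^bsub>icos\<^esub>"
        by (simp only: kelt_mult kelt_zero add.left_inverse add_0)
      then show "klein_elt a \<otimes>\<^bsub>icos\<^esub> kelt (\<lambda>i. - u i) (- x) (- y) 0 \<otimes>\<^bsub>icos\<^esub> v = \<one>\<^bsub>icos\<^esub>"
        unfolding a(3)
        using assoc4[OF dc kc[OF balanced_minus[OF a(2)]] kc[OF a(2)] dc] klein_elt_self[of a] a(1) sub dc[of a]
        by (simp add: subset_iff del: icos_simps)
    qed (use a kc[OF a(2)] kc[OF balanced_minus[OF a(2)]] dc in \<open>auto simp del: icos_simps\<close>)
    also have "\<dots> \<in> stab A"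
      unfolding c using a(1) sub balanced_klein[OF balanced_minus[OF a(2)]] by (simp add: stabI del: icos_simps(2))
    finally show "inv\<^bsub>icos\<^esub> v \<in> stab A" .
  next
    fix v w assume v: "v \<in> stab A" and w: "w \<in> stab A"
    from v obtain a u x y where a: "a \<in> A" "balanced u" "v = kelt u x y 0 \<otimes>\<^bsub>icos\<^esub> klein_elt a"
      using sub by (rule stabE)
    from w obtain b u' x' y' where b: "b \<in> A" "balanced u'" "w = kelt u' x' y' 0 \<otimes>\<^bsub>icos\<^esub> klein_elt b"
      using sub by (rule stabE)
    obtain e f g :: int where c: "\<And>u x y z. klein_elt a \<otimes>\<^bsub>icos\<^esub> kelt u x y z = kelt (u \<circ> klein a) (e * x) (f * y) (g * z) \<otimes>\<^bsub>icos\<^esub> klein_elt a"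
      using klein_elt_kelt[of a] by metis
    let ?u = "u' \<circ> klein a"
    have u: "balanced ?u" by (rule balanced_klein[OF b(2)])
    obtain d where d: "klein_elt a \<otimes>\<^bsub>icos\<^esub> klein_elt b = klein_elt d" "d \<in> A"
      using L.m_closed[of "klein_elt a" "klein_elt b"] a b by blast
    have "v \<otimes>\<^bsub>icos\<^esub> w = kelt u x y 0 \<otimes>\<^bsub>icos\<^esub> (klein_elt a \<otimes>\<^bsub>icos\<^esub> kelt u' x' y' 0) \<otimes>\<^bsub>icos\<^esub> klein_elt b"
      unfolding a(3) b(3) using assoc4[OF kc[OF a(2)] dc kc[OF b(2)] dc] .
    also have "\<dots> = kelt u x y 0 \<otimes>\<^bsub>icos\<^esub> kelt ?u (e * x') (f * y') (g * 0) \<otimes>\<^bsub>icos\<^esub> (klein_elt a \<otimes>\<^bsub>icos\<^esub> klein_elt b)"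
      unfolding c using assoc4'[OF kc[OF a(2)] kc[OF u] dc dc] .
    also have "\<dots> \<in> stab A"
      unfolding d kelt_mult using stabI[OF d(2) sub balanced_add[OF a(2) u]] by simp
    finally show "v \<otimes>\<^bsub>icos\<^esub> w \<in> stab A" .
  qed
qed

lemma stab_kernel_iso:
  assumes A: "A \<in> {{1, 2}, {1, 2, 3, 4}}"
  shows "icos\<lparr>carrier := {x \<in> stab A. fst x = id}\<rparr> \<cong> elem_ab 3 3 \<times>\<times> elem_ab 5 2"
proof -
  let ?N = "{x \<in> stab A. fst x = id}"
  have sub: "A \<subseteq> {1, 2, 3, 4}" and A1: "1 \<in> A" using A by auto
  \<comment> \<open>Three free values solve both equations over the integers: the balance gives the
    value at 4, and the zero sum gives \<open>-2 * (a 0 + a 1)\<close> at 5.\<close>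
  define u :: "(nat \<Rightarrow> int) \<Rightarrow> nat \<Rightarrow> int" where
    "u = (\<lambda>a i. if i = 5 then - (a 0 + a 1) - (a 0 + a 1) else if i = 4 then a 0 + a 1 - a 2 else a (i - 1))"
  define f where "f = (\<lambda>a (b :: nat \<Rightarrow> int). kelt (u a) (b 0) (b 1) 0)"
  have u_vals: "u a 1 = a 0" "u a 2 = a 1" "u a 3 = a 2" "u a 4 = a 0 + a 1 - a 2" "u a 5 = - (a 0 + a 1) - (a 0 + a 1)" for a
    by (simp_all add: u_def)
  have bal: "balanced (u a)" for a unfolding balanced_def sum_1_5 u_vals by simp
  interpret G: group icos by (rule group_icos)
  have kc: "kelt w x y z \<in> carrier icos" if "balanced w" for w x y z
    using kelt_closed that by (simp add: balanced_def)
  have one: "kelt w x y z \<otimes>\<^bsub>icos\<^esub> klein_elt 1 = kelt w x y z" if "balanced w" for w x y z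
    using kc[OF that] by (simp only: klein_elt_1 G.r_one)
  show ?thesis
  proof (rule iso_elem_ab_DirProd[where f = f])
    interpret S: subgroup "stab A" icos by (rule stab_subgroup[OF A])
    interpret gh: group_hom icos "alt_group 5" fst by (rule group_hom_fst)
    have "subgroup (stab A \<inter> kernel icos (alt_group 5) fst) icos"
      using G.subgroups_Inter_pair[OF S.subgroup_axioms gh.subgroup_kernel] .
    moreover have "stab A \<inter> kernel icos (alt_group 5) fst = ?N"
      by (auto simp: kernel_fst stab_def)
    ultimately show "group (icos\<lparr>carrier := ?N\<rparr>)" using G.subgroup_imp_group by simp
    show "f a b \<in> carrier (icos\<lparr>carrier := ?N\<rparr>)" for a b
      using stabI[OF A1 sub bal[of a], of "b 0" "b 1"] unfolding one[OF bal] by (simp add: f_def) (simp add: kelt_def)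
    show "f (\<lambda>i. a i + c i) (\<lambda>i. b i + d i) = f a b \<otimes>\<^bsub>icos\<lparr>carrier := ?N\<rparr>\<^esub> f c d" for a b c d
    proof -
      have "u (\<lambda>i. a i + c i) = (\<lambda>i. u a i + u c i)" by (auto simp: u_def)
      then show ?thesis by (simp add: f_def kelt_mult)
    qed
    show "f a b = \<one>\<^bsub>icos\<lparr>carrier := ?N\<rparr>\<^esub> \<longleftrightarrow> (\<forall>i<3. int 3 dvd a i) \<and> (\<forall>i<2. int 5 dvd b i)" for a b
    proof -
      have "f a b = \<one>\<^bsub>icos\<lparr>carrier := ?N\<rparr>\<^esub> \<longleftrightarrow> f a b = kelt (\<lambda>_. 0) 0 0 0"
        unfolding kelt_zero by simp
      also have "\<dots> \<longleftrightarrow> (3 dvd a 0 \<and> 3 dvd a 1 \<and> 3 dvd a 2) \<and> 5 dvd b 0 \<and> 5 dvd b 1"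
        unfolding f_def kelt_eq_iff diff_0_right ball_1_5 u_vals by presburger
      finally show ?thesis by (simp add: all_less_3 all_less_2)
    qed
    fix v assume "v \<in> carrier (icos\<lparr>carrier := ?N\<rparr>)"
    then have v: "v \<in> stab A" "fst v = id" by auto
    from v(1) obtain a w x y where w: "a \<in> A" "balanced w" "v = kelt w x y 0 \<otimes>\<^bsub>icos\<^esub> klein_elt a"
      using sub by (rule stabE)
    have "klein a = klein 1" using v(2) w(3) by (simp add: kelt_def klein_elt_def klein_def)
    then have "a = 1" using klein_inj w(1) sub by (auto dest!: inj_onD)
    then have v': "v = kelt w x y 0" using w(3) one[OF w(2)] by simp
    have "3 dvd w 4 - (w 1 + w 2 - w 3) \<and> 3 dvd w 5 - (- (w 1 + w 2) - (w 1 + w 2))"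
      using w(2) unfolding balanced_def sum_1_5 by presburger
    then have "v = f (\<lambda>i. w (i + 1)) (\<lambda>i. if i = 0 then x else y)"
      unfolding v' f_def kelt_eq_iff ball_1_5 u_vals
      by (simp add: eval_nat_numeral)
    then show "\<exists>a b. v = f a b" by blast
  qed simp_all
qed

lemma stab_semidirect:
  assumes A: "A \<in> {{1, 2}, {1, 2, 3, 4}}"
    and B: "icos\<lparr>carrier := klein_elt ` A\<rparr> \<cong> B"
  shows "is_semidirect_product (icos\<lparr>carrier := stab A\<rparr>) (elem_ab 3 3 \<times>\<times> elem_ab 5 2) B"
proof -
  let ?K = "{x \<in> stab A. fst x = id}"
  let ?S = "icos\<lparr>carrier := stab A\<rparr>"
  have sub: "A \<subseteq> {1, 2, 3, 4}" and A1: "1 \<in> A" using A by auto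
  interpret G: group icos by (rule group_icos)
  interpret S: subgroup "stab A" icos by (rule stab_subgroup[OF A])
  interpret L: subgroup "klein_elt ` A" icos by (rule klein_elts_subgroup[OF A])
  have gS: "group ?S" using G.subgroup_imp_group[OF S.subgroup_axioms] .
  have "fst \<in> hom ?S (alt_group 5)"
    using fst_hom S.subset by (auto simp: hom_def)
  then have gh: "group_hom ?S (alt_group 5) fst"
    using gS alt_group_is_group by (simp add: group_hom_def group_hom_axioms_def)
  have ker: "kernel ?S (alt_group 5) fst = ?K" by (auto simp: kernel_def alt_group_one)
  have K: "?K \<lhd> ?S" using group_hom.normal_kernel[OF gh] unfolding ker .
  have zero: "balanced (\<lambda>_. 0)" by (simp add: balanced_def)
  have LS: "klein_elt ` A \<subseteq> stab A"
  proof
    fix v assume "v \<in> klein_elt ` A"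
    then obtain a where a: "a \<in> A" "v = klein_elt a" by blast
    show "v \<in> stab A"
      using stabI[OF a(1) sub zero, of 0 0] klein_elt_closed unfolding kelt_zero a(2)
      by (metis G.l_one icos_simps(1))
  qed
  then have L: "subgroup (klein_elt ` A) ?S"
    using G.subgroup_incl[OF L.subgroup_axioms S.subgroup_axioms] by simp
  have "?K \<inter> klein_elt ` A = {\<one>\<^bsub>?S\<^esub>}"
  proof
    show "?K \<inter> klein_elt ` A \<subseteq> {\<one>\<^bsub>?S\<^esub>}"
    proof
      fix v assume "v \<in> ?K \<inter> klein_elt ` A"
      then obtain a where a: "a \<in> A" "v = klein_elt a" "fst v = id" by blast
      then have "klein a = klein 1" by (simp add: klein_elt_def klein_def)
      then have "a = 1" using klein_inj a(1) sub by (auto dest!: inj_onD)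
      then show "v \<in> {\<one>\<^bsub>?S\<^esub>}" using a(2) klein_elt_1 by simp
    qed
    show "{\<one>\<^bsub>?S\<^esub>} \<subseteq> ?K \<inter> klein_elt ` A"
      using S.one_closed L.one_closed by simp
  qed
  moreover have "?K <#>\<^bsub>?S\<^esub> klein_elt ` A = carrier ?S"
  proof
    show "?K <#>\<^bsub>?S\<^esub> klein_elt ` A \<subseteq> carrier ?S"
      using LS S.m_closed by (auto simp: set_mult_def simp del: icos_simps(2))
    show "carrier ?S \<subseteq> ?K <#>\<^bsub>?S\<^esub> klein_elt ` A"
    proof
      fix v assume "v \<in> carrier ?S"
      then have "v \<in> stab A" by simp
      then obtain a u x y where a: "a \<in> A" "balanced u" "v = kelt u x y 0 \<otimes>\<^bsub>icos\<^esub> klein_elt a"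
        using sub by (rule stabE)
      have "kelt u x y 0 \<in> icos_carrier" using a(2) kelt_closed by (simp add: balanced_def)
      then have "kelt u x y 0 \<in> stab A"
        using stabI[OF A1 sub a(2), of x y] unfolding klein_elt_1 by (metis G.r_one icos_simps(1))
      then have "kelt u x y 0 \<in> ?K" by (simp add: kelt_def)
      then show "v \<in> ?K <#>\<^bsub>?S\<^esub> klein_elt ` A"
        unfolding set_mult_def using a
        by (intro UN_I[of "kelt u x y 0"] UN_I[of "klein_elt a"]) (simp_all del: icos_simps(2))
    qed
  qed
  ultimately show ?thesis
    unfolding is_semidirect_product_def
    using K L stab_kernel_iso[OF A] B by (intro exI[of _ ?K] exI[of _ "klein_elt ` A"]) simp
qed

lemma klein_elts_iso:
  "icos\<lparr>carrier := klein_elt ` {1, 2}\<rparr> \<cong> elem_ab 2 1"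
  "icos\<lparr>carrier := klein_elt ` {1, 2, 3, 4}\<rparr> \<cong> elem_ab 2 2"
proof -
  interpret G: group icos by (rule group_icos)
  have inj: "klein_elt a = \<one>\<^bsub>icos\<^esub> \<longleftrightarrow> a = 1" if "a \<in> {1, 2, 3, 4}" for a
    using klein_inj that unfolding klein_elt_1[symmetric] inj_on_def klein_elt_def by auto
  show "icos\<lparr>carrier := klein_elt ` {1, 2}\<rparr> \<cong> elem_ab 2 1"
  proof (rule iso_elem_ab)
    let ?f = "\<lambda>a :: nat \<Rightarrow> int. klein_elt (if even (a 0) then 1 else 2)"
    show "group (icos\<lparr>carrier := klein_elt ` {1, 2}\<rparr>)"
      using G.subgroup_imp_group[OF klein_elts_subgroup] by blast
    show "?f a \<in> carrier (icos\<lparr>carrier := klein_elt ` {1, 2}\<rparr>)" for a by simp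
    show "?f (\<lambda>i. a i + c i) = ?f a \<otimes>\<^bsub>icos\<lparr>carrier := klein_elt ` {1, 2}\<rparr>\<^esub> ?f c" for a c
      by (simp add: klein_elt_mult)
    show "?f a = \<one>\<^bsub>icos\<lparr>carrier := klein_elt ` {1, 2}\<rparr>\<^esub> \<longleftrightarrow> (\<forall>i<1. int 2 dvd a i)" for a
      using inj[of "if even (a 0) then 1 else 2"] by simp
    show "\<exists>a. v = ?f a" if "v \<in> carrier (icos\<lparr>carrier := klein_elt ` {1, 2}\<rparr>)" for v
      using that by (auto intro: exI[of _ "\<lambda>_. 0"] exI[of _ "\<lambda>_. 1"])
  qed simp
  show "icos\<lparr>carrier := klein_elt ` {1, 2, 3, 4}\<rparr> \<cong> elem_ab 2 2"
  proof (rule iso_elem_ab)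
    \<comment> \<open>The parities of \<open>a 0\<close> and \<open>a 1\<close> are the exponents of
      the generators with labels 2 and 3; the product of the two has label 4.\<close>
    let ?f = "\<lambda>a :: nat \<Rightarrow> int. klein_elt (if even (a 0) then if even (a 1) then 1 else 3 else if even (a 1) then 2 else 4)"
    show "group (icos\<lparr>carrier := klein_elt ` {1, 2, 3, 4}\<rparr>)"
      using G.subgroup_imp_group[OF klein_elts_subgroup] by blast
    show "?f a \<in> carrier (icos\<lparr>carrier := klein_elt ` {1, 2, 3, 4}\<rparr>)" for a by simp
    show "?f (\<lambda>i. a i + c i) = ?f a \<otimes>\<^bsub>icos\<lparr>carrier := klein_elt ` {1, 2, 3, 4}\<rparr>\<^esub> ?f c" for a c
      by (simp add: klein_elt_mult)
    show "?f a = \<one>\<^bsub>icos\<lparr>carrier := klein_elt ` {1, 2, 3, 4}\<rparr>\<^esub> \<longleftrightarrow> (\<forall>i<2. int 2 dvd a i)" for a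
      using inj[of "if even (a 0) then if even (a 1) then 1 else 3 else if even (a 1) then 2 else 4"]
      by (simp add: all_less_2)
    show "\<exists>a. v = ?f a" if "v \<in> carrier (icos\<lparr>carrier := klein_elt ` {1, 2, 3, 4}\<rparr>)" for v
    proof -
      have ex: "\<exists>a. klein_elt 1 = ?f a" "\<exists>a. klein_elt 2 = ?f a" "\<exists>a. klein_elt 3 = ?f a" "\<exists>a. klein_elt 4 = ?f a"
        by (rule exI[of _ "\<lambda>_. 0"], simp) (rule exI[of _ "\<lambda>i. if i = 0 then 1 else 0"], simp,
          rule exI[of _ "\<lambda>i. if i = 0 then 0 else 1"], simp, rule exI[of _ "\<lambda>_. 1"], simp)
      have "v = klein_elt 1 \<or> v = klein_elt 2 \<or> v = klein_elt 3 \<or> v = klein_elt 4"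
        using that by simp
      then show ?thesis by (elim disjE) (simp_all only: ex)
    qed
  qed simp
qed

section \<open>Orders and indices\<close>

lemma order_icos: "order icos = 607500"
proof -
  have "card (kernel icos (alt_group 5) fst) = 3 ^ 4 * 5 ^ 3"
    using iso_same_card[OF kernel_iso] unfolding kernel_fst by (simp add: card_cartesian_product card_elem_ab)
  then show ?thesis
    using card_group_hom[OF group_hom_fst finite_icos] by (simp add: fst_surj card_alt_5)
qed

lemma card_stab:
  assumes A: "A \<in> {{1, 2}, {1, 2, 3, 4}}"
  shows "card (stab A) = 675 * card A"
proof -
  let ?S = "icos\<lparr>carrier := stab A\<rparr>"
  have sub: "A \<subseteq> {1, 2, 3, 4}" using A by auto
  interpret G: group icos by (rule group_icos)
  interpret S: subgroup "stab A" icos by (rule stab_subgroup[OF A])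
  have "fst \<in> hom ?S (alt_group 5)"
    using fst_hom S.subset by (auto simp: hom_def)
  then have gh: "group_hom ?S (alt_group 5) fst"
    using G.subgroup_imp_group[OF S.subgroup_axioms] alt_group_is_group by (simp add: group_hom_def group_hom_axioms_def)
  have ker: "kernel ?S (alt_group 5) fst = {x \<in> stab A. fst x = id}" by (auto simp: kernel_def alt_group_one)
  have "fst ` stab A = klein ` A"
  proof
    show "fst ` stab A \<subseteq> klein ` A" by (auto simp: stab_def)
    have "klein_elt a \<in> stab A" if "a \<in> A" for a
      using that klein_elt_closed[of a] by (auto simp: stab_def klein_elt_def diag_mat_def)
    then show "klein ` A \<subseteq> fst ` stab A" by (force simp: klein_elt_def)
  qed
  moreover have "card (klein ` A) = card A"
    using inj_on_subset[OF klein_inj sub] by (rule card_image)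
  moreover have "card {x \<in> stab A. fst x = id} = 3 ^ 3 * 5 ^ 2"
    using iso_same_card[OF stab_kernel_iso[OF A]] by (simp add: card_cartesian_product card_elem_ab)
  moreover have "finite (carrier ?S)" using finite_icos S.subset finite_subset by auto
  ultimately show ?thesis
    using card_group_hom[OF gh] unfolding ker by (simp add: order_def)
qed

text \<open>Lagrange's theorem with \<open>607500 = 675 * 900\<close>, where
  \<open>675 = 3^3 * 5^2\<close>.\<close>

lemma card_rcosets_stab:
  assumes A: "A \<in> {{1, 2}, {1, 2, 3, 4}}"
  shows "card (rcosets\<^bsub>icos\<^esub> stab A) * card A = 900"
  using group.lagrange[OF group_icos stab_subgroup[OF A]]
  unfolding order_icos card_stab[OF A] by (simp add: mult.commute)

section \<open>Elements of prime order\<close>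

lemma icos_conj:
  assumes g: "(s, r, N) \<in> icos_carrier" and x: "(id, t, M) \<in> icos_carrier"
  shows "(s, r, N) \<otimes>\<^bsub>icos\<^esub> (id, t, M) \<otimes>\<^bsub>icos\<^esub> inv\<^bsub>icos\<^esub> (s, r, N)
    = (id, \<lambda>i. t (inv' s i), N ** M ** transpose N)"
  using permutes_inv_o[OF icos_carrierD(2)[OF g]] by (simp add: icos_inv[OF g])

lemma fst_conj:
  assumes "g \<in> icos_carrier"
  shows "fst (g \<otimes>\<^bsub>icos\<^esub> x \<otimes>\<^bsub>icos\<^esub> inv\<^bsub>icos\<^esub> g) = fst g \<circ> fst x \<circ> inv' (fst g)"
  using assms by (cases g; cases x) (simp add: icos_inv)

text \<open>A point moved by \<open>s\<close> lies in a 3-cycle, and the two remaining points cannot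
  be exchanged by a permutation whose cube is trivial.\<close>

lemma perm_cube_fixed_points:
  fixes s :: "nat \<Rightarrow> nat"
  assumes s: "s permutes {1..5}" and cube: "s \<circ> s \<circ> s = id"
  obtains i j where "i \<in> {1..5}" "j \<in> {1..5}" "i \<noteq> j" "s i = i" "s j = j"
proof (cases "s = id")
  case True
  then show ?thesis using that[of 1 2] by simp
next
  case False
  then obtain a where a: "s a \<noteq> a" by (auto simp: fun_eq_iff)
  have sss: "s (s (s x)) = x" for x using cube by (metis comp_apply id_apply)
  have inj: "s x = s y \<longleftrightarrow> x = y" for x y using permutes_inj[OF s] by (auto dest: injD)
  have in5: "s x \<in> {1..5} \<longleftrightarrow> x \<in> {1..5}" for x using permutes_in_image[OF s] .
  have a5: "a \<in> {1..5}" using a permutes_not_in[OF s] by blast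
  have dist: "s (s a) \<noteq> a" "s (s a) \<noteq> s a"
    using a sss[of a] inj by metis+
  let ?D = "{1..5} - {a, s a, s (s a)}"
  have "card ?D = 5 - card {a, s a, s (s a)}"
    by (subst card_Diff_subset) (use a5 in5 in auto)
  also have "card {a, s a, s (s a)} = 3"
    using a dist by (simp add: card_insert_if eq_commute)
  finally have "card ?D = 2" by simp
  then obtain b c where bc: "?D = {b, c}" "b \<noteq> c" by (auto simp: card_2_iff)
  have D: "s x \<in> ?D" if x: "x \<in> ?D" for x
  proof -
    have xn: "x \<noteq> a" "x \<noteq> s a" "x \<noteq> s (s a)" "x \<in> {1..5}" using x by simp_all
    have "s x \<noteq> a" using sss[of x] xn(3) by metis
    moreover have "s x \<noteq> s a" using inj[of x a] xn(1) by simp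
    moreover have "s x \<noteq> s (s a)" using inj[of x "s a"] xn(2) by simp
    moreover have "s x \<in> {1..5}" using in5[of x] xn(4) by (rule iffD2)
    ultimately show ?thesis by (simp only: Diff_iff insert_iff empty_iff simp_thms)
  qed
  have "s b \<in> {b, c}" "s c \<in> {b, c}" using D[unfolded bc(1), of b] D[unfolded bc(1), of c] by simp_all
  then have "s b = b \<and> s c = c \<or> s b = c \<and> s c = b" using bc(2) inj[of b c] by auto
  moreover have "\<not> (s b = c \<and> s c = b)" using sss[of b] bc(2) by metis
  moreover have "b \<in> {1..5}" "c \<in> {1..5}" using bc(1) by blast+
  ultimately show ?thesis using that bc(2) by blast
qed

text \<open>At a fixed point \<open>i\<close> of \<open>s\<close>, the shift of the cube is
  \<open>3 * t i\<close>. As it vanishes modulo 9, the shift \<open>t i\<close> vanishes modulo 3.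
  With two fixed points this forces \<open>M\<close> to be 1 modulo 5, and then \<open>s\<close> to
  be trivial.\<close>

lemma icos_order_3:
  assumes x: "x \<in> icos_carrier" and cube: "x \<otimes>\<^bsub>icos\<^esub> x \<otimes>\<^bsub>icos\<^esub> x = \<one>\<^bsub>icos\<^esub>"
  shows "fst x = id"
proof -
  obtain s t M where v: "x = (s, t, M)" by (cases x)
  note X = icos_carrierD[OF x[unfolded v]]
  have s3: "s \<circ> s \<circ> s = id" and t3: "\<And>i. t (s (s i)) + t (s i) + t i = 0"
    using cube by (simp_all add: v fun_eq_iff)
  obtain i j where ij: "i \<in> {1..5}" "j \<in> {1..5}" "i \<noteq> j" "s i = i" "s j = j"
    using perm_cube_fixed_points[OF X(2) s3] by blast
  have "3 * t i = t (s (s i)) + t (s i) + t i" "3 * t j = t (s (s j)) + t (s j) + t j"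
    using ij by simp_all
  then have "3 * t i = 0" "3 * t j = 0" using t3 by simp_all
  from icos_two_fixed_points[OF x[unfolded v] ij this]
  show ?thesis using icos_matrix_trivial(1)[OF x[unfolded v]] v by simp
qed

lemma icos_order_5:
  assumes x: "x \<in> icos_carrier"
    and pow: "x \<otimes>\<^bsub>icos\<^esub> x \<otimes>\<^bsub>icos\<^esub> x \<otimes>\<^bsub>icos\<^esub> x \<otimes>\<^bsub>icos\<^esub> x = \<one>\<^bsub>icos\<^esub>"
  shows "fst x = id"
proof -
  obtain s t M where v: "x = (s, t, M)" by (cases x)
  have "M ** M ** M ** M ** M = mat 1" using pow by (simp add: v)
  then show ?thesis
    using order5_special_orthogonal icos_carrierD(5)[OF x[unfolded v]] icos_matrix_trivial(1)[OF x[unfolded v]] v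
    by simp
qed

text \<open>Only the unordered pair of images of 1 and 2 is prescribed, so an odd choice can be
  repaired by exchanging these two points.\<close>

lemma even_perm_exists:
  assumes "{a, b, c, d} \<subseteq> {1..5::nat}" "distinct [a, b, c, d]"
  obtains p where "p \<in> carrier (alt_group 5)" "{p 1, p 2} = {a, b}" "p 3 = c" "p 4 = d"
proof -
  have "card ({1..5} - {a, b, c, d}) = 1"
    using assms by (subst card_Diff_subset) auto
  then obtain e where e: "{1..5} - {a, b, c, d} = {e}" using card_1_singletonE by blast
  then have e5: "e \<in> {1..5}" "e \<notin> {a, b, c, d}" by blast+
  define q where "q = (\<lambda>i::nat. if i = 1 then a else if i = 2 then b else if i = 3 then c else if i = 4 then d
    else if i = 5 then e else i)"
  have A5: "{1..5} = {1, 2, 3, 4, 5::nat}" by auto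
  have inj: "inj_on q {1..5}" unfolding A5 using assms(2) e5(2) by (simp add: q_def eq_commute)
  have "q ` {1..5} \<subseteq> {1..5}" using assms(1) e5(1) unfolding q_def by (auto simp del: atLeastAtMost_iff)
  then have q: "q permutes {1..5}"
  proof (intro bij_imp_permutes)
    show "bij_betw q {1..5} {1..5}"
      unfolding bij_betw_def using inj endo_inj_surj[OF _ \<open>q ` {1..5} \<subseteq> {1..5}\<close> inj] by simp
  qed (auto simp: q_def)
  show ?thesis
  proof (cases "evenperm q")
    case True
    then show ?thesis using that[of q] q by (simp add: alt_group_carrier q_def)
  next
    case False
    let ?r = "q \<circ> swap_pts 1 2"
    have "?r permutes {1..5}" by (rule permutes_compose[OF permutes_swap_id q]) auto
    moreover have "evenperm ?r"
      using False q by (subst evenperm_comp) (auto simp: evenperm_swap permutation_swap_id intro: permutation_permutes[THEN iffD2])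
    moreover have "{?r 1, ?r 2} = {a, b}" "?r 3 = c" "?r 4 = d"
      by (auto simp: q_def Transposition.transpose_def)
    ultimately show ?thesis using that[of ?r] by (simp add: alt_group_carrier)
  qed
qed

lemma icos_lift:
  assumes "p \<in> carrier (alt_group 5)"
  obtains r N where "(p, r, N) \<in> icos_carrier"
  using assms fst_surj by (metis imageE prod.collapse)

text \<open>Of five values modulo 3, either two disjoint pairs of equal values exist, and one member
  of each pair goes on either side; or the values are \<open>x, x, x, y, z\<close> with
  \<open>x, y, z\<close> distinct, and then \<open>y + z = - x = x + x\<close>. The proof is the
  finite check.\<close>

lemma balanced_pairs:
  fixes v1 v2 v3 v4 v5 :: int
  assumes "v1 \<in> {0, 1, 2}" "v2 \<in> {0, 1, 2}" "v3 \<in> {0, 1, 2}" "v4 \<in> {0, 1, 2}" "v5 \<in> {0, 1, 2}"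
  shows "3 dvd v1 + v2 - (v3 + v4) \<or> 3 dvd v1 + v3 - (v2 + v4) \<or> 3 dvd v1 + v4 - (v2 + v3)
    \<or> 3 dvd v1 + v2 - (v3 + v5) \<or> 3 dvd v1 + v3 - (v2 + v5) \<or> 3 dvd v1 + v5 - (v2 + v3)
    \<or> 3 dvd v1 + v2 - (v4 + v5) \<or> 3 dvd v1 + v4 - (v2 + v5) \<or> 3 dvd v1 + v5 - (v2 + v4)
    \<or> 3 dvd v1 + v3 - (v4 + v5) \<or> 3 dvd v1 + v4 - (v3 + v5) \<or> 3 dvd v1 + v5 - (v3 + v4)
    \<or> 3 dvd v2 + v3 - (v4 + v5) \<or> 3 dvd v2 + v4 - (v3 + v5) \<or> 3 dvd v2 + v5 - (v3 + v4)"
  using assms by (simp only: insert_iff empty_iff simp_thms, elim disjE) simp_all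

text \<open>The fifteen linear forms are the norm-one lines modulo 5: every vector is orthogonal to one of them.\<close>

lemma isotropic_orbit:
  fixes x y z :: int
  assumes "x \<in> {0, 1, 2, 3, 4}" "y \<in> {0, 1, 2, 3, 4}" "z \<in> {0, 1, 2, 3, 4}"
  shows "5 dvd z \<or> 5 dvd x \<or> 5 dvd y \<or>
    5 dvd - x - 2 * y + z \<or> 5 dvd 2 * x + y - z \<or> 5 dvd - x - y + 2 * z \<or>
    5 dvd x + 2 * y + z \<or> 5 dvd - 2 * x - y - z \<or> 5 dvd x + y + 2 * z \<or>
    5 dvd x - 2 * y - z \<or> 5 dvd - 2 * x + y + z \<or> 5 dvd x - y - 2 * z \<or>
    5 dvd - x + 2 * y - z \<or> 5 dvd 2 * x - y + z \<or> 5 dvd - x + y - 2 * z"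
  using assms by (simp only: insert_iff empty_iff simp_thms, elim disjE) simp_all

lemma conj_mult:
  fixes G (structure)
  assumes "group G" "g \<in> carrier G" "x \<in> carrier G" "y \<in> carrier G"
  shows "(g \<otimes> x \<otimes> inv g) \<otimes> (g \<otimes> y \<otimes> inv g) = g \<otimes> (x \<otimes> y) \<otimes> inv g"
proof -
  interpret group G by fact
  have "inv g \<otimes> (g \<otimes> w) = w" if "w \<in> carrier G" for w
    using that assms(2) by (simp add: m_assoc[symmetric])
  then show ?thesis using assms(2-4) by (simp add: m_assoc)
qed

text \<open>In the dihedral group generated by \<open>y\<close> and \<open>d\<close>, the product
  \<open>n = y \<otimes> d\<close> has odd order, so \<open>m = n [^] (k + 1)\<close> is a square
  root of it. As \<open>d\<close> inverts \<open>m\<close>, \<open>m \<otimes> d \<otimes> inv m = m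
  \<otimes> m \<otimes> d = y\<close>.\<close>

lemma conj_involutions:
  fixes G (structure)
  assumes "group G" and yd: "y \<in> carrier G" "d \<in> carrier G" "y \<otimes> y = \<one>" "d \<otimes> d = \<one>"
    and "(y \<otimes> d) [^] (2 * k + 1 :: nat) = \<one>"
  shows "\<exists>m\<in>carrier G. m \<otimes> y \<otimes> inv m = d"
proof -
  interpret group G by fact
  let ?n = "y \<otimes> d"
  have inv: "inv ?n = d \<otimes> y"
    using yd by (simp add: inv_mult_group inv_unique' [symmetric])
  have dnd: "d \<otimes> ?n [^] j \<otimes> d = inv (?n [^] j)" for j :: nat
  proof (induction j)
    case 0
    then show ?case using yd by simp
  next
    case (Suc j)
    have "d \<otimes> ?n [^] Suc j \<otimes> d = d \<otimes> ?n [^] j \<otimes> (d \<otimes> d) \<otimes> ?n \<otimes> d"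
      using yd by (simp add: m_assoc)
    also have "\<dots> = (d \<otimes> ?n [^] j \<otimes> d) \<otimes> (d \<otimes> ?n \<otimes> d)"
      using yd(1,2) by (simp add: m_assoc)
    also have "d \<otimes> ?n \<otimes> d = d \<otimes> y" using yd by (simp add: m_assoc)
    also have "(d \<otimes> ?n [^] j \<otimes> d) \<otimes> (d \<otimes> y) = inv (?n [^] j) \<otimes> inv ?n" unfolding Suc inv ..
    also have "\<dots> = inv (?n [^] Suc j)"
      using yd(1,2) by (subst inv_mult_group[symmetric]) (auto simp: nat_pow_Suc2[symmetric])
    finally show ?case .
  qed
  let ?m = "?n [^] (k + 1)"
  have mc: "?m \<in> carrier G" using yd by simp
  have mm: "?m \<otimes> ?m = ?n"
  proof -
    have "?m \<otimes> ?m = ?n [^] ((2 * k + 1) + 1)" using yd by (simp only: nat_pow_mult m_closed) (simp add: mult_2 del: nat_pow_Suc)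
    also have "\<dots> = ?n [^] (2 * k + 1) \<otimes> ?n" by (simp)
    finally show ?thesis using assms(6) yd by simp
  qed
  have dmd: "d \<otimes> ?m \<otimes> d = inv ?m" by (rule dnd)
  obtain m where m: "m = ?m" by blast
  have mG: "m \<in> carrier G" using mc m by simp
  have dinv: "inv d = d" using yd by (simp add: inv_equality)
  have "d \<otimes> inv m \<otimes> d = inv (d \<otimes> m \<otimes> d)"
    using yd mG by (simp add: inv_mult_group dinv m_assoc)
  also have "\<dots> = m" using dmd mG by (simp add: m)
  finally have dm: "d \<otimes> inv m \<otimes> d = m" .
  have "m \<otimes> d \<otimes> inv m = m \<otimes> (d \<otimes> inv m \<otimes> d) \<otimes> d"
    using yd mG by (simp add: m_assoc)
  also have "\<dots> = y \<otimes> d \<otimes> d" using mm unfolding dm by (simp only: m)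
  also have "\<dots> = y" using yd by (simp add: m_assoc)
  finally have y: "y = m \<otimes> d \<otimes> inv m" ..
  have md: "inv m \<otimes> (m \<otimes> d) = d" using yd(2) mG by (simp add: m_assoc[symmetric])
  have "inv m \<otimes> y \<otimes> inv (inv m) = inv m \<otimes> (m \<otimes> d) \<otimes> (inv m \<otimes> m)"
    unfolding y using yd(2) mG by (simp add: m_assoc del: l_inv)
  then have "inv m \<otimes> y \<otimes> inv (inv m) = d" unfolding md using yd(2) mG by simp
  then show ?thesis using mG by blast
qed

text \<open>The entry pairs rows 2 and 3 of \<open>N\<close> through the skew form of
  \<open>kmat\<close>, so its coefficients are the \<open>2 x 2\<close> minors of these rows. Their
  cross product is row 1 of \<open>N\<close>; hence \<open>(c, - b, a)\<close> is row 1 modulo 5,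
  and the condition says that row 1 is orthogonal to \<open>(z, - y, x)\<close>.\<close>

lemma kmat_conj_entry:
  assumes N: "special_orthogonal N"
    and c: "5 * (N $ 2 $ 1 * N $ 3 $ 2 - N $ 2 $ 2 * N $ 3 $ 1) = 5 * of_int a"
      "5 * (N $ 2 $ 1 * N $ 3 $ 3 - N $ 2 $ 3 * N $ 3 $ 1) = 5 * of_int b"
      "5 * (N $ 2 $ 2 * N $ 3 $ 3 - N $ 2 $ 3 * N $ 3 $ 2) = 5 * of_int c"
    and "5 dvd a * x + b * y + c * z"
  shows "(N ** kmat x y z ** transpose N) $ 2 $ 3 = 0"
proof -
  have "(N ** kmat x y z ** transpose N) $ 2 $ 3 = (N ** transpose N) $ 2 $ 3
      + 5 * (N $ 2 $ 1 * N $ 3 $ 2 - N $ 2 $ 2 * N $ 3 $ 1) * of_int x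
      + 5 * (N $ 2 $ 1 * N $ 3 $ 3 - N $ 2 $ 3 * N $ 3 $ 1) * of_int y
      + 5 * (N $ 2 $ 2 * N $ 3 $ 3 - N $ 2 $ 3 * N $ 3 $ 2) * of_int z"
    by (simp add: kmat_def matrix_matrix_mult_def sum_3 Finite_Cartesian_Product.transpose_def algebra_simps)
  also have "\<dots> = 5 * of_int (a * x + b * y + c * z)"
    unfolding c using N by (simp add: special_orthogonal_def mat_def algebra_simps)
  also have "\<dots> = 0" using assms(5) by (simp only: mod25_times5_eq_0_iff)
  finally show ?thesis .
qed

text \<open>The identity, \<open>cycle_elt\<close> and its square have the three axes as first rows.
  Multiplying \<open>turn_elt \<otimes> klein_elt a\<close> on the left by these elements gives the
  other twelve norm-one lines: \<open>klein_elt a\<close> changes the signs in the row and the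
  powers of \<open>cycle_elt\<close> select which row of the half-turn comes first.\<close>

lemma isotropic_conj:
  "\<exists>g\<in>icos_carrier. (snd (snd g) ** kmat x y z ** transpose (snd (snd g))) $ 2 $ 3 = 0"
proof -
  interpret group icos by (rule group_icos)
  have step: "\<exists>g\<in>icos_carrier. (snd (snd g) ** kmat x y z ** transpose (snd (snd g))) $ 2 $ 3 = 0"
    if g: "g \<in> carrier icos"
      and "5 * (snd (snd g) $ 2 $ 1 * snd (snd g) $ 3 $ 2 - snd (snd g) $ 2 $ 2 * snd (snd g) $ 3 $ 1) = 5 * of_int a"
      "5 * (snd (snd g) $ 2 $ 1 * snd (snd g) $ 3 $ 3 - snd (snd g) $ 2 $ 3 * snd (snd g) $ 3 $ 1) = 5 * of_int b"
      "5 * (snd (snd g) $ 2 $ 2 * snd (snd g) $ 3 $ 3 - snd (snd g) $ 2 $ 3 * snd (snd g) $ 3 $ 2) = 5 * of_int c"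
      "5 dvd a * x + b * y + c * z" for g a b c x y z
  proof -
    have "special_orthogonal (snd (snd g))" using g icos_carrierD(5) by (cases g) simp
    from kmat_conj_entry[OF this that(2-5)] g show ?thesis by auto
  qed
  have mem: "\<one>\<^bsub>icos\<^esub> \<in> carrier icos" "cycle_elt \<in> carrier icos" "turn_elt \<in> carrier icos" "klein_elt a \<in> carrier icos" for a
    using one_closed cycle_elt_closed turn_elt_closed klein_elt_closed by simp_all
  note defs = cycle_elt_def turn_elt_def klein_elt_def diag_mat_def diag_sign_def matrix_matrix_mult_def sum_3 mat_def
  have main: "\<exists>g\<in>icos_carrier. (snd (snd g) ** kmat x y z ** transpose (snd (snd g))) $ 2 $ 3 = 0"
    if "x \<in> {0, 1, 2, 3, 4}" "y \<in> {0, 1, 2, 3, 4}" "z \<in> {0, 1, 2, 3, 4}" for x y z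
    using isotropic_orbit[OF that]
  proof (elim disjE)
    assume "5 dvd z"
    then show ?thesis
      by (intro step[of "\<one>\<^bsub>icos\<^esub>" "0" "0" "1"] m_closed mem) (simp_all add: defs)
  next
    assume "5 dvd x"
    then show ?thesis
      by (intro step[of "cycle_elt" "1" "0" "0"] m_closed mem) (simp_all add: defs)
  next
    assume "5 dvd y"
    then show ?thesis
      by (intro step[of "cycle_elt \<otimes>\<^bsub>icos\<^esub> cycle_elt" "0" "-1" "0"] m_closed mem) (simp_all add: defs)
  next
    assume "5 dvd - x - 2 * y + z"
    then show ?thesis
      by (intro step[of "turn_elt \<otimes>\<^bsub>icos\<^esub> klein_elt 1" "-1" "-2" "1"] m_closed mem) (simp_all add: defs)
  next
    assume "5 dvd 2 * x + y - z"
    then show ?thesis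
      by (intro step[of "cycle_elt \<otimes>\<^bsub>icos\<^esub> (turn_elt \<otimes>\<^bsub>icos\<^esub> klein_elt 1)" "2" "1" "-1"] m_closed mem) (simp_all add: defs)
  next
    assume "5 dvd - x - y + 2 * z"
    then show ?thesis
      by (intro step[of "cycle_elt \<otimes>\<^bsub>icos\<^esub> (cycle_elt \<otimes>\<^bsub>icos\<^esub> (turn_elt \<otimes>\<^bsub>icos\<^esub> klein_elt 1))" "-1" "-1" "2"] m_closed mem) (simp_all add: defs)
  next
    assume "5 dvd x + 2 * y + z"
    then show ?thesis
      by (intro step[of "turn_elt \<otimes>\<^bsub>icos\<^esub> klein_elt 2" "1" "2" "1"] m_closed mem) (simp_all add: defs)
  next
    assume "5 dvd - 2 * x - y - z"
    then show ?thesis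
      by (intro step[of "cycle_elt \<otimes>\<^bsub>icos\<^esub> (turn_elt \<otimes>\<^bsub>icos\<^esub> klein_elt 2)" "-2" "-1" "-1"] m_closed mem) (simp_all add: defs)
  next
    assume "5 dvd x + y + 2 * z"
    then show ?thesis
      by (intro step[of "cycle_elt \<otimes>\<^bsub>icos\<^esub> (cycle_elt \<otimes>\<^bsub>icos\<^esub> (turn_elt \<otimes>\<^bsub>icos\<^esub> klein_elt 2))" "1" "1" "2"] m_closed mem) (simp_all add: defs)
  next
    assume "5 dvd x - 2 * y - z"
    then show ?thesis
      by (intro step[of "turn_elt \<otimes>\<^bsub>icos\<^esub> klein_elt 3" "1" "-2" "-1"] m_closed mem) (simp_all add: defs)
  next
    assume "5 dvd - 2 * x + y + z"
    then show ?thesis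
      by (intro step[of "cycle_elt \<otimes>\<^bsub>icos\<^esub> (turn_elt \<otimes>\<^bsub>icos\<^esub> klein_elt 3)" "-2" "1" "1"] m_closed mem) (simp_all add: defs)
  next
    assume "5 dvd x - y - 2 * z"
    then show ?thesis
      by (intro step[of "cycle_elt \<otimes>\<^bsub>icos\<^esub> (cycle_elt \<otimes>\<^bsub>icos\<^esub> (turn_elt \<otimes>\<^bsub>icos\<^esub> klein_elt 3))" "1" "-1" "-2"] m_closed mem) (simp_all add: defs)
  next
    assume "5 dvd - x + 2 * y - z"
    then show ?thesis
      by (intro step[of "turn_elt \<otimes>\<^bsub>icos\<^esub> klein_elt 4" "-1" "2" "-1"] m_closed mem) (simp_all add: defs)
  next
    assume "5 dvd 2 * x - y + z"
    then show ?thesis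
      by (intro step[of "cycle_elt \<otimes>\<^bsub>icos\<^esub> (turn_elt \<otimes>\<^bsub>icos\<^esub> klein_elt 4)" "2" "-1" "1"] m_closed mem) (simp_all add: defs)
  next
    assume "5 dvd - x + y - 2 * z"
    then show ?thesis
      by (intro step[of "cycle_elt \<otimes>\<^bsub>icos\<^esub> (cycle_elt \<otimes>\<^bsub>icos\<^esub> (turn_elt \<otimes>\<^bsub>icos\<^esub> klein_elt 4))" "-1" "1" "-2"] m_closed mem) (simp_all add: defs)
  qed
  have five: "a mod 5 \<in> {0, 1, 2, 3, 4}" for a :: int
    using pos_mod_bound[of 5 a] pos_mod_sign[of 5 a] by simp presburger
  have "kmat x y z = kmat (x mod 5) (y mod 5) (z mod 5)"
    by (simp add: kmat_eq_iff)
  then show ?thesis using main[OF five[of x] five[of y] five[of z]] by simp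
qed

lemma kelt_conj:
  assumes g: "(s, r, N) \<in> icos_carrier" and u: "3 dvd (\<Sum>i\<in>{1..5}. u i)"
  shows "(s, r, N) \<otimes>\<^bsub>icos\<^esub> kelt u x y z \<otimes>\<^bsub>icos\<^esub> inv\<^bsub>icos\<^esub> (s, r, N)
    = (id, \<lambda>i. if inv' s i \<in> {1..5} then 3 * of_int (u (inv' s i)) else 0, N ** kmat x y z ** transpose N)"
  using icos_conj[OF g kelt_closed[OF u, unfolded kelt_def]] unfolding kelt_def .

lemma icos_conj_closed:
  assumes "g \<in> icos_carrier" "x \<in> icos_carrier"
  shows "g \<otimes>\<^bsub>icos\<^esub> x \<otimes>\<^bsub>icos\<^esub> inv\<^bsub>icos\<^esub> g \<in> icos_carrier"
proof -
  interpret group icos by (rule group_icos)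
  show ?thesis using assms m_closed inv_closed by (metis icos_simps(1))
qed

lemma balanced_indices:
  fixes u :: "nat \<Rightarrow> int"
  obtains a b c d where "{a, b, c, d} \<subseteq> {1..5}" "distinct [a, b, c, d]" "3 dvd u a + u b - (u c + u d)"
proof -
  have three: "i mod 3 \<in> {0, 1, 2}" for i :: int
    using pos_mod_bound[of 3 i] pos_mod_sign[of 3 i] by simp presburger
  have m: "3 dvd a mod 3 + b mod 3 - (c mod 3 + d mod 3) \<longleftrightarrow> 3 dvd a + b - (c + d)" for a b c d :: int
    by presburger
  show ?thesis
    using balanced_pairs[OF three[of "u 1"] three[of "u 2"] three[of "u 3"] three[of "u 4"] three[of "u 5"]]
    unfolding m
    by (elim disjE)
      (rule that[of 1 2 3 4] that[of 1 3 2 4] that[of 1 4 2 3] that[of 1 2 3 5] that[of 1 3 2 5] that[of 1 5 2 3]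
        that[of 1 2 4 5] that[of 1 4 2 5] that[of 1 5 2 4] that[of 1 3 4 5] that[of 1 4 3 5] that[of 1 5 3 4]
        that[of 2 3 4 5] that[of 2 4 3 5] that[of 2 5 3 4]; simp; fail)+
qed

text \<open>Conjugation by a lift of \<open>inv' p\<close> replaces \<open>u\<close> by its
  composite with \<open>p\<close>, so it suffices that \<open>p\<close> carries the pairs
  \<open>{1, 2}\<close> and \<open>{3, 4}\<close> to pairs with equal sums.\<close>

lemma conj_stab_order_3:
  assumes u: "3 dvd (\<Sum>i\<in>{1..5}. u i)" and A: "1 \<in> A"
  shows "\<exists>g\<in>icos_carrier. g \<otimes>\<^bsub>icos\<^esub> kelt u 0 0 0 \<otimes>\<^bsub>icos\<^esub> inv\<^bsub>icos\<^esub> g \<in> stab A"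
proof -
  obtain a b c d where abcd: "{a, b, c, d} \<subseteq> {1..5}" "distinct [a, b, c, d]" "3 dvd u a + u b - (u c + u d)"
    using balanced_indices by metis
  obtain p where p: "p \<in> carrier (alt_group 5)" "{p 1, p 2} = {a, b}" "p 3 = c" "p 4 = d"
    using even_perm_exists[OF abcd(1,2)] by metis
  obtain r N where g: "(inv' p, r, N) \<in> icos_carrier"
    using icos_lift[OF alt_group_inv_closed[OF p(1)]] by metis
  have pp: "p permutes {1..5}" using p(1) by (simp add: alt_group_carrier)
  have pin: "inv' (inv' p) = p" using permutes_inv_inv[OF pp] .
  have p5: "p i \<in> {1..5} \<longleftrightarrow> i \<in> {1..5}" for i using permutes_in_image[OF pp] .
  let ?g = "(inv' p, r, N)"
  let ?x = "?g \<otimes>\<^bsub>icos\<^esub> kelt u 0 0 0 \<otimes>\<^bsub>icos\<^esub> inv\<^bsub>icos\<^esub> ?g"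
  have x: "?x = (id, \<lambda>i. if p i \<in> {1..5} then 3 * of_int (u (p i)) else 0, mat 1)"
    using kelt_conj[OF g u, of 0 0 0] icos_carrierD(5)[OF g]
    by (simp only: pin kmat_zero matrix_mul_rid special_orthogonal_def)
  have xc: "?x \<in> icos_carrier" by (rule icos_conj_closed[OF g kelt_closed[OF u]])
  have pv: "p 1 \<in> {1..5}" "p 2 \<in> {1..5}" "p 3 \<in> {1..5}" "p 4 \<in> {1..5}" unfolding p5 by simp_all
  have "u (p 1) + u (p 2) = u a + u b" using p(2) by (auto simp: doubleton_eq_iff)
  then have "3 * (of_int (u (p 1) + u (p 2)) :: 9) = 3 * of_int (u (p 3) + u (p 4))"
    unfolding mod9_thrice_eq_iff using abcd(3) p(3,4) by simp
  then have "3 * (of_int (u (p 1)) :: 9) + 3 * of_int (u (p 2)) = 3 * of_int (u (p 3)) + 3 * of_int (u (p 4))"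
    by (simp add: distrib_left)
  moreover have "id \<in> klein ` A" using A by (auto simp: klein_def intro!: image_eqI[of _ _ 1])
  ultimately have "?x \<in> stab A"
    using xc pv unfolding x stab_def mem_Collect_eq prod.case by (simp only: if_True) (simp add: mat_def)
  then show ?thesis using g by blast
qed

lemma conj_stab_order_5:
  assumes A: "1 \<in> A"
  shows "\<exists>g\<in>icos_carrier. g \<otimes>\<^bsub>icos\<^esub> kelt (\<lambda>_. 0) x y z \<otimes>\<^bsub>icos\<^esub> inv\<^bsub>icos\<^esub> g \<in> stab A"
proof -
  obtain s r N where g: "(s, r, N) \<in> icos_carrier" and N: "(N ** kmat x y z ** transpose N) $ 2 $ 3 = 0"
    using isotropic_conj[of x y z] by auto
  let ?x = "(s, r, N) \<otimes>\<^bsub>icos\<^esub> kelt (\<lambda>_. 0) x y z \<otimes>\<^bsub>icos\<^esub> inv\<^bsub>icos\<^esub> (s, r, N)"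
  have x: "?x = (id, \<lambda>i. 0, N ** kmat x y z ** transpose N)"
    using kelt_conj[OF g, of "\<lambda>_. 0" x y z] by (simp add: fun_eq_iff split: if_split)
  have xc: "?x \<in> icos_carrier" by (rule icos_conj_closed[OF g kelt_closed]) simp
  have "id \<in> klein ` A" using A by (auto simp: klein_def intro!: image_eqI[of _ _ 1])
  then have "?x \<in> stab A"
    using xc N unfolding x stab_def by simp
  then show ?thesis using g by blast
qed

text \<open>An even involution on five points is a double transposition, so some conjugate
  \<open>y\<close> of \<open>x\<close> lies over \<open>klein 2\<close>. It differs from
  \<open>klein_elt 2\<close> by a kernel element of odd order, which makes the two involutions
  conjugate.\<close>

lemma conj_stab_order_2:
  assumes x: "x \<in> icos_carrier" "fst x \<noteq> id" "x \<otimes>\<^bsub>icos\<^esub> x = \<one>\<^bsub>icos\<^esub>" and A: "A \<in> {{1, 2}, {1, 2, 3, 4}}"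
  shows "\<exists>g\<in>icos_carrier. g \<otimes>\<^bsub>icos\<^esub> x \<otimes>\<^bsub>icos\<^esub> inv\<^bsub>icos\<^esub> g \<in> stab A"
proof -
  interpret group icos by (rule group_icos)
  let ?s = "fst x"
  have sA: "?s \<in> carrier (alt_group 5)" and sp: "?s permutes {1..5}"
    using x(1) icos_carrierD(1,2) by (cases x; simp)+
  have ss: "?s (?s i) = i" for i
    using x(3) by (cases x) (auto simp: fun_eq_iff)
  have in5: "?s i \<in> {1..5} \<longleftrightarrow> i \<in> {1..5}" for i using permutes_in_image[OF sp] .
  obtain a where a: "?s a \<noteq> a" using x(2) by (auto simp: fun_eq_iff)
  let ?b = "?s a"
  obtain c where c: "c \<noteq> a" "c \<noteq> ?b" "?s c \<noteq> c"
  proof (rule ccontr)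
    assume "\<not> thesis"
    then have "?s c = c" if "c \<noteq> a" "c \<noteq> ?b" for c using that \<open>\<And>c. \<lbrakk>c \<noteq> a; c \<noteq> ?b; ?s c \<noteq> c\<rbrakk> \<Longrightarrow> thesis\<close> by blast
    \<comment> \<open>Without a third moved point the permutation would be a single transposition,
      hence odd.\<close>
    then have "?s = swap_pts a ?b"
      using ss[of a] by (auto simp: fun_eq_iff Transposition.transpose_def)
    then have "\<not> evenperm ?s" using a by (metis evenperm_swap)
    then show False using sA by (simp add: alt_group_carrier)
  qed
  let ?d = "?s c"
  have abcd: "{a, ?b, c, ?d} \<subseteq> {1..5}" "distinct [a, ?b, c, ?d]"
    using a c permutes_not_in[OF sp] in5 ss by (auto simp del: atLeastAtMost_iff) metis+
  obtain p where p: "p \<in> carrier (alt_group 5)" "{p 1, p 2} = {a, ?b}" "p 3 = c" "p 4 = ?d"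
    using even_perm_exists[OF abcd] by metis
  have pp: "p permutes {1..5}" using p(1) by (simp add: alt_group_carrier)
  have pinj: "p i = p j \<longleftrightarrow> i = j" for i j using permutes_inj[OF pp] by (auto dest: injD)
  have p5: "p i \<in> {1..5} \<longleftrightarrow> i \<in> {1..5}" for i using permutes_in_image[OF pp] .
  have p12: "?s (p 1) = p 2" "?s (p 2) = p 1" using p(2) ss by (auto simp: doubleton_eq_iff)
  have p34: "?s (p 3) = p 4" "?s (p 4) = p 3" using p(3,4) ss by auto
  have kl: "klein 2 i = (if i = 1 then 2 else if i = 2 then 1 else if i = 3 then 4 else if i = 4 then 3 else i)" for i
    by (simp add: klein_def Transposition.transpose_def)
  have sp': "?s (p i) = p (klein 2 i)" for i
  proof (cases "i \<in> {1, 2, 3, 4}")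
    case True
    then show ?thesis using p12 p34 by (auto simp: kl)
  next
    case False
    have "?s (p i) = p i"
    proof (cases "i = 5")
      case True
      have A5: "{1..5} = {1, 2, 3, 4, 5::nat}" by auto
      obtain j where j: "?s (p 5) = p j"
        using permutes_surj[OF pp] by (metis surjD)
      then have "p j \<in> {1..5}" using in5[of "p 5"] p5[of 5] by simp
      then have "j \<in> {1..5}" using p5[of j] by blast
      then have "j = 1 \<or> j = 2 \<or> j = 3 \<or> j = 4 \<or> j = 5" unfolding A5 by simp
      then have "j = 5"
        using j ss[of "p 5"] p12 p34 pinj[of 5 1] pinj[of 5 2] pinj[of 5 3] pinj[of 5 4] by (elim disjE) simp_all
      then show ?thesis using j True by simp
    next
      case False
      with \<open>i \<notin> {1, 2, 3, 4}\<close> have "i \<notin> {1..5}" by auto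
      then show ?thesis using p5[of i] permutes_not_in[OF sp] by blast
    qed
    then show ?thesis using False by (simp add: kl)
  qed
  obtain r N where g: "(inv' p, r, N) \<in> icos_carrier"
    using icos_lift[OF alt_group_inv_closed[OF p(1)]] by metis
  let ?g = "(inv' p, r, N)"
  define y where "y = ?g \<otimes>\<^bsub>icos\<^esub> x \<otimes>\<^bsub>icos\<^esub> inv\<^bsub>icos\<^esub> ?g"
  have yc: "y \<in> icos_carrier" unfolding y_def by (rule icos_conj_closed[OF g x(1)])
  have "fst y = inv' p \<circ> ?s \<circ> p"
    unfolding y_def fst_conj[OF g] by (simp add: permutes_inv_inv[OF pp])
  also have "\<dots> = klein 2" by (auto simp: fun_eq_iff sp' permutes_inverses[OF pp])
  finally have fy: "fst y = klein 2" .
  have gG: "?g \<in> carrier icos" and xG: "x \<in> carrier icos" and yG: "y \<in> carrier icos"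
    using g x(1) yc by simp_all
  have yy: "y \<otimes>\<^bsub>icos\<^esub> y = \<one>\<^bsub>icos\<^esub>"
  proof -
    have "y \<otimes>\<^bsub>icos\<^esub> y = ?g \<otimes>\<^bsub>icos\<^esub> (x \<otimes>\<^bsub>icos\<^esub> x) \<otimes>\<^bsub>icos\<^esub> inv\<^bsub>icos\<^esub> ?g"
      unfolding y_def by (rule conj_mult[OF group_icos gG xG xG])
    also have "\<dots> = \<one>\<^bsub>icos\<^esub>" unfolding x(3) using gG by (simp del: icos_simps)
    finally show ?thesis .
  qed
  let ?d = "klein_elt 2"
  have dG: "?d \<in> carrier icos" using klein_elt_closed by simp
  have dd: "?d \<otimes>\<^bsub>icos\<^esub> ?d = \<one>\<^bsub>icos\<^esub>" by (rule klein_elt_self) simp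
  have "y \<otimes>\<^bsub>icos\<^esub> ?d \<in> icos_carrier" using m_closed[OF yG dG] by simp
  moreover have "fst (y \<otimes>\<^bsub>icos\<^esub> ?d) = id"
    using fy by (cases y) (simp add: klein_elt_def)
  ultimately obtain u x' y' z' where "y \<otimes>\<^bsub>icos\<^esub> ?d = kelt u x' y' z'"
    using kelt_exists by (metis prod.collapse)
  \<comment> \<open>The kernel has exponent \<open>15 = 2 * 7 + 1\<close>.\<close>
  then have "(y \<otimes>\<^bsub>icos\<^esub> ?d) [^]\<^bsub>icos\<^esub> (2 * 7 + 1 :: nat) = kelt (\<lambda>_. 0) 0 0 0"
    by (simp only: kelt_pow kelt_eq_iff) simp
  then have "(y \<otimes>\<^bsub>icos\<^esub> ?d) [^]\<^bsub>icos\<^esub> (2 * 7 + 1 :: nat) = \<one>\<^bsub>icos\<^esub>"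
    unfolding kelt_zero .
  then obtain m where m: "m \<in> carrier icos" "m \<otimes>\<^bsub>icos\<^esub> y \<otimes>\<^bsub>icos\<^esub> inv\<^bsub>icos\<^esub> m = ?d"
    using conj_involutions[OF group_icos yG dG yy dd] by blast
  have "(m \<otimes>\<^bsub>icos\<^esub> ?g) \<otimes>\<^bsub>icos\<^esub> x \<otimes>\<^bsub>icos\<^esub> inv\<^bsub>icos\<^esub> (m \<otimes>\<^bsub>icos\<^esub> ?g) = m \<otimes>\<^bsub>icos\<^esub> y \<otimes>\<^bsub>icos\<^esub> inv\<^bsub>icos\<^esub> m"
    unfolding y_def using m(1) gG xG by (simp add: m_assoc inv_mult_group del: icos_simps)
  moreover have "?d \<in> stab A"
    using A klein_elt_closed[of 2] by (auto simp: stab_def klein_elt_def diag_mat_def)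
  moreover have "m \<otimes>\<^bsub>icos\<^esub> ?g \<in> icos_carrier" using m_closed[OF m(1) gG] by simp
  ultimately show ?thesis using m(2) by metis
qed

text \<open>In the kernel, of exponent 15, the order is 3 or 5, and one of the two module components
  vanishes. Outside it the order divides 60, and the results on orders 3 and 5 leave only
  involutions.\<close>

lemma conj_stab_prime_order:
  assumes x: "x \<in> carrier icos" and p: "Factorial_Ring.prime (group.ord icos x)"
    and A: "A \<in> {{1, 2}, {1, 2, 3, 4}}"
  shows "\<exists>g\<in>carrier icos. g \<otimes>\<^bsub>icos\<^esub> x \<otimes>\<^bsub>icos\<^esub> inv\<^bsub>icos\<^esub> g \<in> stab A"
proof -
  interpret gh: group_hom icos "alt_group 5" fst by (rule group_hom_fst)
  define q where "q = group.ord icos x"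
  have q: "Factorial_Ring.prime q" using p q_def by simp
  have pow: "x [^]\<^bsub>icos\<^esub> q = \<one>\<^bsub>icos\<^esub>" using gh.G.pow_ord_eq_1[OF x] q_def by simp
  have A1: "1 \<in> A" using A by auto
  have finA: "finite (carrier (alt_group 5))" using card_alt_5 card.infinite by fastforce
  have primes: "Factorial_Ring.prime (2 :: nat)" "Factorial_Ring.prime (3 :: nat)" "Factorial_Ring.prime (5 :: nat)"
    by simp_all
  show ?thesis
  proof (cases "fst x = id")
    case True
    then obtain u a b c where u: "x = kelt u a b c" "3 dvd (\<Sum>i\<in>{1..5}. u i)"
      using x kelt_exists by (metis icos_simps(1) prod.collapse)
    have "x [^]\<^bsub>icos\<^esub> (15 :: nat) = kelt (\<lambda>_. 0) 0 0 0"
      unfolding u(1) kelt_pow kelt_eq_iff by simp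
    then have "q dvd 15"
      using gh.G.pow_eq_id[OF x, of 15] unfolding kelt_zero q_def by simp
    then have "q dvd 3 * 5" by simp
    then have "q dvd 3 \<or> q dvd 5" using q prime_dvd_mult_iff by blast
    then have "q = 3 \<or> q = 5"
      using primes_dvd_imp_eq[OF q primes(2)] primes_dvd_imp_eq[OF q primes(3)] by blast
    then show ?thesis
    proof
      assume "q = 3"
      then have "kelt (\<lambda>i. int 3 * u i) (int 3 * a) (int 3 * b) (int 3 * c) = kelt (\<lambda>_. 0) 0 0 0"
        using pow unfolding u(1) kelt_pow kelt_zero by simp
      then have "5 dvd 3 * a" "5 dvd 3 * b" "5 dvd 3 * c" unfolding kelt_eq_iff by simp_all
      then have "5 dvd a" "5 dvd b" "5 dvd c" by presburger+
      then have "x = kelt u 0 0 0" unfolding u(1) kelt_eq_iff by simp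
      then show ?thesis using conj_stab_order_3[OF u(2) A1] by simp
    next
      assume "q = 5"
      then have "kelt (\<lambda>i. int 5 * u i) (int 5 * a) (int 5 * b) (int 5 * c) = kelt (\<lambda>_. 0) 0 0 0"
        using pow unfolding u(1) kelt_pow kelt_zero by simp
      then have "3 dvd 5 * u i" if "i \<in> {1..5}" for i unfolding kelt_eq_iff using that by simp
      moreover have "3 dvd 5 * v \<Longrightarrow> 3 dvd v" for v :: int by presburger
      ultimately have "3 dvd u i" if "i \<in> {1..5}" for i using that by blast
      then have "x = kelt (\<lambda>_. 0) a b c" unfolding u(1) kelt_eq_iff by simp
      then show ?thesis using conj_stab_order_5[OF A1] by simp
    qed
  next
    case False
    have "fst x [^]\<^bsub>alt_group 5\<^esub> q = fst (x [^]\<^bsub>icos\<^esub> q)"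
      using gh.hom_nat_pow[OF x] by simp
    also have "\<dots> = \<one>\<^bsub>alt_group 5\<^esub>" unfolding pow by (simp add: alt_group_one)
    finally have "q dvd order (alt_group 5)"
      using prime_dvd_order[OF gh.H.group_axioms finA gh.hom_closed[OF x]] False q by (simp add: alt_group_one)
    then have "q dvd 2 * (2 * (3 * 5))" by (simp add: order_def card_alt_5)
    then have "q dvd 2 \<or> q dvd 3 \<or> q dvd 5" using q prime_dvd_mult_iff by blast
    then have "q = 2 \<or> q = 3 \<or> q = 5"
      using primes[THEN primes_dvd_imp_eq[OF q]] by blast
    then show ?thesis
    proof (elim disjE)
      assume "q = 2"
      then have "x \<otimes>\<^bsub>icos\<^esub> x = \<one>\<^bsub>icos\<^esub>"
        using pow x by (simp add: eval_nat_numeral nat_pow_def del: icos_simps(2,3))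
      then show ?thesis using conj_stab_order_2[OF _ False _ A] x by simp
    next
      assume "q = 3"
      then have "x \<otimes>\<^bsub>icos\<^esub> x \<otimes>\<^bsub>icos\<^esub> x = \<one>\<^bsub>icos\<^esub>"
        using pow x by (simp add: eval_nat_numeral nat_pow_def del: icos_simps(2,3))
      then show ?thesis using icos_order_3 x False by simp
    next
      assume "q = 5"
      then have "x \<otimes>\<^bsub>icos\<^esub> x \<otimes>\<^bsub>icos\<^esub> x \<otimes>\<^bsub>icos\<^esub> x \<otimes>\<^bsub>icos\<^esub> x = \<one>\<^bsub>icos\<^esub>"
        using pow x by (simp add: eval_nat_numeral nat_pow_def del: icos_simps(2,3))
      then show ?thesis using icos_order_5 x False by simp
    qed
  qed
qed

section \<open>Faithfulness of the coset action and non-splitness\<close>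

lemma mod9_eq_if_diff_antisym:
  fixes a b c d :: 9
  assumes "3 * a = 0" "3 * b = 0" "a + c = b + d" "a + d = b + c"
  shows "a = b"
proof -
  have "(a - b) + (a - b) = (a + c) - (b + d) + ((a + d) - (b + c))" by (simp add: algebra_simps)
  then have "2 * (a - b) = 0" using assms(3,4) by (simp add: algebra_simps)
  moreover have "3 * (a - b) = 0" using assms(1,2) by (simp add: algebra_simps)
  ultimately have "3 * (a - b) - 2 * (a - b) = 0" by (simp only: diff_self)
  then show ?thesis by (simp add: algebra_simps)
qed

text \<open>Conjugates of \<open>s\<close> all fix the point 5, so \<open>s\<close> is trivial. The
  balance equation in every arrangement of four points makes \<open>t\<close> constant, and the zero
  sum then makes it 0. Conjugation by the powers of the axis cycle moves each off-diagonal
  coordinate of \<open>M\<close> into the entry required to vanish.\<close>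

lemma stab_core_free:
  assumes A: "A \<in> {{1, 2}, {1, 2, 3, 4}}" and x: "x \<in> carrier icos"
    and conj: "\<And>g. g \<in> carrier icos \<Longrightarrow> g \<otimes>\<^bsub>icos\<^esub> x \<otimes>\<^bsub>icos\<^esub> inv\<^bsub>icos\<^esub> g \<in> stab A"
  shows "x = \<one>\<^bsub>icos\<^esub>"
proof -
  interpret group icos by (rule group_icos)
  obtain s t M where v: "x = (s, t, M)" by (cases x)
  note X = icos_carrierD[OF x[unfolded v icos_simps]]
  have fix5: "fst y 5 = 5" if "y \<in> stab A" for y
  proof -
    have "fst y \<in> klein ` A" using that by (cases y) (simp add: stab_def)
    then obtain a where "fst y = klein a" by blast
    then show ?thesis using klein_vals[of a] by auto
  qed
  have perm: "\<exists>p\<in>carrier (alt_group 5). {p 1, p 2} = {a, b} \<and> p 3 = c \<and> p 4 = d"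
    if "{a, b, c, d} \<subseteq> {1..5}" "distinct [a, b, c, d]" for a b c d
    using even_perm_exists[OF that] by metis
  have s5: "s (p 5) = p 5" if p: "p \<in> carrier (alt_group 5)" for p
  proof -
    have pp: "p permutes {1..5}" using p by (simp add: alt_group_carrier)
    obtain r N where g: "(inv' p, r, N) \<in> icos_carrier"
      using icos_lift[OF alt_group_inv_closed[OF p]] by metis
    have "fst ((inv' p, r, N) \<otimes>\<^bsub>icos\<^esub> x \<otimes>\<^bsub>icos\<^esub> inv\<^bsub>icos\<^esub> (inv' p, r, N)) = inv' p \<circ> s \<circ> p"
      unfolding fst_conj[OF g] by (simp add: v permutes_inv_inv[OF pp])
    then have "inv' p (s (p 5)) = 5" using fix5[OF conj[of "(inv' p, r, N)"]] g by simp
    then show ?thesis by (metis permutes_inverses(1)[OF pp])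
  qed
  have sid: "s = id"
  proof
    fix i show "s i = id i"
    proof (cases "i \<in> {1..5}")
      case True
      have A5: "{1..5} = {1, 2, 3, 4, 5::nat}" by auto
      obtain a b c d where abcd: "{a, b, c, d} \<subseteq> {1..5}" "distinct [a, b, c, d]" "{1..5} = {a, b, c, d, i}" "i \<notin> {a, b, c, d}"
        using True that[of 2 3 4 5] that[of 1 3 4 5] that[of 1 2 4 5] that[of 1 2 3 5] that[of 1 2 3 4]
        unfolding A5 by (elim insertE) auto
      obtain p where p: "p \<in> carrier (alt_group 5)" "{p 1, p 2} = {a, b}" "p 3 = c" "p 4 = d"
        using perm[OF abcd(1,2)] by blast
      have pp: "p permutes {1..5}" using p(1) by (simp add: alt_group_carrier)
      have "p 5 \<in> {1..5}" using permutes_in_image[OF pp, of 5] by simp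
      moreover have "p 5 \<noteq> p 1" "p 5 \<noteq> p 2" "p 5 \<noteq> p 3" "p 5 \<noteq> p 4"
        using permutes_inj[OF pp] by (simp_all add: inj_eq)
      then have "p 5 \<notin> {p 1, p 2} \<union> {p 3, p 4}" by simp
      then have "p 5 \<notin> {a, b, c, d}" unfolding p(2-4) by simp
      ultimately have "p 5 = i" unfolding abcd(3) by blast
      then show ?thesis using s5[OF p(1)] by simp
    next
      case False
      then show ?thesis using permutes_not_in[OF X(2)] by simp
    qed
  qed
  have t3: "3 * t i = 0" for i using icos_perm_trivial(1) x[unfolded v sid] by simp
  have tsum: "t a + t b = t c + t d" if abcd: "{a, b, c, d} \<subseteq> {1..5}" "distinct [a, b, c, d]" for a b c d
  proof -
    obtain p where p: "p \<in> carrier (alt_group 5)" "{p 1, p 2} = {a, b}" "p 3 = c" "p 4 = d"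
      using perm[OF abcd] by blast
    have pp: "p permutes {1..5}" using p by (simp add: alt_group_carrier)
    obtain r N where g: "(inv' p, r, N) \<in> icos_carrier"
      using icos_lift[OF alt_group_inv_closed[OF p(1)]] by metis
    have "(id, \<lambda>i. t (inv' (inv' p) i), N ** M ** transpose N) \<in> stab A"
      using conj[of "(inv' p, r, N)"] icos_conj[OF g, of t M] g x by (simp add: v sid)
    then have "t (p 1) + t (p 2) = t (p 3) + t (p 4)"
      by (simp add: stab_def permutes_inv_inv[OF pp])
    moreover have "t (p 1) + t (p 2) = t a + t b" using p(2) by (auto simp: doubleton_eq_iff add.commute)
    ultimately show ?thesis using p(3,4) by simp
  qed
  have teq: "t a = t b" if ab: "{a, b} \<subseteq> {1..5}" "a \<noteq> b" for a b
  proof -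
    have "card ({1..5} - {a, b}) = 3" using ab by (subst card_Diff_subset) auto
    then obtain c d e where cde: "{1..5} - {a, b} = {c, d, e}" "c \<noteq> d" by (auto simp: card_3_iff)
    have "c \<in> {1..5} - {a, b}" "d \<in> {1..5} - {a, b}" unfolding cde(1) by simp_all
    \<comment> \<open>The two arrangements differ by exchanging \<open>c\<close> and
      \<open>d\<close>; together they give \<open>2 * (t a - t b) = 0\<close>.\<close>
    then have "t a + t c = t b + t d" "t a + t d = t b + t c"
      using tsum[of a c b d] tsum[of a d b c] ab cde(2) by (simp_all add: eq_commute)
    then show ?thesis using mod9_eq_if_diff_antisym t3 by blast
  qed
  have t1: "t 1 = 0"
  proof -
    have "t 2 = t 1" "t 3 = t 1" "t 4 = t 1" "t 5 = t 1" by (rule teq; simp)+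
    then have "5 * t 1 = 0" using X(4) unfolding sum_1_5 by simp
    \<comment> \<open>The multipliers are chosen so that \<open>2 * 3 - 5 = 1\<close>.\<close>
    then have "2 * (3 * t 1) - 5 * t 1 = 0" by (simp only: t3 mult_zero_right diff_self)
    then show ?thesis by simp
  qed
  have t0: "t i = 0" for i
  proof (cases "i \<in> {1..5}")
    case True
    then show ?thesis using teq[of i 1] t1 by (cases "i = 1") auto
  qed (use X(3) in blast)
  have tz: "t = (\<lambda>_. 0)" using t0 by auto
  obtain a b c where M: "M = kmat a b c"
    using kmat_exists[OF X(5)] icos_perm_trivial(2) x[unfolded v sid] by auto
  have entry: "(N ** kmat a b c ** transpose N) $ 2 $ 3 = 0" if g: "(p, r, N) \<in> icos_carrier" for p r N
    using conj[of "(p, r, N)"] icos_conj[OF g, of t M] g x by (simp add: v sid M stab_def)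
  define C :: "25^3^3" where "C = vector [vector [0, 0, 1], vector [1, 0, 0], vector [0, 1, 0]]"
  obtain q r where C: "(q, r, C) \<in> icos_carrier"
    using cycle_elt_closed unfolding cycle_elt_def C_def by blast
  have "kmat a b c $ 2 $ 3 = 0"
    using entry[OF icos_one_closed] by (simp add: transpose_mat matrix_mul_lid matrix_mul_rid)
  moreover note entry[OF C] entry[OF icos_mult_closed[OF C C]]
  ultimately have "5 * (of_int c :: 25) = 0" "5 * (of_int a :: 25) = 0" "5 * (of_int b :: 25) = 0"
    by (simp_all add: C_def kmat_def matrix_matrix_mult_def sum_3 Finite_Cartesian_Product.transpose_def)
  then have "M = mat 1"
    unfolding M kmat_zero[symmetric] kmat_eq_iff by (simp only: mod25_times5_eq_0_iff diff_0_right simp_thms)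
  then show ?thesis by (simp add: v sid tz)
qed

text \<open>A complement would contain an element \<open>k\<close> over the 3-cycle of
  \<open>cycle_elt\<close>. Its cube lies in the complement and in the kernel, so it is trivial,
  contradicting \<open>icos_order_3\<close>.\<close>

lemma icos_not_split: "\<not> splits_over icos (kernel icos (alt_group 5) fst)"
proof
  assume "splits_over icos (kernel icos (alt_group 5) fst)"
  then obtain K where K: "subgroup K icos" "kernel icos (alt_group 5) fst \<inter> K = {\<one>\<^bsub>icos\<^esub>}"
    "kernel icos (alt_group 5) fst <#>\<^bsub>icos\<^esub> K = carrier icos"
    unfolding splits_over_def by blast
  interpret K: subgroup K icos by (rule K(1))
  have "cycle_elt \<in> kernel icos (alt_group 5) fst <#>\<^bsub>icos\<^esub> K"
    unfolding K(3) using cycle_elt_closed by simp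
  then obtain n k where nk: "cycle_elt = n \<otimes>\<^bsub>icos\<^esub> k" "fst n = id" "k \<in> K"
    by (auto simp: set_mult_def kernel_fst)
  have "fst (n \<otimes>\<^bsub>icos\<^esub> k) = fst n \<circ> fst k" by (cases n; cases k) simp
  then have fk: "fst k = fst cycle_elt" unfolding nk(1,2) by simp
  let ?c = "k \<otimes>\<^bsub>icos\<^esub> k \<otimes>\<^bsub>icos\<^esub> k"
  have "fst ?c = fst k \<circ> fst k \<circ> fst k" by (cases k) simp
  also have "\<dots> = id"
    unfolding fk by (simp add: cycle_elt_def fun_eq_iff Transposition.transpose_def)
  finally have "?c \<in> kernel icos (alt_group 5) fst \<inter> K"
    using nk(3) K.m_closed K.subset by (auto simp: kernel_fst simp del: icos_simps(2))
  then have c: "?c = \<one>\<^bsub>icos\<^esub>" unfolding K(2) by (simp del: icos_simps)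
  have "k \<in> icos_carrier" using nk(3) K.subset by auto
  from icos_order_3[OF this c] have "fst k = id" .
  then have "fst cycle_elt 2 = 2" using fk by simp
  then show False by (simp add: cycle_elt_def Transposition.transpose_def)
qed

lemma elusive_icos:
  assumes A: "A \<in> {{1, 2}, {1, 2, 3, 4}}" and B: "icos\<lparr>carrier := klein_elt ` A\<rparr> \<cong> B"
    and n: "n * card A = 900"
  shows "\<exists>H N. elusive n H \<and> N \<lhd> perm_group n H \<and>
    perm_group n H\<lparr>carrier := N\<rparr> \<cong> elem_ab 3 4 \<times>\<times> elem_ab 5 3 \<and>
    perm_group n H Mod N \<cong> alt_group 5 \<and> \<not> splits_over (perm_group n H) N \<and>
    is_semidirect_product (perm_group n (point_stabilizer H)) (elem_ab 3 3 \<times>\<times> elem_ab 5 2) B"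
proof (rule elusive_representation[OF group_icos finite_icos stab_subgroup[OF A]])
  have "card A > 0" using A by auto
  then show "card (rcosets\<^bsub>icos\<^esub> stab A) = n"
    using card_rcosets_stab[OF A] n by (metis mult_right_cancel not_gr_zero)
  show "fst ` carrier icos = carrier (alt_group 5)" by (simp add: fst_surj)
  show "icos\<lparr>carrier := kernel icos (alt_group 5) fst\<rparr> \<cong> elem_ab 3 4 \<times>\<times> elem_ab 5 3"
    using kernel_iso unfolding kernel_fst .
qed (use stab_core_free[OF A] conj_stab_prime_order[OF _ _ A] alt_group_is_group fst_hom icos_not_split
    stab_semidirect[OF A B] in blast)+

theorem theorem1p4:
  shows "(\<exists>H N. elusive 225 H \<and>
            N \<lhd> perm_group 225 H \<and>
            perm_group 225 H\<lparr>carrier := N\<rparr> \<cong> elem_ab 3 4 \<times>\<times> elem_ab 5 3 \<and>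
            perm_group 225 H Mod N \<cong> alt_group 5 \<and>
            \<not> splits_over (perm_group 225 H) N \<and>
            is_semidirect_product (perm_group 225 (point_stabilizer H))
              (elem_ab 3 3 \<times>\<times> elem_ab 5 2) (elem_ab 2 2))
       \<and> (\<exists>H N. elusive 450 H \<and>
            N \<lhd> perm_group 450 H \<and>
            perm_group 450 H\<lparr>carrier := N\<rparr> \<cong> elem_ab 3 4 \<times>\<times> elem_ab 5 3 \<and>
            perm_group 450 H Mod N \<cong> alt_group 5 \<and>
            \<not> splits_over (perm_group 450 H) N \<and>
            is_semidirect_product (perm_group 450 (point_stabilizer H))
              (elem_ab 3 3 \<times>\<times> elem_ab 5 2) (elem_ab 2 1))"
  using elusive_icos[OF _ klein_elts_iso(2), of 225] elusive_icos[OF _ klein_elts_iso(1), of 450]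
  by (intro conjI) simp_all

end
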